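(* Let $n\ge 1$ and let $\alpha\in\Lambda_n$ be written as $$\alpha=(\underbrace{\gamma_1,\ldots,\gamma_1}_{m_1},\ldots,\underbrace{\gamma_r,\ldots,\gamma_r}_{m_r}),\qquad \gamma_1>\cdots>\gamma_r,\ m_j>0,\ \sum_j m_j=n .$$ Then $$\mu(\pi^\alpha,\pi^\alpha)=q^{\,2n(\alpha)+\frac12|\alpha|+\frac12\#\{i\,:\,\alpha_i\text{ is odd}\}}\ \prod_{j=1}^r c_j,\qquad c_j=\begin{cases} w_{m_j}(-q^{-1}) & \text{if }\gamma_j\text{ is even},\\ w_{m_j/2}(q^{-4}) & \text{if }\gamma_j\text{ is odd},\end{cases}$$ where $n(\alpha)=\sum_{i=1}^n (i-1)\alpha_i$, $|\alpha|=\sum_{i=1}^n\alpha_i$ and $w_m(t)=\prod_{i=1}^m(1-t^i)$.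
   Context: $k$ is a $\mathfrak p$-adic field of odd residual characteristic with ring of integers $\mathfrak o$, prime element $\pi$, $\mathfrak p=\pi\mathfrak o$, $q=\#(\mathfrak o/\mathfrak p)$. $D$ is the division quaternion algebra over $k$ with canonical involution $*$, $\mathcal O$ its maximal order, $\mathcal P$ the maximal ideal of $\mathcal O$; $\varPi\in D$ is a prime element with $\varPi^2=\pi$ and $\varPi\epsilon=-\epsilon\varPi$, where $k(\epsilon)\subset D$ is an unramified quadratic extension of $k$ with $\epsilon^2\in\mathfrak o^\times$. For a matrix $A=(a_{ij})$ over $D$, $A^*=(a_{ji}^* )$. $X_n=\{A\in GL_n(D): A^*=A\}$, $X_n^+=X_n\cap M_n(\mathcal O)$, and $A[u]=u^*Au$. $\Lambda_n$ is the set of $\alpha\in\mathbb Z^n$ with $\alpha_1\ge\cdots\ge\alpha_n$ such that whenever $\alpha_i$ is odd, $\#\{j:\alpha_j=\alpha_i\}$ is even. For $\alpha\in\Lambda_n$ with distinct values $\gamma_1>\cdots>\gamma_r$ of multiplicities $m_1,\dots,m_r$, $\pi^\alpha\in X_n$ is the block-diagonal matrix with $j$-th block $\pi^e 1_{m_j}$ if $\gamma_j=2e$, and the block-diagonal sum of $m_j/2$ copies of $\begin{pmatrix}0&\pi^e\varPi\\-\pi^e\varPi&0\end{pmatrix}$ if $\gamma_j=2e+1$. Local densities: for $A\in X_m^+$, $B\in X_n^+$, $m\ge n$, $$\mu(B,A)=\lim_{\ell\to\infty}\frac{N_\ell(B,A)}{q^{\ell n(4m-2n+1)+n(n-1)}},\quad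 N_\ell(B,A)=\#\{\overline u\in M_{mn}(\mathcal O)/M_{mn}(\mathcal P^{2\ell}) : A[u]-B\in M_n(\mathcal P^{2\ell-1})\}$$ (the ratio is constant for large $\ell$). For general $A\in X_m$, $B\in X_n$, choose $e\in\mathbb N$ with $\pi^eA\in X_m^+$, $\pi^eB\in X_n^+$ and set $\mu(B,A)=q^{-en(2n-1)}\mu(\pi^eB,\pi^eA)$, which is independent of $e$. *)

theory Defs
  imports
    Complex_Main
    "HOL-Computational_Algebra.Polynomial"
    "HOL-Computational_Algebra.Primes"
    "Jordan_Normal_Form.Matrix"
begin

section \<open>The base field\<close>

text \<open>
  A $\mathfrak p$-adic field is a field of characteristic zero that is complete with respect to
  a discrete valuation with finite residue field. Here \<open>v\<close> is the normalised additive
  valuation; its value at \<open>0\<close> (mathematically \<open>\<infinity>\<close>) is left unspecified, so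
  \<open>v x \<ge> N\<close> is always guarded by \<open>x = 0 \<or> \<dots>\<close>.
\<close>

definition prime_pow :: "('k::field \<Rightarrow> int) \<Rightarrow> int \<Rightarrow> 'k set" where
  "prime_pow v N = {x. x = 0 \<or> N \<le> v x}"

abbreviation val_ring :: "('k::field \<Rightarrow> int) \<Rightarrow> 'k set" where
  "val_ring v \<equiv> prime_pow v 0"

abbreviation val_ideal :: "('k::field \<Rightarrow> int) \<Rightarrow> 'k set" where
  "val_ideal v \<equiv> prime_pow v 1"

definition residue_field :: "('k::field \<Rightarrow> int) \<Rightarrow> 'k set set" where
  "residue_field v =
     val_ring v // {(x, y). x \<in> val_ring v \<and> y \<in> val_ring v \<and> x - y \<in> val_ideal v}"

definition residue_card :: "('k::field \<Rightarrow> int) \<Rightarrow> nat" where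
  "residue_card v = card (residue_field v)"

locale padic_field =
  fixes v :: "'k::field_char_0 \<Rightarrow> int"
  assumes v_mult: "\<lbrakk>x \<noteq> 0; y \<noteq> 0\<rbrakk> \<Longrightarrow> v (x * y) = v x + v y"
    and v_add: "\<lbrakk>x \<noteq> 0; y \<noteq> 0; x + y \<noteq> 0\<rbrakk> \<Longrightarrow> min (v x) (v y) \<le> v (x + y)"
    and v_normalised: "\<exists>x. x \<noteq> 0 \<and> v x = 1"
    and complete:
      "\<And>X :: nat \<Rightarrow> 'k.
        (\<forall>N. \<exists>M. \<forall>i\<ge>M. \<forall>j\<ge>M. X i - X j \<in> prime_pow v N) \<Longrightarrow>
        (\<exists>L. \<forall>N. \<exists>M. \<forall>i\<ge>M. X i - L \<in> prime_pow v N)"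
    and finite_residue_field: "finite (residue_field v)"

locale padic_field_odd = padic_field v for v :: "'k::field_char_0 \<Rightarrow> int" +
  assumes odd_residue_char: "\<exists>p. prime p \<and> odd p \<and> of_nat p \<in> val_ideal v"

section \<open>Quaternion algebras, orders and ideals\<close>

locale division_quaternion_algebra = vector_space scale
  for scale :: "'k::field \<Rightarrow> 'd::division_ring \<Rightarrow> 'd" +
  assumes scale_mult_left: "scale a x * y = scale a (x * y)"
    and scale_mult_right: "x * scale a y = scale a (x * y)"
    and central: "(\<forall>y. x * y = y * x) \<Longrightarrow> \<exists>a. x = scale a 1"
    and dim_4: "dim UNIV = 4"

text \<open>
  The canonical involution of a quaternion algebra is its unique standard involution, i.e. the
  unique linear anti-automorphism of order at most two all of whose norms \<open>x * star x\<close>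
  (hence also all traces \<open>x + star x\<close>) are scalars.
\<close>

locale canonical_involution = division_quaternion_algebra scale
  for scale :: "'k::field \<Rightarrow> 'd::division_ring \<Rightarrow> 'd"
    and star :: "'d \<Rightarrow> 'd" +
  assumes star_add: "star (x + y) = star x + star y"
    and star_scale: "star (scale a x) = scale a (star x)"
    and star_one: "star 1 = 1"
    and star_mult: "star (x * y) = star y * star x"
    and star_star: "star (star x) = x"
    and star_norm: "\<exists>a. x * star x = scale a 1"

definition is_order ::
  "('k::field \<Rightarrow> int) \<Rightarrow> ('k \<Rightarrow> 'd::division_ring \<Rightarrow> 'd) \<Rightarrow> 'd set \<Rightarrow> bool" where
  "is_order v scale R \<longleftrightarrow>
     1 \<in> R \<and> (\<forall>x\<in>R. \<forall>y\<in>R. x - y \<in> R \<and> x * y \<in> R) \<and>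
     (\<exists>S. finite S \<and> R = {\<Sum>s\<in>S. scale (c s) s | c. \<forall>s\<in>S. c s \<in> val_ring v}) \<and>
     (\<forall>x. \<exists>S c. finite S \<and> S \<subseteq> R \<and> x = (\<Sum>s\<in>S. scale (c s) s))"

definition is_maximal_order ::
  "('k::field \<Rightarrow> int) \<Rightarrow> ('k \<Rightarrow> 'd::division_ring \<Rightarrow> 'd) \<Rightarrow> 'd set \<Rightarrow> bool" where
  "is_maximal_order v scale R \<longleftrightarrow>
     is_order v scale R \<and> (\<forall>R'. is_order v scale R' \<and> R \<subseteq> R' \<longrightarrow> R' = R)"

definition is_two_sided_ideal :: "'d::ring_1 set \<Rightarrow> 'd set \<Rightarrow> bool" where
  "is_two_sided_ideal R I \<longleftrightarrow>
     I \<subseteq> R \<and> 0 \<in> I \<and> (\<forall>x\<in>I. \<forall>y\<in>I. x - y \<in> I) \<and>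
     (\<forall>r\<in>R. \<forall>x\<in>I. r * x \<in> I \<and> x * r \<in> I)"

definition is_maximal_ideal :: "'d::ring_1 set \<Rightarrow> 'd set \<Rightarrow> bool" where
  "is_maximal_ideal R I \<longleftrightarrow>
     is_two_sided_ideal R I \<and> I \<noteq> R \<and>
     (\<forall>J. is_two_sided_ideal R J \<and> I \<subseteq> J \<longrightarrow> J = I \<or> J = R)"

definition ideal_mult :: "'d::ring_1 set \<Rightarrow> 'd set \<Rightarrow> 'd set" where
  "ideal_mult I J = {\<Sum>i<(N::nat). f i * g i | N f g. \<forall>i<N. f i \<in> I \<and> g i \<in> J}"

primrec ideal_power :: "'d::ring_1 set \<Rightarrow> 'd set \<Rightarrow> nat \<Rightarrow> 'd set" where
  "ideal_power R I 0 = R"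
| "ideal_power R I (Suc l) = ideal_mult I (ideal_power R I l)"

section \<open>Unramified quadratic subfields\<close>

definition integral_over ::
  "('k::field \<Rightarrow> int) \<Rightarrow> ('k \<Rightarrow> 'd::division_ring \<Rightarrow> 'd) \<Rightarrow> 'd \<Rightarrow> bool" where
  "integral_over v scale x \<longleftrightarrow>
     (\<exists>f :: 'k poly. lead_coeff f = 1 \<and> (\<forall>i. coeff f i \<in> val_ring v) \<and>
        (\<Sum>i\<le>degree f. scale (coeff f i) (x ^ i)) = 0)"

definition integers_of ::
  "('k::field \<Rightarrow> int) \<Rightarrow> ('k \<Rightarrow> 'd::division_ring \<Rightarrow> 'd) \<Rightarrow> 'd set \<Rightarrow> 'd set" where
  "integers_of v scale K = {x \<in> K. integral_over v scale x}"

text \<open>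
  A finite extension \<open>K\<close> of a $\mathfrak p$-adic field is unramified iff a prime element
  \<open>\<pi>\<close> of the base field still generates the maximal ideal (the non-units) of the ring of
  integers of \<open>K\<close>.
\<close>

definition unramified ::
  "('k::field \<Rightarrow> int) \<Rightarrow> ('k \<Rightarrow> 'd::division_ring \<Rightarrow> 'd) \<Rightarrow> 'k \<Rightarrow> 'd set \<Rightarrow> bool" where
  "unramified v scale \<pi> K \<longleftrightarrow>
     {x \<in> integers_of v scale K. \<forall>y \<in> integers_of v scale K. x * y \<noteq> 1} =
     scale \<pi> ` integers_of v scale K"

section \<open>Quaternion hermitian matrices and local densities\<close>

text \<open>
  \<open>\<O>\<close> is the maximal order, \<open>\<P>\<close> its maximal ideal, \<open>\<pi>\<close> and \<open>\<Theta>\<close> are the prime elements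
  of the field and of the division algebra (the latter replaces the letter \<open>\<Pi>\<close>, which is binder syntax). As \<open>\<epsilon>\<^sup>2\<close> is a scalar,
  the field generated by \<open>\<epsilon>\<close> is the linear span of \<open>1\<close> and \<open>\<epsilon>\<close>.
\<close>

locale padic_quaternion =
  padic_field_odd v + canonical_involution scale star
  for v :: "'k::field_char_0 \<Rightarrow> int"
    and scale :: "'k \<Rightarrow> 'd::division_ring \<Rightarrow> 'd"
    and star :: "'d \<Rightarrow> 'd" +
  fixes \<O> :: "'d set"
    and \<P> :: "'d set"
    and \<pi> :: 'k
    and \<Theta> :: 'd
    and \<epsilon> :: 'd
  assumes maximal_order: "is_maximal_order v scale \<O>"
    and maximal_ideal: "is_maximal_ideal \<O> \<P>"
    and prime_element: "\<pi> \<noteq> 0" "v \<pi> = 1"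
    and eps_square: "\<exists>d. d \<noteq> 0 \<and> v d = 0 \<and> \<epsilon>\<^sup>2 = scale d 1"
    and eps_quadratic: "dim (span {1, \<epsilon>}) = 2"
    and eps_unramified: "unramified v scale \<pi> (span {1, \<epsilon>})"
    and Theta_prime: "\<P> = (\<lambda>x. \<Theta> * x) ` \<O>"
    and Theta_square: "\<Theta>\<^sup>2 = scale \<pi> 1"
    and Theta_eps: "\<Theta> * \<epsilon> = - (\<epsilon> * \<Theta>)"
begin

definition q :: nat where
  "q = residue_card v"

definition adjoint :: "'d mat \<Rightarrow> 'd mat" where
  "adjoint A = map_mat star (transpose_mat A)"

definition act :: "'d mat \<Rightarrow> 'd mat \<Rightarrow> 'd mat" where
  "act A u = adjoint u * A * u"

definition matrices_over :: "nat \<Rightarrow> nat \<Rightarrow> 'd set \<Rightarrow> 'd mat set" where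
  "matrices_over m n S = {u \<in> carrier_mat m n. \<forall>i<m. \<forall>j<n. u $$ (i, j) \<in> S}"

definition X :: "nat \<Rightarrow> 'd mat set" where
  "X n = {A \<in> carrier_mat n n. invertible_mat A \<and> adjoint A = A}"

definition X_int :: "nat \<Rightarrow> 'd mat set" where
  "X_int n = X n \<inter> matrices_over n n \<O>"

text \<open>
  The count is over classes of matrices modulo $\mathcal P^{2\ell}$. For integral \<open>A\<close> the
  condition on \<open>u\<close> depends only on its class, so the solution set is a union of classes.
\<close>

definition N_sol :: "nat \<Rightarrow> nat \<Rightarrow> nat \<Rightarrow> 'd mat \<Rightarrow> 'd mat \<Rightarrow> nat" where
  "N_sol m n l B A =
     card ({u \<in> matrices_over m n \<O>. act A u - B \<in> matrices_over n n (ideal_power \<O> \<P> (2*l - 1))} //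
       {(u, w). u \<in> matrices_over m n \<O> \<and> w \<in> matrices_over m n \<O> \<and>
                u - w \<in> matrices_over m n (ideal_power \<O> \<P> (2*l))})"

text \<open>For \<open>A\<close> in \<open>X_int m\<close> and \<open>B\<close> in \<open>X_int n\<close>, where \<open>n \<le> m\<close>.\<close>

definition density_int :: "nat \<Rightarrow> nat \<Rightarrow> 'd mat \<Rightarrow> 'd mat \<Rightarrow> real" where
  "density_int m n B A =
     lim (\<lambda>l. real (N_sol m n l B A) / real q ^ (l * n * (4*m - 2*n + 1) + n * (n - 1)))"

text \<open>
  For \<open>A\<close> in \<open>X m\<close> and \<open>B\<close> in \<open>X n\<close>, where \<open>n \<le> m\<close>; any clearing exponent \<open>e\<close> gives the
  same value.
\<close>

definition density :: "nat \<Rightarrow> nat \<Rightarrow> 'd mat \<Rightarrow> 'd mat \<Rightarrow> real" where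
  "density m n B A =
     (let e = (SOME e. map_mat (scale (\<pi> ^ e)) A \<in> X_int m \<and>
                       map_mat (scale (\<pi> ^ e)) B \<in> X_int n)
      in density_int m n (map_mat (scale (\<pi> ^ e)) B) (map_mat (scale (\<pi> ^ e)) A)
           / real q ^ (e * n * (2*n - 1)))"

text \<open>
  The block of \<open>\<pi>\<^sup>\<alpha>\<close> of size \<open>m\<close> for the value \<open>g\<close>; since \<open>div\<close> on integers rounds
  down, \<open>g div 2\<close> is the exponent \<open>e\<close> for \<open>g = 2e\<close> and for \<open>g = 2e + 1\<close>, also if \<open>g < 0\<close>.
\<close>

definition pi_block :: "int \<Rightarrow> nat \<Rightarrow> 'd mat" where
  "pi_block g m =
     (let c = \<pi> powi (g div 2)
      in if even g then scale c 1 \<cdot>\<^sub>m 1\<^sub>m m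
         else diag_block_mat (replicate (m div 2)
                (mat_of_rows_list 2 [[0, scale c \<Theta>], [- scale c \<Theta>, 0]])))"

definition pi_pow :: "int list \<Rightarrow> 'd mat" where
  "pi_pow \<alpha> =
     diag_block_mat (map (\<lambda>g. pi_block g (count_list \<alpha> g)) (rev (sorted_list_of_set (set \<alpha>))))"

end

section \<open>Index set and right-hand side\<close>

definition Lambda :: "nat \<Rightarrow> int list set" where
  "Lambda n = {\<alpha>. length \<alpha> = n \<and> sorted_wrt (\<ge>) \<alpha> \<and>
     (\<forall>i<n. odd (\<alpha> ! i) \<longrightarrow> even (card {j. j < n \<and> \<alpha> ! j = \<alpha> ! i}))}"

text \<open>List positions start at \<open>0\<close>, so the weight \<open>i - 1\<close> of the \<open>i\<close>-th part becomes \<open>i\<close>.\<close>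

definition n_stat :: "int list \<Rightarrow> int" where
  "n_stat \<alpha> = (\<Sum>i<length \<alpha>. int i * \<alpha> ! i)"

definition w_poly :: "nat \<Rightarrow> real \<Rightarrow> real" where
  "w_poly m t = (\<Prod>i=1..m. 1 - t ^ i)"

end

theory Submission
  imports Defs
begin

text \<open>
  After scaling, \<open>\<pi>\<^sup>\<alpha>\<close> is an integral monomial matrix \<open>A\<close> with entries \<open>\<plusminus>\<Theta>\<^sup>\<alpha>\<^sup>i\<close>. The integral \<open>u\<close> for which
  \<open>A\<^sup>-\<^sup>1 u\<^sup>* A\<close> is integral too form a ring, given by lower bounds on the valuations of the entries,
  and every solution of \<open>A[u] \<equiv> A\<close> modulo a high power of \<open>\<P>\<close> lies in this ring. By Newton
  iteration, right translation identifies all fibres of \<open>u \<mapsto> A[u]\<close> over the forms congruent to \<open>A\<close>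
  modulo the radical. So the number of solutions is the number of \<open>u\<close> with \<open>A[u]\<close> congruent to \<open>A\<close>
  modulo the radical, divided by the number of these forms. The latter number is an index of
  lattices. The former is one too, up to the orders of the isometry groups of the diagonal blocks
  over the residue field with \<open>q\<^sup>2\<close> elements: unitary groups for the even parts of \<open>\<alpha>\<close>, symplectic groups
  for the odd ones, because conjugation by \<open>\<Theta>\<close> and \<open>*\<close> induce the same automorphism of this field.
  These orders are found by extending orthonormal and symplectic frames one step at a time.
\<close>

section \<open>Cosets and their representatives\<close>

text \<open>The obstacle is the radical of the ring: Newton iteration needs a filtration in which
  products add levels, and integral entry bounds do not supply one directly. The valuation is
  therefore refined to steps of \<open>1 / N\<close>. With \<open>d = a j - a i\<close>, the bound
  for an entry is \<open>d - d / N\<close> when \<open>d\<close> is positive and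
  \<open>d / N\<close> when it is negative. These bounds are subadditive, a shift by
  \<open>1 / N\<close> gives the next level, and after rounding up levels 0 and 1 are the ring and
  its radical. The exponent of \<open>q\<close> arises as follows. A block of size \<open>m\<close>
  contributes \<open>m^2\<close> through its unitary group, or \<open>m^2 + m\<close> through its
  symplectic group. Since diagonal entries of a hermitian matrix are scalars, whose valuation in the
  algebra is even, the lattice of forms contributes \<open>a j div 2\<close> for each
  \<open>j\<close>; each pair of indices contributes twice its smaller exponent. The sum of all
  \<open>a j div 2\<close> plus the number of odd \<open>a j\<close> is half of the sum of the
  \<open>a j\<close> plus half of that number, and this is the last term of the exponent.\<close>

definition subgrp :: "'a::ab_group_add set \<Rightarrow> bool" where
  "subgrp H \<longleftrightarrow> 0 \<in> H \<and> (\<forall>x\<in>H. \<forall>y\<in>H. x - y \<in> H)"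

text \<open>The predicate is the same for all \<open>x\<close> in a coset of \<open>H\<close>, so
  the choice operator picks one element per coset and equality of cosets becomes equality of
  values.\<close>

definition rep :: "'a::ab_group_add set \<Rightarrow> 'a \<Rightarrow> 'a" where
  "rep H x = (SOME y. y - x \<in> H)"

text \<open>The number of cosets of \<open>H\<close> that meet \<open>S\<close>, which is the index
  when \<open>H\<close> is a subgroup of \<open>S\<close>. As \<open>card\<close> is 0 on infinite
  sets, finiteness is carried along separately.\<close>

definition ncl :: "'a::ab_group_add set \<Rightarrow> 'a set \<Rightarrow> nat" where
  "ncl H S = card (rep H ` S)"

lemma subgrp_zero: "subgrp H \<Longrightarrow> 0 \<in> H"
  and subgrp_diff: "subgrp H \<Longrightarrow> x \<in> H \<Longrightarrow> y \<in> H \<Longrightarrow> x - y \<in> H"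
  by (auto simp: subgrp_def)

lemma subgrp_minus: "subgrp H \<Longrightarrow> x \<in> H \<Longrightarrow> - x \<in> H"
  using subgrp_diff[of H 0 x] by (simp add: subgrp_zero)

lemma subgrp_add: "subgrp H \<Longrightarrow> x \<in> H \<Longrightarrow> y \<in> H \<Longrightarrow> x + y \<in> H"
  using subgrp_diff[of H x "- y"] by (simp add: subgrp_minus)

lemma subgrp_sum: "subgrp H \<Longrightarrow> (\<And>i. i \<in> I \<Longrightarrow> f i \<in> H) \<Longrightarrow> sum f I \<in> H"
  by (induction I rule: infinite_finite_induct) (auto simp: subgrp_zero subgrp_add)

lemma subgrp_diff_commute: "subgrp H \<Longrightarrow> x - y \<in> H \<longleftrightarrow> y - x \<in> H"
  using subgrp_minus[of H "x - y"] subgrp_minus[of H "y - x"] by auto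

lemma subgrp_diff_trans: "subgrp H \<Longrightarrow> x - y \<in> H \<Longrightarrow> y - z \<in> H \<Longrightarrow> x - z \<in> H"
  using subgrp_add[of H "x - y" "y - z"] by simp

lemma subgrp_diff_right: "subgrp H \<Longrightarrow> x - y \<in> H \<Longrightarrow> x \<in> H \<longleftrightarrow> y \<in> H"
  using subgrp_diff[of H x "x - y"] subgrp_add[of H "x - y" y] by auto

lemma rep_diff: assumes "subgrp H" shows "rep H x - x \<in> H"
proof -
  have "\<exists>y. y - x \<in> H" using assms by (intro exI[of _ x]) (simp add: subgrp_zero)
  then show ?thesis unfolding rep_def by (rule someI_ex)
qed

lemma rep_eq_iff: assumes "subgrp H" shows "rep H x = rep H y \<longleftrightarrow> x - y \<in> H"
proof
  assume "rep H x = rep H y"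
  then show "x - y \<in> H"
    using subgrp_diff[OF assms rep_diff[OF assms, of y] rep_diff[OF assms, of x]] by simp
next
  assume a: "x - y \<in> H"
  have "z - x \<in> H \<longleftrightarrow> z - y \<in> H" for z
    using subgrp_diff_right[OF assms, of "z - y" "z - x"] a by auto
  then show "rep H x = rep H y" unfolding rep_def by simp
qed

lemma rep_rep: "subgrp H \<Longrightarrow> rep H (rep H x) = rep H x"
  by (simp add: rep_eq_iff rep_diff)

text \<open>Sending \<open>f x\<close> to \<open>g x\<close> is a well-defined bijection of the
  images. Cosets, tuples of representatives and equivalence classes are compared in this
  way.\<close>

lemma card_image_eq_kernel:
  assumes "\<And>x y. x \<in> S \<Longrightarrow> y \<in> S \<Longrightarrow> f x = f y \<longleftrightarrow> g x = g y"
  shows "card (f ` S) = card (g ` S)" and "finite (f ` S) \<longleftrightarrow> finite (g ` S)"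
proof -
  define h where "h y = g (SOME x. x \<in> S \<and> f x = y)" for y
  have hf: "h (f x) = g x" if "x \<in> S" for x
  proof -
    have "(SOME z. z \<in> S \<and> f z = f x) \<in> S \<and> f (SOME z. z \<in> S \<and> f z = f x) = f x"
      by (rule someI[of _ x]) (simp add: that)
    then show ?thesis unfolding h_def using assms that by blast
  qed
  have "bij_betw h (f ` S) (g ` S)"
    unfolding bij_betw_def
  proof
    show "inj_on h (f ` S)" by (auto intro!: inj_onI simp: hf assms)
    show "h ` f ` S = g ` S" by (force simp: hf)
  qed
  then show "card (f ` S) = card (g ` S)" "finite (f ` S) \<longleftrightarrow> finite (g ` S)"
    by (auto simp: bij_betw_same_card bij_betw_finite)
qed

text \<open>The map \<open>k\<close> descends to an injection of classes. It serves for right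
  translations of matrices.\<close>

lemma card_image_le_kernel:
  assumes "finite (g ` S')" "\<And>x. x \<in> S \<Longrightarrow> k x \<in> S'"
    and "\<And>x y. x \<in> S \<Longrightarrow> y \<in> S \<Longrightarrow> g (k x) = g (k y) \<longleftrightarrow> g x = g y"
  shows "card (g ` S) \<le> card (g ` S')"
proof -
  have "card (g ` S) = card ((\<lambda>x. g (k x)) ` S)"
    by (rule card_image_eq_kernel) (use assms in auto)
  also have "\<dots> \<le> card (g ` S')" using assms by (intro card_mono) auto
  finally show ?thesis .
qed

text \<open>The second hypothesis says that \<open>g\<close> factors through \<open>f\<close>, so
  each class of \<open>f\<close> lies over a single value of \<open>g\<close>.\<close>

lemma card_fibres:
  assumes "finite (f ` S)" "\<And>x y. x \<in> S \<Longrightarrow> y \<in> S \<Longrightarrow> f x = f y \<Longrightarrow> g x = g y"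
  shows "card (f ` S) = (\<Sum>y \<in> g ` S. card (f ` {x \<in> S. g x = y}))"
proof -
  have fin: "finite (g ` S)"
  proof -
    obtain h where "\<And>x. x \<in> S \<Longrightarrow> h (f x) = g x"
    proof
      fix x assume x: "x \<in> S"
      have "(SOME z. z \<in> S \<and> f z = f x) \<in> S \<and> f (SOME z. z \<in> S \<and> f z = f x) = f x"
        by (rule someI[of _ x]) (simp add: x)
      then show "(\<lambda>y. g (SOME x. x \<in> S \<and> f x = y)) (f x) = g x" using assms(2) x by blast
    qed
    then have "g ` S = h ` (f ` S)" by force
    then show ?thesis using assms(1) by simp
  qed
  have eq: "f ` S = (\<Union>y\<in>g ` S. f ` {x \<in> S. g x = y})" by auto
  show ?thesis unfolding eq
  proof (rule card_UN_disjoint[OF fin])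
    show "\<forall>i\<in>g ` S. finite (f ` {x \<in> S. g x = i})"
      using assms(1) by (auto intro: finite_subset[OF _ assms(1)])
    show "\<forall>i\<in>g ` S. \<forall>j\<in>g ` S. i \<noteq> j \<longrightarrow> f ` {x \<in> S. g x = i} \<inter> f ` {x \<in> S. g x = j} = {}"
      by (auto dest: assms(2))
  qed
qed

text \<open>Multiplicativity of the index: every class of \<open>S\<close> modulo \<open>H\<close>
  is that of \<open>rep K x + rep H k\<close> for exactly one pair of representatives, and
  \<open>sat\<close> keeps these sums in \<open>S\<close>.\<close>

lemma ncl_tower:
  assumes H: "subgrp H" and K: "subgrp K" and HK: "H \<subseteq> K"
    and sat: "\<And>x k. x \<in> S \<Longrightarrow> k \<in> K \<Longrightarrow> x + k \<in> S"
  shows "ncl H S = ncl K S * ncl H K"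
    and "finite (rep K ` S) \<Longrightarrow> finite (rep H ` K) \<Longrightarrow> finite (rep H ` S)"
proof -
  let ?m = "\<lambda>(a, b). rep H (a + b)"
  have inj: "inj_on ?m (rep K ` S \<times> rep H ` K)"
  proof (rule inj_onI, clarify)
    fix x k x' k' assume *: "x \<in> S" "x' \<in> S" "k \<in> K" "k' \<in> K"
      and "rep H (rep K x + rep H k) = rep H (rep K x' + rep H k')"
    then have d: "rep K x + rep H k - (rep K x' + rep H k') \<in> H" by (simp add: rep_eq_iff H)
    have rk: "rep H k \<in> K" "rep H k' \<in> K"
      using rep_diff[OF H] HK * subgrp_diff_right[OF K] by blast+
    have e: "rep K x - rep K x' = (rep K x + rep H k - (rep K x' + rep H k')) - (rep H k - rep H k')"
      by (simp add: algebra_simps)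
    have "rep K x - rep K x' \<in> K"
      by (subst e) (use subgrp_diff[OF K subsetD[OF HK d] subgrp_diff[OF K rk]] in simp)
    then have "rep K (rep K x) = rep K (rep K x')" by (simp add: rep_eq_iff K)
    then have 1: "rep K x = rep K x'" by (simp add: rep_rep K)
    with d have "rep H (rep H k) = rep H (rep H k')" by (simp add: rep_eq_iff H)
    with 1 show "rep K x = rep K x' \<and> rep H k = rep H k'" by (simp add: rep_rep H)
  qed
  have img: "?m ` (rep K ` S \<times> rep H ` K) = rep H ` S"
  proof (intro subset_antisym subsetI)
    fix y assume "y \<in> ?m ` (rep K ` S \<times> rep H ` K)"
    then obtain x k where *: "x \<in> S" "k \<in> K" "y = rep H (rep K x + rep H k)" by auto
    have "rep H k \<in> K" using rep_diff[OF H] HK * subgrp_diff_right[OF K] by blast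
    then have "(rep K x - x) + rep H k \<in> K" by (intro subgrp_add[OF K] rep_diff[OF K])
    from sat[OF *(1) this] show "y \<in> rep H ` S" unfolding *(3) by (auto simp: algebra_simps)
  next
    fix y assume "y \<in> rep H ` S"
    then obtain x where *: "x \<in> S" "y = rep H x" by auto
    have "x - rep K x \<in> K" using rep_diff[OF K, of x] subgrp_diff_commute[OF K] by blast
    moreover have "rep H x = rep H (rep K x + rep H (x - rep K x))"
      using rep_diff[OF H, of "x - rep K x"]
        subgrp_diff_commute[OF H, of "rep H (x - rep K x)" "x - rep K x"]
      by (simp add: rep_eq_iff[OF H] diff_diff_add)
    ultimately show "y \<in> ?m ` (rep K ` S \<times> rep H ` K)" unfolding *(2) using *(1) by force
  qed
  show "ncl H S = ncl K S * ncl H K"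
    unfolding ncl_def img[symmetric] card_image[OF inj] by (simp add: card_cartesian_product)
  assume "finite (rep K ` S)" "finite (rep H ` K)"
  then show "finite (rep H ` S)" unfolding img[symmetric] by simp
qed

lemma ncl_transport:
  assumes "subgrp H" "subgrp K"
    and "\<And>x y. x \<in> S \<Longrightarrow> y \<in> S \<Longrightarrow> f x - f y \<in> K \<longleftrightarrow> x - y \<in> H"
  shows "ncl K (f ` S) = ncl H S" and "finite (rep K ` f ` S) \<longleftrightarrow> finite (rep H ` S)"
  using card_image_eq_kernel[of S "\<lambda>x. rep K (f x)" "rep H"] assms
  by (auto simp: ncl_def image_image rep_eq_iff)

section \<open>The base field\<close>

context padic_field
begin

lemma pp_iff: "x \<in> prime_pow v N \<longleftrightarrow> x = 0 \<or> N \<le> v x"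
  by (simp add: prime_pow_def)

lemma v_one: "v 1 = 0"
  using v_mult[of 1 1] by simp

lemma v_minus: "v (- x) = v x"
proof (cases "x = 0")
  case False
  have "v ((- 1) * (- 1)) = v (- 1) + v (- 1)" by (rule v_mult) auto
  then have "v (- 1) = 0" by (simp add: v_one)
  then show ?thesis using v_mult[of "- 1" x] False by simp
qed simp

lemma v_inverse: "x \<noteq> 0 \<Longrightarrow> v (inverse x) = - v x"
  using v_mult[of x "inverse x"] by (simp add: v_one)

lemma v_divide: "x \<noteq> 0 \<Longrightarrow> y \<noteq> 0 \<Longrightarrow> v (x / y) = v x - v y"
  by (simp add: divide_inverse v_mult v_inverse)

lemma v_power: "x \<noteq> 0 \<Longrightarrow> v (x ^ n) = int n * v x"
  by (induction n) (auto simp: v_one v_mult algebra_simps)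

lemma v_power_int: "x \<noteq> 0 \<Longrightarrow> v (x powi n) = n * v x"
  by (auto simp: power_int_def v_power v_inverse)

lemma pp_zero [simp]: "0 \<in> prime_pow v N" by (simp add: pp_iff)

lemma pp_add: "x \<in> prime_pow v N \<Longrightarrow> y \<in> prime_pow v N \<Longrightarrow> x + y \<in> prime_pow v N"
  using v_add[of x y] by (cases "x = 0"; cases "y = 0"; cases "x + y = 0") (auto simp: pp_iff)

lemma pp_minus: "x \<in> prime_pow v N \<Longrightarrow> - x \<in> prime_pow v N"
  by (simp add: pp_iff v_minus)

lemma pp_diff: "x \<in> prime_pow v N \<Longrightarrow> y \<in> prime_pow v N \<Longrightarrow> x - y \<in> prime_pow v N"
  using pp_add[of x N "- y"] pp_minus[of y N] by simp

lemma subgrp_pp: "subgrp (prime_pow v N)"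
  by (simp add: subgrp_def pp_diff)

lemma pp_mult: "x \<in> prime_pow v M \<Longrightarrow> y \<in> prime_pow v N \<Longrightarrow> x * y \<in> prime_pow v (M + N)"
  using v_mult[of x y] by (cases "x = 0"; cases "y = 0") (auto simp: pp_iff)

lemma pp_mono: "M \<le> N \<Longrightarrow> prime_pow v N \<subseteq> prime_pow v M"
  by (auto simp: pp_iff)

lemma pp_one: "1 \<in> val_ring v" by (simp add: pp_iff v_one)

lemma pp_of_nat: "of_nat n \<in> val_ring v"
  by (induction n) (auto intro!: pp_add pp_one)

lemma pp_mult_left_iff: "c \<noteq> 0 \<Longrightarrow> c * x \<in> prime_pow v N \<longleftrightarrow> x \<in> prime_pow v (N - v c)"
  by (cases "x = 0") (auto simp: pp_iff v_mult)

lemma v_add_eq: assumes "x \<noteq> 0" "y \<noteq> 0" "v x < v y" shows "x + y \<noteq> 0" "v (x + y) = v x"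
proof -
  show *: "x + y \<noteq> 0" using assms by (metis add_eq_0_iff less_irrefl v_minus)
  have "v x \<le> v (x + y)" using v_add[OF assms(1,2) *] assms(3) by simp
  moreover have "min (v (x + y)) (v (- y)) \<le> v (x + y + - y)"
    using * assms by (intro v_add) auto
  ultimately show "v (x + y) = v x" using assms(3) by (auto simp: v_minus)
qed

text \<open>Valuations of different parity are different, so the sum has the smaller one and nothing
  cancels. This separates the two halves of the norm form of the algebra.\<close>

lemma pp_parity_add:
  assumes "x = 0 \<or> even (v x)" "y = 0 \<or> odd (v y)"
  shows "x + y \<in> prime_pow v N \<longleftrightarrow> x \<in> prime_pow v N \<and> y \<in> prime_pow v N"
proof -
  consider "x = 0 \<or> y = 0" | "x \<noteq> 0" "y \<noteq> 0" "v x < v y" | "x \<noteq> 0" "y \<noteq> 0" "v y < v x"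
    using assms by (metis not_less_iff_gr_or_eq)
  then show ?thesis
  proof cases
    case 2 then show ?thesis using v_add_eq[of x y] by (auto simp: pp_iff)
  next
    case 3 then show ?thesis using v_add_eq[of y x] by (auto simp: pp_iff add.commute)
  qed auto
qed

lemma residue_card_eq_ncl: "residue_card v = ncl (val_ideal v) (val_ring v)"
  and finite_rep_val_ring: "finite (rep (val_ideal v) ` val_ring v)"
proof -
  let ?r = "{(x, y). x \<in> val_ring v \<and> y \<in> val_ring v \<and> x - y \<in> val_ideal v}"
  have rf: "residue_field v = (\<lambda>x. ?r `` {x}) ` val_ring v"
    by (auto simp: residue_field_def quotient_def)
  have k: "?r `` {x} = ?r `` {y} \<longleftrightarrow> rep (val_ideal v) x = rep (val_ideal v) y"
    if "x \<in> val_ring v" "y \<in> val_ring v" for x y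
  proof -
    have "?r `` {x} = ?r `` {y} \<longleftrightarrow> x - y \<in> val_ideal v"
    proof
      assume "?r `` {x} = ?r `` {y}"
      moreover have "y \<in> ?r `` {y}" using that by simp
      ultimately show "x - y \<in> val_ideal v" by auto
    next
      assume a: "x - y \<in> val_ideal v"
      have "x - z \<in> val_ideal v \<longleftrightarrow> y - z \<in> val_ideal v" for z
        using subgrp_diff_right[OF subgrp_pp, of "x - z" "y - z"] a by auto
      then show "?r `` {x} = ?r `` {y}" using that by auto
    qed
    then show ?thesis by (simp add: rep_eq_iff subgrp_pp)
  qed
  show "residue_card v = ncl (val_ideal v) (val_ring v)"
    unfolding residue_card_def rf ncl_def by (rule card_image_eq_kernel(1)) (rule k)
  show "finite (rep (val_ideal v) ` val_ring v)"
    using finite_residue_field unfolding rf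
    by (subst card_image_eq_kernel(2)[OF k, symmetric]) auto
qed

lemma ncl_pp_Suc:
  shows "ncl (prime_pow v (N + 1)) (prime_pow v N) = residue_card v"
    and "finite (rep (prime_pow v (N + 1)) ` prime_pow v N)"
proof -
  obtain p where p: "p \<noteq> 0" "v p = 1" using v_normalised by blast
  define c where "c = p powi N"
  have c: "c \<noteq> 0" "v c = N" using p by (auto simp: c_def v_power_int)
  have img: "(*) c ` val_ring v = prime_pow v N"
  proof (intro subset_antisym subsetI)
    fix x assume "x \<in> prime_pow v N"
    then have "x / c \<in> val_ring v" using c by (cases "x = 0") (auto simp: pp_iff v_divide)
    then show "x \<in> (*) c ` val_ring v" using c by (intro image_eqI[of _ _ "x / c"]) auto
  qed (use c in \<open>auto simp: pp_mult_left_iff\<close>)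
  have k: "c * x - c * y \<in> prime_pow v (N + 1) \<longleftrightarrow> x - y \<in> val_ideal v" for x y
    unfolding right_diff_distrib[symmetric] using c by (simp add: pp_mult_left_iff)
  note t = ncl_transport[OF subgrp_pp subgrp_pp k, of "val_ring v", unfolded img]
  show "ncl (prime_pow v (N + 1)) (prime_pow v N) = residue_card v"
    using t(1) by (simp add: residue_card_eq_ncl)
  show "finite (rep (prime_pow v (N + 1)) ` prime_pow v N)"
    using t(2) finite_rep_val_ring by simp
qed

lemma ncl_pp_aux:
  "ncl (prime_pow v (N + int k)) (prime_pow v N) = residue_card v ^ k \<and>
   finite (rep (prime_pow v (N + int k)) ` prime_pow v N)"
proof (induction k)
  case 0
  have "rep (prime_pow v N) ` prime_pow v N = {rep (prime_pow v N) 0}"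
    by (auto simp: rep_eq_iff subgrp_pp intro!: image_eqI[of _ _ 0])
  then show ?case by (simp add: ncl_def)
next
  case (Suc k)
  have sub: "prime_pow v (N + int k + 1) \<subseteq> prime_pow v (N + int k)" by (rule pp_mono) simp
  have sat: "x + y \<in> prime_pow v N" if "x \<in> prime_pow v N" "y \<in> prime_pow v (N + int k)" for x y
    using that pp_mono[of N "N + int k"] by (intro pp_add) auto
  note t = ncl_tower[OF subgrp_pp subgrp_pp sub sat]
  show ?case using t Suc ncl_pp_Suc[of "N + int k"] by (simp add: algebra_simps)
qed

lemma ncl_pp:
  assumes "M \<le> N"
  shows "ncl (prime_pow v N) (prime_pow v M) = residue_card v ^ nat (N - M)"
    and "finite (rep (prime_pow v N) ` prime_pow v M)"
  using ncl_pp_aux[of M "nat (N - M)"] assms by auto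

lemma residue_card_pos: "residue_card v > 0"
proof -
  have "0 \<in> val_ring v" by simp
  show ?thesis unfolding residue_card_eq_ncl ncl_def
    using finite_rep_val_ring \<open>0 \<in> val_ring v\<close> by (metis card_gt_0_iff empty_iff image_is_empty)
qed

lemma residue_card_gt_1: "residue_card v > 1"
proof -
  let ?H = "val_ideal v"
  have "rep ?H 0 \<noteq> rep ?H 1" by (simp add: rep_eq_iff subgrp_pp pp_iff v_minus v_one)
  then have "card {rep ?H 0, rep ?H 1} = 2" by simp
  moreover have "{rep ?H 0, rep ?H 1} \<subseteq> rep ?H ` val_ring v" by (auto simp: pp_one)
  ultimately have "2 \<le> card (rep ?H ` val_ring v)"
    using card_mono[OF finite_rep_val_ring] by metis
  then show ?thesis by (simp add: residue_card_eq_ncl ncl_def)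
qed

end

section \<open>Square roots when 2 is a unit\<close>

context padic_field_odd
begin

text \<open>If 2 were in the maximal ideal together with an odd prime \<open>2 * j + 1\<close>, then
  so would be 1.\<close>

lemma v_two: "v 2 = 0"
proof (rule ccontr)
  assume ne: "v 2 \<noteq> 0"
  have "(2::'k) \<in> val_ring v" using pp_of_nat[of 2] by simp
  then have two: "(2::'k) \<in> val_ideal v" using ne by (simp add: pp_iff)
  obtain p where p: "odd p" "of_nat p \<in> val_ideal v" using odd_residue_char by blast
  then obtain j where j: "p = 2 * j + 1" by (elim oddE)
  have "of_nat p - 2 * of_nat j \<in> val_ideal v"
    using pp_diff[OF p(2)] pp_mult[OF two pp_of_nat[of j]] by simp
  then show False by (simp add: j pp_iff v_one)
qed

lemma pp_half: "x / 2 \<in> prime_pow v N \<longleftrightarrow> x \<in> prime_pow v N"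
  by (cases "x = 0") (auto simp: pp_iff v_divide v_two)

text \<open>The root is a fixed point of \<open>y \<mapsto> (z - y^2) / 2\<close>. This map is a
  contraction of the maximal ideal because 2 is a unit, so the iterates from 0 form a Cauchy
  sequence.\<close>

lemma sqrt_one_plus:
  assumes z: "z \<in> val_ideal v"
  shows "\<exists>y. (1 + y)\<^sup>2 = 1 + z"
proof -
  define Y where "Y = rec_nat 0 (\<lambda>_ y. (z - y\<^sup>2) / 2)"
  have Y0: "Y 0 = 0" and YS: "Y (Suc i) = (z - (Y i)\<^sup>2) / 2" for i
    by (simp_all add: Y_def)
  have Yp: "Y i \<in> val_ideal v" for i
  proof (induction i)
    case (Suc i)
    have "Y i * Y i \<in> prime_pow v 2" using pp_mult[OF Suc Suc] by simp
    then have "Y i * Y i \<in> val_ideal v" using pp_mono[of 1 2] by auto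
    then show ?case unfolding YS pp_half by (simp add: power2_eq_square pp_diff z)
  qed (simp add: Y0)
  have step: "(z - x\<^sup>2) / 2 - (z - y\<^sup>2) / 2 \<in> prime_pow v (N + 1)"
    if "x \<in> val_ideal v" "y \<in> val_ideal v" "x - y \<in> prime_pow v N" for x y N
  proof -
    have "(z - x\<^sup>2) / 2 - (z - y\<^sup>2) / 2 = - (((x - y) * (x + y)) / 2)"
      by (simp add: field_simps power2_eq_square)
    moreover have "(x - y) * (x + y) \<in> prime_pow v (N + 1)" by (intro pp_mult pp_add that)
    ultimately show ?thesis by (simp add: pp_minus pp_half)
  qed
  have d1: "Y (Suc i) - Y i \<in> prime_pow v (int i)" for i
  proof (induction i)
    case 0 then show ?case using Yp[of 1] pp_mono[of 0 1] by (auto simp: Y0)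
  next
    case (Suc i)
    have "(z - (Y (Suc i))\<^sup>2) / 2 - (z - (Y i)\<^sup>2) / 2 \<in> prime_pow v (int i + 1)"
      by (rule step[OF Yp Yp Suc])
    then show ?case by (simp only: YS[symmetric]) (simp add: add.commute)
  qed
  have d2: "Y (i + k) - Y i \<in> prime_pow v (int i)" for i k
  proof (induction k)
    case (Suc k)
    have "Y (Suc (i + k)) - Y (i + k) \<in> prime_pow v (int i)"
      using d1[of "i + k"] pp_mono[of "int i" "int (i + k)"] by auto
    from pp_add[OF this Suc] show ?case by simp
  qed simp
  have d3: "Y i - Y j \<in> prime_pow v N" if "i \<ge> nat N" "j \<ge> nat N" for i j N
  proof -
    have "Y i - Y (nat N) \<in> prime_pow v (int (nat N))" "Y j - Y (nat N) \<in> prime_pow v (int (nat N))"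
      using d2[of "nat N" "i - nat N"] d2[of "nat N" "j - nat N"] that by auto
    from pp_diff[OF this] have "Y i - Y j \<in> prime_pow v (int (nat N))" by simp
    then show ?thesis using pp_mono[of N "int (nat N)"] by (metis nat_0_le nat_le_eq_zle linorder_le_cases of_nat_0_le_iff subsetD order_trans)
  qed
  then obtain L where L: "\<forall>N. \<exists>M. \<forall>i\<ge>M. Y i - L \<in> prime_pow v N"
    using complete[of Y] by meson
  have fix0: "L - (z - L\<^sup>2) / 2 \<in> prime_pow v N" if "N \<ge> 1" for N
  proof -
    obtain M where M: "\<forall>i\<ge>M. Y i - L \<in> prime_pow v N" using L by blast
    have m: "L - Y M \<in> prime_pow v N" "L - Y (Suc M) \<in> prime_pow v N"
      using M subgrp_diff_commute[OF subgrp_pp] by auto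
    have "L = (L - Y M) + Y M" by simp
    then have Lp: "L \<in> val_ideal v" using pp_add[of "L - Y M" 1 "Y M"] m(1) Yp[of M] pp_mono[OF that] by auto
    have "(z - L\<^sup>2) / 2 - (z - (Y M)\<^sup>2) / 2 \<in> prime_pow v (N + 1)"
      by (rule step[OF Lp Yp m(1)])
    then have "(z - L\<^sup>2) / 2 - Y (Suc M) \<in> prime_pow v N"
      using pp_mono[of N "N + 1"] by (auto simp: YS)
    from pp_diff[OF m(2) this] show ?thesis by simp
  qed
  \<comment> \<open>A nonzero difference would contradict \<open>fix0\<close> at the level one above
    its own valuation.\<close>
  have "L - (z - L\<^sup>2) / 2 = 0"
    using fix0[of "max 1 (v (L - (z - L\<^sup>2) / 2) + 1)"] by (auto simp: pp_iff)
  then have "(1 + L)\<^sup>2 = 1 + z" by (simp add: field_simps power2_eq_square)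
  then show ?thesis by blast
qed

text \<open>The element \<open>s\<close> is a unit; dividing by \<open>s^2\<close> leaves the square
  root of an element congruent to 1.\<close>

lemma hensel_square:
  assumes "v d = 0" "d \<noteq> 0" "s \<in> val_ring v" "d - s\<^sup>2 \<in> val_ideal v"
  shows "\<exists>r. r\<^sup>2 = d"
proof -
  have s0: "s \<notin> val_ideal v"
  proof
    assume "s \<in> val_ideal v"
    then have "s\<^sup>2 \<in> val_ideal v"
      using pp_mult[of s 1 s 1] pp_mono[of 1 2] by (auto simp: power2_eq_square)
    then have "d \<in> val_ideal v" using subgrp_diff_right[OF subgrp_pp assms(4)] by blast
    then show False using assms by (simp add: pp_iff)
  qed
  then have s: "s \<noteq> 0" "v s = 0" using assms(3) by (auto simp: pp_iff)
  have vs: "v (s\<^sup>2) = 0" using s by (simp add: v_power)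
  have "(d - s\<^sup>2) / s\<^sup>2 \<in> val_ideal v"
    using assms(4) s vs v_divide[of "d - s\<^sup>2" "s\<^sup>2"] by (cases "d = s\<^sup>2") (auto simp: pp_iff)
  then obtain y where "(1 + y)\<^sup>2 = 1 + (d - s\<^sup>2) / s\<^sup>2" using sqrt_one_plus by blast
  then have "(1 + y)\<^sup>2 = d / s\<^sup>2" using s by (simp add: field_simps)
  then have "(s * (1 + y))\<^sup>2 = d" using s by (simp add: power_mult_distrib)
  then show ?thesis by blast
qed

end

section \<open>The division quaternion algebra\<close>

context padic_quaternion
begin

section \<open>Scalars, traces and the subfield generated by \<epsilon>\<close>

definition emb :: "'k \<Rightarrow> 'd" where "emb a = scale a 1"

lemma emb_mult_left: "emb a * x = scale a x"
  by (simp add: emb_def scale_mult_left)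

lemma emb_mult_right: "x * emb a = scale a x"
  by (simp add: emb_def scale_mult_right)

lemma emb_commute: "x * emb a = emb a * x"
  by (simp add: emb_mult_left emb_mult_right)

lemma emb_left_commute: "x * (emb a * y) = emb a * (x * y)"
  by (metis emb_commute mult.assoc)

lemma emb_add: "emb (a + b) = emb a + emb b"
  and emb_diff: "emb (a - b) = emb a - emb b"
  and emb_minus: "emb (- a) = - emb a"
  and emb_zero [simp]: "emb 0 = 0"
  and emb_one [simp]: "emb 1 = 1"
  by (simp_all add: emb_def scale_left_distrib scale_left_diff_distrib scale_minus_left)

lemma emb_mult: "emb (a * b) = emb a * emb b"
  by (simp add: emb_mult_left) (simp add: emb_def)

lemma emb_eq_0_iff [simp]: "emb a = 0 \<longleftrightarrow> a = 0"
  by (simp add: emb_def scale_eq_0_iff)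

lemma emb_eq_iff: "emb a = emb b \<longleftrightarrow> a = b"
  using emb_eq_0_iff[of "a - b"] by (simp add: emb_diff)

lemma star_zero [simp]: "star 0 = 0"
  using star_add[of 0 0] by simp

lemma star_minus: "star (- x) = - star x"
  using star_add[of x "- x"] by (simp add: minus_unique)

lemma star_diff: "star (x - y) = star x - star y"
  using star_add[of x "- y"] by (simp add: star_minus)

lemma star_sum: "star (sum f I) = (\<Sum>i\<in>I. star (f i))"
  by (induction I rule: infinite_finite_induct) (auto simp: star_add)

lemma star_emb [simp]: "star (emb a) = emb a"
  by (simp add: emb_def star_scale star_one)

lemma double_eq_0: assumes "(x::'d) + x = 0" shows "x = 0"
proof -
  have "emb (1 + 1) * x = x + x" by (simp only: emb_add distrib_right) simp
  moreover have "emb (1 + 1) \<noteq> 0" by (subst emb_eq_0_iff) simp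
  ultimately show ?thesis using assms by auto
qed

text \<open>The scalar norms of \<open>x\<close> and \<open>x + 1\<close> differ by the trace of
  \<open>x\<close> plus 1.\<close>

lemma trace_scalar: "\<exists>t. x + star x = emb t"
proof -
  obtain m m' where "x * star x = scale m 1" "(x + 1) * star (x + 1) = scale m' 1"
    using star_norm by meson
  then have "x * star x = emb m" "(x + 1) * (star x + 1) = emb m'"
    by (simp_all add: emb_def star_add star_one)
  then have "x + star x = emb (m' - m - 1)" by (simp add: algebra_simps emb_diff emb_add)
  then show ?thesis by blast
qed

text \<open>With trace \<open>t\<close> and norm \<open>m\<close>, the element satisfies
  \<open>x^2 = t x - m\<close>. As \<open>x^2\<close> is a scalar, so is \<open>t x\<close>, and
  \<open>t\<close> must vanish because \<open>x\<close> is not a scalar.\<close>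

lemma star_pure: assumes "x * x = emb c" "\<And>a. x \<noteq> emb a" shows "star x = - x"
proof -
  obtain t where t: "x + star x = emb t" using trace_scalar by blast
  obtain m where "x * star x = scale m 1" using star_norm by meson
  then have m: "x * star x = emb m" by (simp add: emb_def)
  have sx: "star x = emb t - x" using t by (simp add: algebra_simps)
  have e: "emb t * x = emb (m + c)"
    using m assms(1) by (simp add: sx right_diff_distrib emb_commute emb_add algebra_simps)
  have "t = 0"
  proof (rule ccontr)
    assume "t \<noteq> 0"
    have "emb (1 / t) * (emb t * x) = emb (1 / t) * emb (m + c)" by (simp only: e)
    then have "x = emb (1 / t * (m + c))"
      using \<open>t \<noteq> 0\<close> by (simp add: mult.assoc[symmetric] flip: emb_mult)
    then show False using assms(2) by blast
  qed
  then show ?thesis using sx by simp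
qed

definition dlt :: 'k where "dlt = (SOME d. d \<noteq> 0 \<and> v d = 0 \<and> \<epsilon>\<^sup>2 = scale d 1)"

lemma dlt: "dlt \<noteq> 0" "v dlt = 0" "\<epsilon> * \<epsilon> = emb dlt"
  using someI_ex[OF eps_square, folded dlt_def] by (simp_all add: emb_def power2_eq_square)

lemma eps_not_scalar: "\<epsilon> \<noteq> emb a"
proof
  assume "\<epsilon> = emb a"
  then have "span {1, \<epsilon>} \<subseteq> span {1}"
    by (intro span_minimal subspace_span) (auto simp: emb_def intro: span_base span_scale)
  from dim_le_card[OF this] show False using eps_quadratic by simp
qed

lemma star_eps: "star \<epsilon> = - \<epsilon>"
  by (rule star_pure[OF dlt(3) eps_not_scalar])

lemma Theta_sq: "\<Theta> * \<Theta> = emb \<pi>"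
  using Theta_square by (simp add: power2_eq_square emb_def)

lemma Theta_nonzero [simp]: "\<Theta> \<noteq> 0"
  using Theta_sq prime_element(1) by auto

lemma eps_nonzero [simp]: "\<epsilon> \<noteq> 0"
  using eps_not_scalar[of 0] by simp

text \<open>The elements \<open>a + b \<epsilon>\<close> of the unramified quadratic subfield. The
  algebra is the sum of this field and \<open>\<Theta>\<close> times it, and the valuation is
  computed in these coordinates.\<close>

definition quad :: "'k \<Rightarrow> 'k \<Rightarrow> 'd" where "quad a b = emb a + emb b * \<epsilon>"

lemma quad_diff: "quad a b - quad c d = quad (a - c) (b - d)"
  by (simp add: quad_def emb_diff algebra_simps)

lemma quad_mult: "quad a b * quad c d = quad (a * c + dlt * b * d) (a * d + b * c)"
proof -
  have 1: "emb a * (emb d * \<epsilon>) = emb (a * d) * \<epsilon>" by (simp add: emb_mult mult.assoc)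
  have 2: "emb b * \<epsilon> * emb c = emb (b * c) * \<epsilon>"
    by (simp add: emb_mult mult.assoc emb_commute[of \<epsilon>])
  have "emb b * \<epsilon> * (emb d * \<epsilon>) = emb b * emb d * (\<epsilon> * \<epsilon>)"
    by (simp add: mult.assoc emb_left_commute[of \<epsilon>])
  then have 3: "emb b * \<epsilon> * (emb d * \<epsilon>) = emb (dlt * b * d)"
    by (simp add: dlt(3) mult.assoc mult.commute[of dlt] flip: emb_mult)
  show ?thesis
    unfolding quad_def distrib_left distrib_right 1 2 3 emb_add
    by (simp add: emb_mult add_ac)
qed

lemma quad_eq_0_iff: "quad a b = 0 \<longleftrightarrow> a = 0 \<and> b = 0"
proof
  assume z: "quad a b = 0"
  have "b = 0"
  proof (rule ccontr)
    assume b: "b \<noteq> 0"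
    have "emb (1 / b) * quad a b = emb (a / b) + \<epsilon>"
      using b by (simp add: quad_def distrib_left mult.assoc[symmetric] flip: emb_mult)
    then have "\<epsilon> = emb (- (a / b))" using z by (simp add: emb_minus eq_neg_iff_add_eq_0 add.commute)
    then show False using eps_not_scalar by blast
  qed
  then show "a = 0 \<and> b = 0" using z by (simp add: quad_def)
qed (simp add: quad_def)

lemma quad_eq_iff: "quad a b = quad c d \<longleftrightarrow> a = c \<and> b = d"
  using quad_eq_0_iff[of "a - c" "b - d"] by (simp add: quad_diff[symmetric])

lemma star_quad: "star (quad a b) = quad a (- b)"
  by (simp add: quad_def star_add star_mult star_eps emb_minus emb_commute)

lemma quad_Theta: "quad a b * \<Theta> = \<Theta> * quad a (- b)"
proof -
  have "emb b * (\<epsilon> * \<Theta>) = - (\<Theta> * (emb b * \<epsilon>))"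
    by (simp add: emb_left_commute Theta_eps)
  then show ?thesis by (simp add: quad_def algebra_simps emb_minus emb_commute)
qed

text \<open>The form is the product of \<open>quad a b\<close> and \<open>quad a (- b)\<close>, and
  a division ring has no zero divisors.\<close>

lemma quad_norm_eq_0_iff: "a\<^sup>2 - dlt * b\<^sup>2 = 0 \<longleftrightarrow> a = 0 \<and> b = 0"
proof
  assume "a\<^sup>2 - dlt * b\<^sup>2 = 0"
  then have "quad a b * quad a (- b) = 0"
    by (simp add: quad_mult quad_eq_0_iff power2_eq_square algebra_simps)
  then show "a = 0 \<and> b = 0" by (auto simp: quad_eq_0_iff)
qed simp

lemma quad_inverse: assumes "quad c d \<noteq> 0" shows "\<exists>c' d'. quad c d * quad c' d' = 1"
proof -
  let ?n = "c\<^sup>2 - dlt * d\<^sup>2"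
  have n: "?n \<noteq> 0" using assms by (simp only: quad_norm_eq_0_iff quad_eq_0_iff not_False_eq_True)
  have "quad c d * quad (c / ?n) (- d / ?n) = quad 1 0"
  proof -
    have "c * (c / m) + dlt * d * (- d / m) = (c\<^sup>2 - dlt * d\<^sup>2) / m" for m
      by (simp add: power2_eq_square diff_divide_distrib mult.assoc)
    then have "c * (c / ?n) + dlt * d * (- d / ?n) = 1" by (simp only: divide_self[OF n])
    moreover have "c * (- d / ?n) + d * (c / ?n) = 0" by (simp add: mult.commute)
    ultimately show ?thesis by (simp only: quad_mult)
  qed
  then show ?thesis by (auto simp: quad_def)
qed

text \<open>Elements of the subfield commute with \<epsilon>, whereas \<Theta> anticommutes with
  it.\<close>

lemma Theta_not_quad: "\<Theta> \<noteq> quad a b"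
proof
  assume t: "\<Theta> = quad a b"
  have "\<epsilon> = quad 0 1" by (simp add: quad_def)
  moreover have "quad a b * quad 0 1 = quad 0 1 * quad a b" by (simp add: quad_mult mult.commute)
  ultimately have "\<Theta> * \<epsilon> = \<epsilon> * \<Theta>" by (simp only: t)
  with Theta_eps have "\<epsilon> * \<Theta> + \<epsilon> * \<Theta> = 0" by (simp add: eq_neg_iff_add_eq_0)
  then have "\<epsilon> * \<Theta> = 0" by (rule double_eq_0)
  then show False by simp
qed

lemma star_Theta: "star \<Theta> = - \<Theta>"
  using Theta_not_quad[of _ 0] by (intro star_pure[OF Theta_sq]) (simp add: quad_def)

text \<open>If the coefficient of \<Theta> were nonzero, inverting it within the subfield would
  place \<Theta> in the subfield.\<close>

lemma coords_eq_0: assumes "quad a b + \<Theta> * quad c d = 0"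
  shows "quad a b = 0" "quad c d = 0"
proof -
  show 1: "quad c d = 0"
  proof (rule ccontr)
    assume "quad c d \<noteq> 0"
    then obtain c' d' where i: "quad c d * quad c' d' = 1" using quad_inverse by blast
    have m: "quad (- a) (- b) = - quad a b" by (simp add: quad_def emb_minus)
    have "\<Theta> * quad c d = - quad a b" using assms by (simp add: eq_neg_iff_add_eq_0 add.commute)
    then have "\<Theta> * quad c d * quad c' d' = - quad a b * quad c' d'" by simp
    then have "\<Theta> = quad (- a) (- b) * quad c' d'"
      using i by (simp add: mult.assoc m)
    then show False using Theta_not_quad by (simp add: quad_mult)
  qed
  show "quad a b = 0" using assms by (simp add: 1)
qed

definition basis4 :: "'d set" where "basis4 = {\<Theta> * \<epsilon>, \<Theta>, \<epsilon>, 1}"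

lemma in_span_cases:
  "x \<in> span {1} \<longleftrightarrow> (\<exists>a. x = quad a 0)"
  "x \<in> span {\<epsilon>, 1} \<longleftrightarrow> (\<exists>a b. x = quad a b)"
  "x \<in> span {\<Theta>, \<epsilon>, 1} \<longleftrightarrow> (\<exists>a b c. x = quad a b + \<Theta> * quad c 0)"
  "x \<in> span basis4 \<longleftrightarrow> (\<exists>a b c d. x = quad a b + \<Theta> * quad c d)"
proof -
  have *: "scale k y = emb k * y" for k y by (simp add: emb_mult_left)
  show 1: "x \<in> span {1} \<longleftrightarrow> (\<exists>a. x = quad a 0)" for x
    by (auto simp: span_breakdown_eq span_empty quad_def *)
  show 2: "x \<in> span {\<epsilon>, 1} \<longleftrightarrow> (\<exists>a b. x = quad a b)" for x
    by (subst span_breakdown_eq) (auto simp: 1 quad_def * algebra_simps)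
  show 3: "x \<in> span {\<Theta>, \<epsilon>, 1} \<longleftrightarrow> (\<exists>a b c. x = quad a b + \<Theta> * quad c 0)" for x
  proof -
    have "\<Theta> * quad c 0 = emb c * \<Theta>" for c by (simp add: quad_def emb_commute)
    then show ?thesis by (subst span_breakdown_eq) (auto simp: 2 * diff_eq_eq)
  qed
  have 4: "\<Theta> * quad c d = \<Theta> * quad c 0 + emb d * (\<Theta> * \<epsilon>)" for c d
    by (simp add: quad_def distrib_left emb_left_commute)
  have 5: "x - emb d * (\<Theta> * \<epsilon>) = quad a b + \<Theta> * quad c 0 \<longleftrightarrow> x = quad a b + \<Theta> * quad c d" for a b c d
    by (simp only: diff_eq_eq add.assoc 4[of c d])
  show "x \<in> span basis4 \<longleftrightarrow> (\<exists>a b c d. x = quad a b + \<Theta> * quad c d)"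
    unfolding basis4_def by (subst span_breakdown_eq) (simp only: 3 * 5, blast)
qed

lemma basis4_not_in_span:
  "1 \<notin> span {}" "\<epsilon> \<notin> span {1}" "\<Theta> \<notin> span {\<epsilon>, 1}" "\<Theta> * \<epsilon> \<notin> span {\<Theta>, \<epsilon>, 1}"
proof -
  show "1 \<notin> span {}" by (simp add: span_empty)
  show "\<epsilon> \<notin> span {1}" using eps_not_scalar by (simp add: in_span_cases quad_def)
  show "\<Theta> \<notin> span {\<epsilon>, 1}" using Theta_not_quad by (simp add: in_span_cases)
  show "\<Theta> * \<epsilon> \<notin> span {\<Theta>, \<epsilon>, 1}"
  proof
    assume "\<Theta> * \<epsilon> \<in> span {\<Theta>, \<epsilon>, 1}"
    then obtain a b c where *: "\<Theta> * \<epsilon> = quad a b + \<Theta> * quad c 0" by (auto simp: in_span_cases)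
    have "quad c (-1) = quad c 0 - \<epsilon>" by (simp add: quad_def emb_minus)
    then have "quad a b + \<Theta> * quad c (-1) = 0" using * by (simp add: right_diff_distrib)
    from coords_eq_0(2)[OF this] show False by (simp add: quad_eq_0_iff)
  qed
qed

lemma basis4_distinct: "\<epsilon> \<notin> {1}" "\<Theta> \<notin> {\<epsilon>, 1}" "\<Theta> * \<epsilon> \<notin> {\<Theta>, \<epsilon>, 1}"
  using basis4_not_in_span(2-4) span_base[of \<epsilon> "{1}"] span_base[of \<Theta> "{\<epsilon>, 1}"]
    span_base[of "\<Theta> * \<epsilon>" "{\<Theta>, \<epsilon>, 1}"] by blast+

lemma basis4: "independent basis4" "card basis4 = 4" "finite basis4"
proof -
  note n = basis4_not_in_span
  show "independent basis4" unfolding basis4_def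
    by (intro independent_insertI n independent_empty)
  show "finite basis4" by (simp add: basis4_def)
  show "card basis4 = 4" using basis4_distinct by (simp add: basis4_def)
qed

text \<open>The four independent vectors of \<open>basis4\<close> span, since a fifth independent
  vector would exceed the dimension.\<close>

lemma coords: "\<exists>a b c d. x = quad a b + \<Theta> * quad c d"
proof -
  have "x \<in> span basis4"
  proof (rule ccontr)
    assume x: "x \<notin> span basis4"
    then have i: "independent (insert x basis4)" by (rule independent_insertI) (rule basis4)
    obtain B where B: "independent B" "UNIV \<subseteq> span B" "card B = dim UNIV"
      using basis_exists[of UNIV] by metis
    have f: "finite B" using B(3) dim_4 by (intro card_ge_0_finite) simp
    have "card (insert x basis4) \<le> card B"
      using independent_span_bound[OF f i] B(2) by blast
    moreover have "x \<notin> basis4" using x span_superset by blast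
    ultimately show False using basis4 B(3) dim_4 by simp
  qed
  then show ?thesis by (simp add: in_span_cases)
qed

section \<open>Reduced norm and valuation of the algebra\<close>

definition nrd :: "'d \<Rightarrow> 'k" where "nrd x = (THE a. x * star x = emb a)"

lemma nrd_eqI: "x * star x = emb a \<Longrightarrow> nrd x = a"
  by (auto simp: nrd_def emb_eq_iff)

lemma nrd: "x * star x = emb (nrd x)"
proof -
  obtain a where "x * star x = emb a" using star_norm[of x] by (auto simp: emb_def)
  then show ?thesis by (simp add: nrd_eqI)
qed

lemma nrd_mult: "nrd (x * y) = nrd x * nrd y"
proof (rule nrd_eqI)
  have "x * y * star (x * y) = x * (y * star y) * star x" by (simp add: star_mult mult.assoc)
  also have "\<dots> = emb (nrd y) * (x * star x)"
    by (simp add: nrd emb_commute[of x] mult.assoc)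
  also have "\<dots> = emb (nrd x * nrd y)"
    by (simp add: nrd mult.commute[of "nrd x"] flip: emb_mult)
  finally show "x * y * star (x * y) = emb (nrd x * nrd y)" .
qed

lemma nrd_zero [simp]: "nrd 0 = 0"
  and nrd_one [simp]: "nrd 1 = 1"
  and nrd_emb: "nrd (emb a) = a\<^sup>2"
  and nrd_minus: "nrd (- x) = nrd x"
  by (rule nrd_eqI; simp add: emb_mult power2_eq_square star_one star_minus nrd)+

lemma star_eq_0_iff [simp]: "star x = 0 \<longleftrightarrow> x = 0"
  using star_star[of x] by auto

lemma nrd_eq_0_iff [simp]: "nrd x = 0 \<longleftrightarrow> x = 0"
  using nrd[of x] by auto

text \<open>Cancelling \<open>x\<close> in \<open>x * (star x * x) = x * emb (nrd x)\<close> shows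
  that the norm may be formed in either order.\<close>

lemma nrd_star: "nrd (star x) = nrd x"
proof (cases "x = 0")
  case False
  have "x * (star x * x) = x * emb (nrd x)"
    by (simp add: mult.assoc[symmetric] nrd emb_commute)
  then have "star x * x = emb (nrd x)" using False by simp
  then show ?thesis by (intro nrd_eqI) (simp add: star_star)
qed simp

lemma nrd_Theta: "nrd \<Theta> = - \<pi>"
  by (rule nrd_eqI) (simp add: star_Theta Theta_sq emb_minus)

lemma star_coords: "star (quad a b + \<Theta> * quad c d) = quad a (- b) - \<Theta> * quad c d"
  by (simp add: star_add star_mult star_quad star_Theta quad_Theta)

text \<open>Moving \<Theta> across the subfield conjugates it, which makes the cross terms cancel.
  What remains is the norm of the subfield on both coordinates, the second one weighted by
  \<open>- \<pi>\<close>.\<close>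

lemma nrd_coords:
  "nrd (quad a b + \<Theta> * quad c d) = (a\<^sup>2 - dlt * b\<^sup>2) + (- \<pi>) * (c\<^sup>2 - dlt * d\<^sup>2)"
proof (rule nrd_eqI)
  have nq: "quad a b * quad a (- b) = emb (a\<^sup>2 - dlt * b\<^sup>2)" for a b
    by (simp add: quad_mult) (simp add: quad_def power2_eq_square algebra_simps)
  have 1: "quad a b * (\<Theta> * quad c d) = \<Theta> * (quad a (- b) * quad c d)"
    by (simp add: mult.assoc[symmetric] quad_Theta)
  have 2: "\<Theta> * quad c d * (\<Theta> * quad c d) = emb \<pi> * (quad c (- d) * quad c d)"
  proof -
    have "\<Theta> * quad c d * (\<Theta> * quad c d) = \<Theta> * (quad c d * \<Theta>) * quad c d" by (simp only: mult.assoc)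
    also have "\<dots> = \<Theta> * \<Theta> * (quad c (- d) * quad c d)" by (simp only: quad_Theta mult.assoc)
    finally show ?thesis by (simp only: Theta_sq)
  qed
  have 3: "quad c d * quad a (- b) = quad a (- b) * quad c d"
    by (simp add: quad_mult quad_eq_iff mult_ac add.commute)
  have "(quad a b + \<Theta> * quad c d) * (quad a (- b) - \<Theta> * quad c d)
    = quad a b * quad a (- b) - emb \<pi> * (quad c (- d) * quad c d)"
    using 1 2 by (simp add: distrib_right right_diff_distrib mult.assoc 3)
  also have "quad c (- d) * quad c d = emb (c\<^sup>2 - dlt * d\<^sup>2)"
    using nq[of c "- d"] by simp
  finally show "(quad a b + \<Theta> * quad c d) * star (quad a b + \<Theta> * quad c d) =
      emb ((a\<^sup>2 - dlt * b\<^sup>2) + (- \<pi>) * (c\<^sup>2 - dlt * d\<^sup>2))"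
    by (simp add: star_coords nq emb_add emb_minus emb_mult emb_diff right_diff_distrib)
qed

text \<open>Otherwise \<open>b\<close> is a unit and \<open>a / b\<close> is a square root of
  \<open>dlt\<close> modulo the ideal. By Hensel's lemma \<open>dlt\<close> is then a square,
  against the anisotropy of the form.\<close>

lemma quad_norm_unit:
  assumes "a \<in> val_ring v" "b \<in> val_ring v" "a \<notin> val_ideal v \<or> b \<notin> val_ideal v"
  shows "a\<^sup>2 - dlt * b\<^sup>2 \<notin> val_ideal v"
proof
  assume n: "a\<^sup>2 - dlt * b\<^sup>2 \<in> val_ideal v"
  have sq: "x\<^sup>2 \<in> val_ideal v \<longleftrightarrow> x \<in> val_ideal v" if "x \<in> val_ring v" for x
    using that by (cases "x = 0") (auto simp: pp_iff v_power)
  have bb: "dlt * b\<^sup>2 \<in> val_ideal v \<longleftrightarrow> b \<in> val_ideal v"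
    using sq[OF assms(2)] by (simp add: pp_mult_left_iff dlt)
  have "b \<notin> val_ideal v"
    using subgrp_diff_right[OF subgrp_pp n] bb sq[OF assms(1)] assms(3) by blast
  then have b: "b \<noteq> 0" "v b = 0" using assms(2) by (auto simp: pp_iff)
  have e: "dlt - (a / b)\<^sup>2 = (- 1 / b\<^sup>2) * (a\<^sup>2 - dlt * b\<^sup>2)"
    using b by (simp add: field_simps)
  have "v (- 1 / b\<^sup>2) = 0" using b by (simp add: v_divide v_minus v_power v_one)
  then have "(- 1 / b\<^sup>2) * (a\<^sup>2 - dlt * b\<^sup>2) \<in> val_ideal v"
    using n b by (subst pp_mult_left_iff) simp_all
  then have "dlt - (a / b)\<^sup>2 \<in> val_ideal v" by (simp only: e)
  moreover have "a / b \<in> val_ring v" using assms(1) b by (cases "a = 0") (auto simp: pp_iff v_divide)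
  ultimately obtain r where r: "r\<^sup>2 = dlt" using hensel_square[of dlt "a / b"] dlt by blast
  have "r\<^sup>2 - dlt * 1\<^sup>2 \<noteq> 0" by (subst quad_norm_eq_0_iff) simp
  then show False by (simp add: r)
qed

text \<open>Dividing by a coordinate \<open>c\<close> of least valuation makes both coordinates
  integral and one of them a unit, so the norm has valuation exactly \<open>2 * v c\<close>.\<close>

lemma quad_norm_val:
  assumes "a \<noteq> 0 \<or> b \<noteq> 0"
  obtains j where "v (a\<^sup>2 - dlt * b\<^sup>2) = 2 * j" "a \<in> prime_pow v j" "b \<in> prime_pow v j"
proof -
  obtain c where c: "c \<noteq> 0" "c = a \<or> c = b" "a \<in> prime_pow v (v c)" "b \<in> prime_pow v (v c)"
  proof (cases "a \<noteq> 0 \<and> (b = 0 \<or> v a \<le> v b)")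
    case True then show ?thesis using that[of a] by (auto simp: pp_iff)
  next
    case False then show ?thesis using that[of b] assms by (auto simp: pp_iff)
  qed
  have i: "x / c \<in> val_ring v" if "x \<in> prime_pow v (v c)" for x
    using that c(1) by (cases "x = 0") (auto simp: pp_iff v_divide)
  have "a / c \<notin> val_ideal v \<or> b / c \<notin> val_ideal v"
    using c(1,2) by (auto simp: pp_iff v_one)
  from quad_norm_unit[OF i[OF c(3)] i[OF c(4)] this]
  have n1: "(a / c)\<^sup>2 - dlt * (b / c)\<^sup>2 \<notin> val_ideal v" .
  have n2: "(a / c)\<^sup>2 - dlt * (b / c)\<^sup>2 \<in> val_ring v"
    using pp_mult[OF i[OF c(3)] i[OF c(3)]]
      pp_mult[OF pp_mult[OF i[OF c(4)] i[OF c(4)]], of dlt 0]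
    by (intro pp_diff) (auto simp: power2_eq_square mult_ac pp_iff dlt)
  define m where "m = (a / c)\<^sup>2 - dlt * (b / c)\<^sup>2"
  have m: "m \<noteq> 0" "v m = 0" using n1 n2 by (auto simp: m_def pp_iff)
  have "a\<^sup>2 - dlt * b\<^sup>2 = c\<^sup>2 * m" using c(1) by (simp add: m_def field_simps)
  then have "v (a\<^sup>2 - dlt * b\<^sup>2) = 2 * v c" using m c(1) by (simp add: v_mult v_power)
  then show ?thesis using that c(3,4) by blast
qed

lemma quad_norm_even: "a\<^sup>2 - dlt * b\<^sup>2 = 0 \<or> even (v (a\<^sup>2 - dlt * b\<^sup>2))"
  by (metis quad_norm_val dvd_triv_left quad_norm_eq_0_iff)

lemma quad_norm_pp:
  "a\<^sup>2 - dlt * b\<^sup>2 \<in> prime_pow v (2 * j) \<longleftrightarrow> a \<in> prime_pow v j \<and> b \<in> prime_pow v j"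
proof
  assume n: "a\<^sup>2 - dlt * b\<^sup>2 \<in> prime_pow v (2 * j)"
  show "a \<in> prime_pow v j \<and> b \<in> prime_pow v j"
  proof (cases "a \<noteq> 0 \<or> b \<noteq> 0")
    case True
    then obtain i where i: "v (a\<^sup>2 - dlt * b\<^sup>2) = 2 * i" "a \<in> prime_pow v i" "b \<in> prime_pow v i"
      by (rule quad_norm_val)
    have "a\<^sup>2 - dlt * b\<^sup>2 \<noteq> 0" using True by (simp only: quad_norm_eq_0_iff) simp
    then have "j \<le> i" using n i(1) by (simp add: pp_iff)
    then show ?thesis using i pp_mono[of j i] by auto
  qed simp
next
  assume ab: "a \<in> prime_pow v j \<and> b \<in> prime_pow v j"
  have "dlt * (b * b) \<in> prime_pow v (j + j)"
    using pp_mult[of b j b j] ab by (simp add: pp_mult_left_iff dlt)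
  then show "a\<^sup>2 - dlt * b\<^sup>2 \<in> prime_pow v (2 * j)"
    using pp_mult[of a j a j] ab by (simp add: power2_eq_square pp_diff)
qed

lemma pp_even: assumes "x = 0 \<or> even (v x)"
  shows "x \<in> prime_pow v N \<longleftrightarrow> x \<in> prime_pow v (2 * ((N + 1) div 2))"
  using assms by (auto simp: pp_iff; presburger)

text \<open>The powers of the maximal ideal, as balls for the valuation \<open>v \<circ> nrd\<close>.\<close>

definition PP :: "int \<Rightarrow> 'd set" where "PP N = {x. nrd x \<in> prime_pow v N}"

definition w :: "'d \<Rightarrow> int" where "w x = v (nrd x)"

lemma PP_iff: "x \<in> PP N \<longleftrightarrow> x = 0 \<or> N \<le> w x"
  by (auto simp: PP_def pp_iff w_def)

text \<open>Norms from the unramified subfield have even valuation, so the two terms of the norm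
  form have valuations of opposite parity and cannot cancel. A ball is thus a product of ideals in
  coordinates, which is why it is closed under addition.\<close>

lemma PP_coords:
  "quad a b + \<Theta> * quad c d \<in> PP N \<longleftrightarrow>
     a \<in> prime_pow v ((N + 1) div 2) \<and> b \<in> prime_pow v ((N + 1) div 2) \<and>
     c \<in> prime_pow v (N div 2) \<and> d \<in> prime_pow v (N div 2)"
proof -
  let ?m = "a\<^sup>2 - dlt * b\<^sup>2" and ?n = "c\<^sup>2 - dlt * d\<^sup>2"
  have vp: "v (- \<pi>) = 1" "- \<pi> \<noteq> 0" using prime_element by (simp_all add: v_minus)
  have odd: "(- \<pi>) * ?n = 0 \<or> odd (v ((- \<pi>) * ?n))"
  proof (cases "?n = 0")
    case False
    then have "even (v ?n)" using quad_norm_even by blast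
    moreover have "v ((- \<pi>) * ?n) = v (- \<pi>) + v ?n" using False vp by (intro v_mult)
    ultimately show ?thesis using vp by simp
  qed simp
  have "quad a b + \<Theta> * quad c d \<in> PP N \<longleftrightarrow> ?m \<in> prime_pow v N \<and> (- \<pi>) * ?n \<in> prime_pow v N"
    unfolding PP_def mem_Collect_eq nrd_coords by (rule pp_parity_add[OF quad_norm_even odd])
  also have "?m \<in> prime_pow v N \<longleftrightarrow> ?m \<in> prime_pow v (2 * ((N + 1) div 2))"
    by (rule pp_even[OF quad_norm_even])
  also have "(- \<pi>) * ?n \<in> prime_pow v N \<longleftrightarrow> ?n \<in> prime_pow v (N - 1)"
    using pp_mult_left_iff[OF vp(2)] vp(1) by simp
  also have "?n \<in> prime_pow v (N - 1) \<longleftrightarrow> ?n \<in> prime_pow v (2 * (N div 2))"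
    using pp_even[OF quad_norm_even, of c d "N - 1"] by simp
  finally show ?thesis by (simp only: quad_norm_pp) blast
qed

lemma PP_zero [simp]: "0 \<in> PP N" by (simp add: PP_iff)

lemma subgrp_PP: "subgrp (PP N)"
proof -
  have "x - y \<in> PP N" if "x \<in> PP N" "y \<in> PP N" for x y
  proof -
    obtain a b c d where x: "x = quad a b + \<Theta> * quad c d" using coords by blast
    obtain a' b' c' d' where y: "y = quad a' b' + \<Theta> * quad c' d'" using coords by blast
    have xy: "x - y = quad (a - a') (b - b') + \<Theta> * quad (c - c') (d - d')"
      by (simp add: x y algebra_simps flip: quad_diff)
    have "quad (a - a') (b - b') + \<Theta> * quad (c - c') (d - d') \<in> PP N"
      using that unfolding x y PP_coords by (simp add: pp_diff)
    then show ?thesis by (simp only: xy)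
  qed
  then show ?thesis by (simp add: subgrp_def)
qed

lemmas PP_add = subgrp_add[OF subgrp_PP]
  and PP_diff = subgrp_diff[OF subgrp_PP]
  and PP_minus = subgrp_minus[OF subgrp_PP]
  and PP_sum = subgrp_sum[OF subgrp_PP]

lemma w_mult: "x \<noteq> 0 \<Longrightarrow> y \<noteq> 0 \<Longrightarrow> w (x * y) = w x + w y"
  by (simp add: w_def nrd_mult v_mult)

lemma w_one: "w 1 = 0" by (simp add: w_def v_one)

lemma w_emb: "a \<noteq> 0 \<Longrightarrow> w (emb a) = 2 * v a" by (simp add: w_def nrd_emb v_power)

lemma w_Theta: "w \<Theta> = 1" by (simp add: w_def nrd_Theta v_minus prime_element)

lemma w_star: "w (star x) = w x" by (simp add: w_def nrd_star)

lemma w_minus: "w (- x) = w x" by (simp add: w_def nrd_minus)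

lemma w_power: "x \<noteq> 0 \<Longrightarrow> w (x ^ n) = int n * w x"
  by (induction n) (auto simp: w_one w_mult algebra_simps)

lemma w_inverse: "x \<noteq> 0 \<Longrightarrow> w (inverse x) = - w x"
  using w_mult[of x "inverse x"] by (simp add: w_one)

lemma PP_mult: "x \<in> PP M \<Longrightarrow> y \<in> PP N \<Longrightarrow> x * y \<in> PP (M + N)"
  by (auto simp: PP_def nrd_mult pp_mult)

lemma PP_star: "star x \<in> PP N \<longleftrightarrow> x \<in> PP N"
  by (simp add: PP_def nrd_star)

lemma PP_mono: "M \<le> N \<Longrightarrow> PP N \<subseteq> PP M"
  using pp_mono by (auto simp: PP_def)

lemma PP_one [simp]: "1 \<in> PP 0" by (simp add: PP_def pp_one)

lemma PP_emb: "emb a \<in> PP N \<longleftrightarrow> a \<in> prime_pow v ((N + 1) div 2)"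
  using PP_coords[of a 0 0 0 N] by (simp add: quad_def)

lemma PP_mult_left_iff: "c \<noteq> 0 \<Longrightarrow> c * x \<in> PP N \<longleftrightarrow> x \<in> PP (N - w c)"
  by (simp add: PP_def w_def nrd_mult pp_mult_left_iff)

lemma Theta_image_PP: "(*) \<Theta> ` PP N = PP (N + 1)"
proof (intro subset_antisym subsetI)
  fix x assume "x \<in> PP (N + 1)"
  moreover have "x = \<Theta> * (inverse \<Theta> * x)" by (simp add: mult.assoc[symmetric])
  ultimately have "inverse \<Theta> * x \<in> PP N"
    using PP_mult_left_iff[of \<Theta> "inverse \<Theta> * x" "N + 1"] by (simp add: w_Theta)
  then show "x \<in> (*) \<Theta> ` PP N" using \<open>x = \<Theta> * (inverse \<Theta> * x)\<close> by blast
qed (auto simp: PP_mult_left_iff w_Theta)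

section \<open>Identification of the maximal order, its maximal ideal and the powers\<close>

lemma is_order_PP0: "is_order v scale (PP 0)"
proof -
  have ne: "\<epsilon> \<noteq> 1" "\<Theta> \<noteq> \<epsilon>" "\<Theta> \<noteq> 1" "\<Theta> * \<epsilon> \<noteq> \<Theta>" "\<Theta> * \<epsilon> \<noteq> \<epsilon>" "\<Theta> * \<epsilon> \<noteq> 1"
    using basis4_distinct by auto
  have s4: "(\<Sum>s\<in>basis4. scale (c s) s) = quad (c 1) (c \<epsilon>) + \<Theta> * quad (c \<Theta>) (c (\<Theta> * \<epsilon>))" for c
    using ne by (simp add: basis4_def quad_def emb_mult_left[symmetric] distrib_left
        emb_commute emb_left_commute add_ac)
  define f where "f a b c d s = (if s = 1 then a else if s = \<epsilon> then b else if s = \<Theta> then c else d)"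
    for a b c d :: 'k and s :: 'd
  have f: "(\<Sum>s\<in>basis4. scale (f a b c d s) s) = quad a b + \<Theta> * quad c d" for a b c d
    unfolding s4 using ne by (simp add: f_def)
  have B: "basis4 \<subseteq> PP 0"
    using PP_coords[of 1 0 0 0 0] PP_coords[of 0 1 0 0 0] PP_coords[of 0 0 1 0 0] PP_coords[of 0 0 0 1 0]
    by (simp add: basis4_def quad_def pp_one)
  show ?thesis unfolding is_order_def
  proof (intro conjI ballI allI)
    show "1 \<in> PP 0" by simp
    fix x y assume "x \<in> PP 0" "y \<in> PP 0"
    then show "x - y \<in> PP 0" "x * y \<in> PP 0" using PP_mult[of x 0 y 0] by (simp_all add: PP_diff)
  next
    show "\<exists>S. finite S \<and> PP 0 = {\<Sum>s\<in>S. scale (c s) s | c. \<forall>s\<in>S. c s \<in> val_ring v}"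
    proof (intro exI[of _ basis4] conjI basis4(3) subset_antisym subsetI)
      fix x assume x: "x \<in> PP 0"
      obtain a b c d where *: "x = quad a b + \<Theta> * quad c d" using coords by blast
      have "\<forall>s. f a b c d s \<in> val_ring v" using x unfolding * PP_coords by (simp add: f_def)
      then show "x \<in> {\<Sum>s\<in>basis4. scale (c s) s | c. \<forall>s\<in>basis4. c s \<in> val_ring v}"
        using f[of a b c d] * by (intro CollectI exI[of _ "f a b c d"]) simp
    next
      fix x assume "x \<in> {\<Sum>s\<in>basis4. scale (c s) s | c. \<forall>s\<in>basis4. c s \<in> val_ring v}"
      then obtain c where "x = (\<Sum>s\<in>basis4. scale (c s) s)" "\<forall>s\<in>basis4. c s \<in> val_ring v" by blast
      then have "x = quad (c 1) (c \<epsilon>) + \<Theta> * quad (c \<Theta>) (c (\<Theta> * \<epsilon>))" by (simp only: s4)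
      moreover have "1 \<in> basis4" "\<epsilon> \<in> basis4" "\<Theta> \<in> basis4" "\<Theta> * \<epsilon> \<in> basis4"
        by (simp_all add: basis4_def)
      ultimately show "x \<in> PP 0"
        using \<open>\<forall>s\<in>basis4. c s \<in> val_ring v\<close> by (simp add: PP_coords)
    qed
  next
    fix x
    obtain a b c d where *: "x = quad a b + \<Theta> * quad c d" using coords by blast
    show "\<exists>S c. finite S \<and> S \<subseteq> PP 0 \<and> x = (\<Sum>s\<in>S. scale (c s) s)"
      using f[of a b c d] * B basis4(3) by (intro exI[of _ basis4] exI[of _ "f a b c d"]) simp
  qed
qed

text \<open>All powers of \<open>x\<close> lie in a finitely generated module, on which
  \<open>w\<close> is bounded below; a negative \<open>w x\<close> would push
  \<open>w (x ^ k)\<close> below every bound.\<close>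

lemma order_le_PP0: assumes "is_order v scale R" shows "R \<subseteq> PP 0"
proof
  fix x assume x: "x \<in> R"
  obtain S where S: "finite S" "R = {\<Sum>s\<in>S. scale (c s) s | c. \<forall>s\<in>S. c s \<in> val_ring v}"
    using assms by (auto simp: is_order_def)
  obtain M where M: "\<forall>s\<in>S. s \<in> PP M"
  proof
    show "\<forall>s\<in>S. s \<in> PP (Min (insert 0 (w ` S)))" using S(1) by (auto simp: PP_iff)
  qed
  have RM: "y \<in> PP M" if yR: "y \<in> R" for y
  proof -
    obtain c where c: "y = (\<Sum>s\<in>S. scale (c s) s)" "\<forall>s\<in>S. c s \<in> val_ring v"
      using yR[unfolded S(2)] by blast
    have "scale (c s) s \<in> PP M" if "s \<in> S" for s
      using PP_mult[of "emb (c s)" 0 s M] M c(2) that by (simp add: PP_emb emb_mult_left)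
    then show ?thesis unfolding c(1) by (rule PP_sum)
  qed
  have pw: "x ^ k \<in> R" for k
    using assms x by (induction k) (auto simp: is_order_def)
  show "x \<in> PP 0"
  proof (rule ccontr)
    assume "x \<notin> PP 0"
    then have x0: "x \<noteq> 0" "w x < 0" by (auto simp: PP_iff)
    \<comment> \<open>As \<open>w x \<le> - 1\<close>, this exponent brings the valuation of the
      power below \<open>M\<close>.\<close>
    let ?k = "nat (\<bar>M\<bar> + 1)"
    have "M \<le> int ?k * w x" using RM[OF pw[of ?k]] x0 by (simp add: PP_iff w_power)
    moreover have "int ?k * w x \<le> int ?k * (- 1)" using x0 by (intro mult_left_mono) auto
    ultimately show False by linarith
  qed
qed

text \<open>An order that contains every order is the only maximal one.\<close>

lemma O_eq: "\<O> = PP 0"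
  using maximal_order is_order_PP0 order_le_PP0 unfolding is_maximal_order_def by blast

lemma P_eq: "\<P> = PP 1"
  using Theta_prime Theta_image_PP[of 0] by (simp add: O_eq)

text \<open>The ideal is generated by \<Theta>, so a single product \<open>\<Theta> * y\<close>
  already gives each element of the next power.\<close>

lemma ideal_power_eq: "ideal_power \<O> \<P> k = PP (int k)"
proof (induction k)
  case (Suc k)
  have "ideal_mult (PP 1) (PP (int k)) = PP (int k + 1)"
  proof (intro subset_antisym subsetI)
    fix x assume "x \<in> ideal_mult (PP 1) (PP (int k))"
    then obtain N f g where x: "x = (\<Sum>i<(N::nat). f i * g i)" "\<forall>i<N. f i \<in> PP 1 \<and> g i \<in> PP (int k)"
      by (auto simp: ideal_mult_def)
    then show "x \<in> PP (int k + 1)"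
      using PP_mult[of _ 1 _ "int k"] by (auto intro!: PP_sum simp: add.commute)
  next
    fix x assume "x \<in> PP (int k + 1)"
    then obtain y where y: "y \<in> PP (int k)" "x = \<Theta> * y" using Theta_image_PP[of "int k"] by blast
    have "\<Theta> \<in> PP 1" by (simp add: PP_iff w_Theta)
    then show "x \<in> ideal_mult (PP 1) (PP (int k))"
      unfolding ideal_mult_def using y
      by (intro CollectI exI[of _ "1::nat"] exI[of _ "\<lambda>_. \<Theta>"] exI[of _ "\<lambda>_. y"]) simp
  qed
  then show ?case by (simp add: Suc.IH[unfolded P_eq] P_eq add.commute)
qed (simp add: O_eq)

text \<open>The second coordinate of an integral element is multiplied by \<Theta>, hence lies in
  \<open>PP 1\<close>: the residue field is that of the quadratic subfield.\<close>

lemma PP0_quad: assumes "x \<in> PP 0"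
  obtains a b where "a \<in> val_ring v" "b \<in> val_ring v" "x - quad a b \<in> PP 1"
proof -
  obtain a b c d where x: "x = quad a b + \<Theta> * quad c d" using coords by blast
  have "x - quad a b = quad 0 0 + \<Theta> * quad c d" by (simp add: x quad_def[of 0 0])
  then have "x - quad a b \<in> PP 1" using assms unfolding x by (simp only: PP_coords) simp
  moreover have "a \<in> val_ring v" "b \<in> val_ring v" using assms unfolding x PP_coords by simp_all
  ultimately show ?thesis using that by blast
qed

lemma PP_quad: "quad a b \<in> PP N \<longleftrightarrow> a \<in> prime_pow v ((N + 1) div 2) \<and> b \<in> prime_pow v ((N + 1) div 2)"
  using PP_coords[of a b 0 0 N] by (simp add: quad_def[of 0 0])

text \<open>A residue is a pair of residues of the base field, namely the two coordinates in the
  quadratic subfield.\<close>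

lemma ncl_PP_0: "ncl (PP 1) (PP 0) = residue_card v ^ 2" "finite (rep (PP 1) ` PP 0)"
proof -
  let ?o = "val_ring v" and ?r = "rep (val_ideal v)"
  let ?f = "\<lambda>(a, b). rep (PP 1) (quad a b)" and ?g = "\<lambda>(a, b). (?r a, ?r b)"
  have img: "rep (PP 1) ` PP 0 = ?f ` (?o \<times> ?o)"
  proof (intro subset_antisym subsetI)
    fix y assume "y \<in> rep (PP 1) ` PP 0"
    then obtain x where x: "x \<in> PP 0" "y = rep (PP 1) x" by blast
    obtain a b where "a \<in> ?o" "b \<in> ?o" "x - quad a b \<in> PP 1" using PP0_quad[OF x(1)] by blast
    then show "y \<in> ?f ` (?o \<times> ?o)" unfolding x(2)
      by (intro image_eqI[of _ _ "(a, b)"]) (auto simp: rep_eq_iff subgrp_PP)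
  qed (auto simp: PP_quad)
  have k: "?f s = ?f t \<longleftrightarrow> ?g s = ?g t" for s t
    by (auto simp: split_beta rep_eq_iff subgrp_PP subgrp_pp quad_diff PP_quad)
  have g: "?g ` (?o \<times> ?o) = ?r ` ?o \<times> ?r ` ?o" by auto
  show "ncl (PP 1) (PP 0) = residue_card v ^ 2"
    unfolding ncl_def img card_image_eq_kernel(1)[OF k] g
    by (simp add: card_cartesian_product residue_card_eq_ncl ncl_def power2_eq_square)
  show "finite (rep (PP 1) ` PP 0)"
    unfolding img card_image_eq_kernel(2)[OF k] g by (simp add: finite_rep_val_ring)
qed

lemma ncl_PP_Suc:
  "ncl (PP (int k + 1)) (PP (int k)) = residue_card v ^ 2 \<and> finite (rep (PP (int k + 1)) ` PP (int k))"
proof (induction k)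
  case (Suc k)
  have k: "\<Theta> * x - \<Theta> * y \<in> PP (int k + 1 + 1) \<longleftrightarrow> x - y \<in> PP (int k + 1)" for x y
    unfolding right_diff_distrib[symmetric] by (simp add: PP_mult_left_iff w_Theta add.commute)
  note t = ncl_transport[OF subgrp_PP subgrp_PP k, of "PP (int k)", unfolded Theta_image_PP]
  show ?case using t Suc by (simp add: add_ac)
qed (use ncl_PP_0 in simp)

lemma ncl_PP_aux:
  "ncl (PP (int j + int k)) (PP (int j)) = residue_card v ^ (2 * k) \<and>
   finite (rep (PP (int j + int k)) ` PP (int j))"
proof (induction k)
  case 0
  have "rep (PP (int j)) ` PP (int j) = {rep (PP (int j)) 0}"
    by (auto simp: rep_eq_iff subgrp_PP intro!: image_eqI[of _ _ 0])
  then show ?case by (simp add: ncl_def)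
next
  case (Suc k)
  have sub: "PP (int j + int k + 1) \<subseteq> PP (int j + int k)" by (rule PP_mono) simp
  have sat: "x + y \<in> PP (int j)" if "x \<in> PP (int j)" "y \<in> PP (int j + int k)" for x y
    using that PP_mono[of "int j" "int j + int k"] by (intro PP_add) auto
  note t = ncl_tower[OF subgrp_PP subgrp_PP sub sat]
  show ?case using t Suc ncl_PP_Suc[of "j + k"] by (simp add: algebra_simps power2_eq_square)
qed

lemma ncl_PP:
  assumes "0 \<le> M" "M \<le> N"
  shows "ncl (PP N) (PP M) = residue_card v ^ (2 * nat (N - M))" and "finite (rep (PP N) ` PP M)"
  using ncl_PP_aux[of "nat M" "nat (N - M)"] assms by auto

lemma star_fixed_iff: "star x = x \<longleftrightarrow> (\<exists>a. x = emb a)"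
proof
  assume s: "star x = x"
  obtain t where "x + star x = emb t" using trace_scalar by blast
  then have t: "x + x = emb t" using s by simp
  have "x = emb (1/2) * (x + x)"
    using emb_add[of "1/2" "1/2"] by (simp add: distrib_left flip: distrib_right)
  then show "\<exists>a. x = emb a" by (metis t emb_mult)
qed auto

text \<open>The fixed elements are the scalars, whose \<open>w\<close> is twice their
  \<open>v\<close>. Hence one factor \<open>q\<close> for every two steps, and the rounding
  \<open>(N + 1) div 2\<close>.\<close>

lemma ncl_PP_fixed:
  assumes "M \<le> N"
  shows "ncl (PP N) {x \<in> PP M. star x = x} = residue_card v ^ nat ((N + 1) div 2 - (M + 1) div 2)"
    and "finite (rep (PP N) ` {x \<in> PP M. star x = x})"
proof -
  have img: "emb ` prime_pow v ((M + 1) div 2) = {x \<in> PP M. star x = x}"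
    by (auto simp: star_fixed_iff PP_emb)
  have k: "emb a - emb b \<in> PP N \<longleftrightarrow> a - b \<in> prime_pow v ((N + 1) div 2)" for a b
    by (simp add: PP_emb flip: emb_diff)
  note t = ncl_transport[OF subgrp_pp subgrp_PP k, of "prime_pow v ((M + 1) div 2)", unfolded img]
  have le: "(M + 1) div 2 \<le> (N + 1) div 2" using assms by (simp add: zdiv_mono1)
  show "ncl (PP N) {x \<in> PP M. star x = x} = residue_card v ^ nat ((N + 1) div 2 - (M + 1) div 2)"
    using t(1) ncl_pp(1)[OF le] by simp
  show "finite (rep (PP N) ` {x \<in> PP M. star x = x})"
    using t(2) ncl_pp(2)[OF le] by simp
qed

lemma PP_cong_mult:
  assumes "x - x' \<in> PP 1" "y - y' \<in> PP 1" "x \<in> PP 0" "y' \<in> PP 0"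
  shows "x * y - x' * y' \<in> PP 1"
proof -
  have "x * y - x' * y' = x * (y - y') + (x - x') * y'" by (simp add: algebra_simps)
  then show ?thesis using PP_mult[OF assms(3,2)] PP_mult[OF assms(1,4)] by (simp add: PP_add)
qed

text \<open>Modulo \<open>PP 1\<close> both factors may be replaced by elements of the commutative
  quadratic subfield.\<close>

lemma PP_commute: assumes "x \<in> PP 0" "y \<in> PP 0" shows "x * y - y * x \<in> PP 1"
proof -
  obtain a b where x: "a \<in> val_ring v" "b \<in> val_ring v" "x - quad a b \<in> PP 1"
    using PP0_quad[OF assms(1)] by blast
  obtain c d where y: "c \<in> val_ring v" "d \<in> val_ring v" "y - quad c d \<in> PP 1"
    using PP0_quad[OF assms(2)] by blast
  have q: "quad a b \<in> PP 0" "quad c d \<in> PP 0" using x y by (auto simp: PP_quad)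
  have "quad a b * quad c d = quad c d * quad a b" by (simp add: quad_mult quad_eq_iff mult_ac)
  then show ?thesis
    using PP_diff[OF PP_cong_mult[OF x(3) y(3) assms(1) q(2)] PP_cong_mult[OF y(3) x(3) assms(2) q(1)]]
    by simp
qed

text \<open>On the quadratic subfield the two products agree, since conjugation by \<Theta> is the
  involution there. The remaining component \<open>\<Theta> * ?y\<close> contributes only terms with
  two factors \<Theta>.\<close>

lemma star_Theta_cong: assumes "x \<in> PP 0" shows "star x * \<Theta> - \<Theta> * x \<in> PP 2"
proof -
  obtain a b c d where x: "x = quad a b + \<Theta> * quad c d" using coords by blast
  let ?y = "quad c d"
  have y: "?y \<in> PP 0" using assms unfolding x PP_coords PP_quad by simp
  have T: "\<Theta> \<in> PP 1" by (simp add: PP_iff w_Theta)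
  have "star x * \<Theta> - \<Theta> * x = - (\<Theta> * (?y * \<Theta>)) - \<Theta> * (\<Theta> * ?y)"
    unfolding x star_coords by (simp add: left_diff_distrib distrib_left mult.assoc quad_Theta)
  moreover have "\<Theta> * (?y * \<Theta>) \<in> PP 2" "\<Theta> * (\<Theta> * ?y) \<in> PP 2"
    using PP_mult[OF T PP_mult[OF y T]] PP_mult[OF T PP_mult[OF T y]] by simp_all
  ultimately show ?thesis by (simp add: PP_diff PP_minus)
qed

lemma PP_inverse: "x \<in> PP 0 \<Longrightarrow> x \<notin> PP 1 \<Longrightarrow> inverse x \<in> PP 0"
  by (cases "x = 0") (auto simp: PP_iff w_inverse)

lemma q_eq: "q = residue_card v" by (simp add: q_def)

end

section \<open>The monomial form and its filtrations\<close>

context padic_quaternion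
begin

lemma mat_add_diff:
  fixes x y z :: "'d mat"
  shows "x \<in> carrier_mat m k \<Longrightarrow> y \<in> carrier_mat m k \<Longrightarrow> z \<in> carrier_mat m k \<Longrightarrow> x + y - z = x - z + y"
  by (rule eq_matI) auto

lemma adjoint_carrier [simp]: "u \<in> carrier_mat m k \<Longrightarrow> adjoint u \<in> carrier_mat k m"
  by (simp add: adjoint_def)

lemma adjoint_dim [simp]: "dim_row (adjoint u) = dim_col u" "dim_col (adjoint u) = dim_row u"
  by (simp_all add: adjoint_def)

lemma adjoint_index [simp]:
  "i < dim_col u \<Longrightarrow> j < dim_row u \<Longrightarrow> adjoint u $$ (i, j) = star (u $$ (j, i))"
  by (simp add: adjoint_def)

lemma adjoint_adjoint [simp]: "adjoint (adjoint u) = u"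
  by (rule eq_matI) (auto simp: star_star)

lemma adjoint_add: "u \<in> carrier_mat m k \<Longrightarrow> u' \<in> carrier_mat m k \<Longrightarrow> adjoint (u + u') = adjoint u + adjoint u'"
  by (rule eq_matI) (auto simp: star_add)

lemma adjoint_diff: "u \<in> carrier_mat m k \<Longrightarrow> u' \<in> carrier_mat m k \<Longrightarrow> adjoint (u - u') = adjoint u - adjoint u'"
  by (rule eq_matI) (auto simp: star_diff)

lemma adjoint_one [simp]: "adjoint (1\<^sub>m k) = 1\<^sub>m k"
  by (rule eq_matI) (auto simp: star_one)

lemma adjoint_mult:
  assumes "u \<in> carrier_mat m k" "u' \<in> carrier_mat k l"
  shows "adjoint (u * u') = adjoint u' * adjoint u"
  using assms by (intro eq_matI) (auto simp: scalar_prod_def star_sum star_mult)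

lemma mult_carrier_square [simp]:
  "x \<in> carrier_mat m m \<Longrightarrow> y \<in> carrier_mat m m \<Longrightarrow> x * y \<in> carrier_mat m m"
  by (rule mult_carrier_mat)

lemma act_carrier [simp]:
  "A \<in> carrier_mat m m \<Longrightarrow> u \<in> carrier_mat m k \<Longrightarrow> act A u \<in> carrier_mat k k"
  unfolding act_def by (meson adjoint_carrier mult_carrier_mat)

lemma act_mult:
  assumes "A \<in> carrier_mat m m" "u \<in> carrier_mat m m" "t \<in> carrier_mat m m"
  shows "act A (u * t) = act (act A u) t"
proof -
  note c = assms adjoint_carrier[OF assms(2)] adjoint_carrier[OF assms(3)]
  show ?thesis unfolding act_def adjoint_mult[OF assms(2,3)]
    using c by (simp add: assoc_mult_mat[of _ m m _ m _ m])
qed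

lemma act_add:
  assumes "A \<in> carrier_mat m m" "B \<in> carrier_mat m m" "u \<in> carrier_mat m m"
  shows "act (A + B) u = act A u + act B u"
  using assms unfolding act_def
  by (simp add: mult_add_distrib_mat[of _ m m _ m] add_mult_distrib_mat[of _ m m _ _ m])

lemma act_one: "A \<in> carrier_mat m m \<Longrightarrow> act A (1\<^sub>m m) = A"
  by (simp add: act_def)

lemma act_carrier_square [simp]:
  "A \<in> carrier_mat m m \<Longrightarrow> u \<in> carrier_mat m m \<Longrightarrow> act A u \<in> carrier_mat m m"
  by (rule act_carrier)

lemma adjoint_act:
  assumes "A \<in> carrier_mat m m" "adjoint A = A" "u \<in> carrier_mat m m"
  shows "adjoint (act A u) = act A u"
proof -
  have c: "adjoint u \<in> carrier_mat m m" "adjoint u * A \<in> carrier_mat m m" using assms by auto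
  show ?thesis unfolding act_def adjoint_mult[OF c(2) assms(3)] adjoint_mult[OF c(1) assms(1)]
    using assms c by (simp add: assoc_mult_mat[of _ m m _ m _ m])
qed

end

text \<open>The numbers \<open>a i\<close> are the exponents after scaling. The involution
  \<open>p\<close> pairs the two indices of each plane with odd exponent and fixes the indices with
  even exponent; the signs \<open>s\<close> are opposite on a pair. Blocks of both kinds are thus
  treated together.\<close>

locale monomial_form = padic_quaternion v scale star \<O> \<P> \<pi> \<Theta> \<epsilon>
  for v :: "'k::field_char_0 \<Rightarrow> int"
    and scale :: "'k \<Rightarrow> 'd::division_ring \<Rightarrow> 'd"
    and star :: "'d \<Rightarrow> 'd"
    and \<O> \<P> :: "'d set" and \<pi> :: 'k and \<Theta> \<epsilon> :: 'd +
  fixes n :: nat and a :: "nat \<Rightarrow> nat" and p :: "nat \<Rightarrow> nat" and s :: "nat \<Rightarrow> 'd"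
  assumes p_less: "i < n \<Longrightarrow> p i < n"
    and p_p: "i < n \<Longrightarrow> p (p i) = i"
    and a_p: "i < n \<Longrightarrow> a (p i) = a i"
    and s_unit: "i < n \<Longrightarrow> s i = 1 \<or> s i = - 1"
    and p_even: "i < n \<Longrightarrow> even (a i) \<Longrightarrow> p i = i \<and> s i = 1"
    and p_odd: "i < n \<Longrightarrow> odd (a i) \<Longrightarrow> p i \<noteq> i \<and> s (p i) = - s i"
begin

definition A :: "'d mat" where
  "A = mat n n (\<lambda>(i, j). if j = p i then s i * \<Theta> ^ a i else 0)"

definition Ainv :: "'d mat" where
  "Ainv = mat n n (\<lambda>(i, j). if j = p i then inverse (s j * \<Theta> ^ a j) else 0)"

lemma A_carrier [simp]: "A \<in> carrier_mat n n" "Ainv \<in> carrier_mat n n"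
  "dim_row A = n" "dim_col A = n" "dim_row Ainv = n" "dim_col Ainv = n"
  by (simp_all add: A_def Ainv_def)

lemma s_nonzero: "i < n \<Longrightarrow> s i \<noteq> 0"
  using s_unit by fastforce

lemma w_s: "i < n \<Longrightarrow> w (s i) = 0"
  using s_unit[of i] by (auto simp: w_one w_minus)

lemma A_entry_w: "i < n \<Longrightarrow> w (s i * \<Theta> ^ a i) = int (a i)"
  by (simp add: w_mult s_nonzero w_s w_power w_Theta)

lemma A_mult_index:
  assumes "x \<in> carrier_mat n n" "i < n" "j < n"
  shows "(A * x) $$ (i, j) = s i * \<Theta> ^ a i * x $$ (p i, j)"
proof -
  have "(A * x) $$ (i, j) = (\<Sum>k\<in>{0..<n}. A $$ (i, k) * x $$ (k, j))"
    using assms by (auto simp: scalar_prod_def intro!: sum.cong)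
  also have "\<dots> = (\<Sum>k\<in>{0..<n}. if k = p i then s i * \<Theta> ^ a i * x $$ (k, j) else 0)"
    using assms by (intro sum.cong) (auto simp: A_def)
  also have "\<dots> = s i * \<Theta> ^ a i * x $$ (p i, j)" using p_less[OF assms(2)] by simp
  finally show ?thesis .
qed

lemma Ainv_mult_index:
  assumes "x \<in> carrier_mat n n" "i < n" "j < n"
  shows "(Ainv * x) $$ (i, j) = inverse (s (p i) * \<Theta> ^ a (p i)) * x $$ (p i, j)"
proof -
  have "(Ainv * x) $$ (i, j) = (\<Sum>k\<in>{0..<n}. Ainv $$ (i, k) * x $$ (k, j))"
    using assms by (auto simp: scalar_prod_def intro!: sum.cong)
  also have "\<dots> = (\<Sum>k\<in>{0..<n}. if k = p i then inverse (s k * \<Theta> ^ a k) * x $$ (k, j) else 0)"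
    using assms by (intro sum.cong) (auto simp: Ainv_def)
  also have "\<dots> = inverse (s (p i) * \<Theta> ^ a (p i)) * x $$ (p i, j)" using p_less[OF assms(2)] by simp
  finally show ?thesis .
qed

lemma A_Ainv: "A * Ainv = 1\<^sub>m n"
proof (rule eq_matI)
  fix i j assume "i < dim_row (1\<^sub>m n :: 'd mat)" "j < dim_col (1\<^sub>m n :: 'd mat)"
  then have ij: "i < n" "j < n" by auto
  have "s i * \<Theta> ^ a i \<noteq> 0" using s_nonzero ij by simp
  then show "(A * Ainv) $$ (i, j) = 1\<^sub>m n $$ (i, j)"
    unfolding A_mult_index[OF A_carrier(2) ij] using ij p_less[OF ij(1)]
    by (cases "i = j") (simp_all add: Ainv_def p_p del: mult_eq_0_iff)
qed auto

lemma Ainv_A: "Ainv * A = 1\<^sub>m n"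
proof (rule eq_matI)
  fix i j assume "i < dim_row (1\<^sub>m n :: 'd mat)" "j < dim_col (1\<^sub>m n :: 'd mat)"
  then have ij: "i < n" "j < n" by auto
  have "s (p i) * \<Theta> ^ a (p i) \<noteq> 0" using s_nonzero p_less ij by simp
  then show "(Ainv * A) $$ (i, j) = 1\<^sub>m n $$ (i, j)"
    unfolding Ainv_mult_index[OF A_carrier(1) ij] using ij p_less[OF ij(1)]
    by (cases "i = j") (simp_all add: A_def p_p del: mult_eq_0_iff)
qed auto

lemma star_Theta_power: "star (\<Theta> ^ k) = (if even k then \<Theta> ^ k else - (\<Theta> ^ k))"
proof (induction k)
  case (Suc k)
  have "star (\<Theta> ^ Suc k) = star (\<Theta> ^ k) * star \<Theta>" unfolding power_Suc2 power_Suc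
    by (simp add: star_mult power_commutes[symmetric] Suc star_Theta)
  then show ?case by (simp add: Suc star_Theta power_commutes)
qed (simp add: star_one)

text \<open>For an odd exponent \<open>star\<close> changes the sign of
  \<open>\<Theta> ^ a i\<close>, and the opposite signs on a pair compensate for this.\<close>

lemma adjoint_A: "adjoint A = A"
proof (rule eq_matI)
  fix i j assume "i < dim_row A" "j < dim_col A"
  then have ij: "i < n" "j < n" by auto
  have e: "i = p j \<longleftrightarrow> j = p i" using p_p ij by metis
  show "adjoint A $$ (i, j) = A $$ (i, j)"
  proof (cases "i = p j")
    case True
    have st: "star (s j) = s j" using s_unit[OF ij(2)] by (auto simp: star_one star_minus)
    have "adjoint A $$ (i, j) = star (s j * \<Theta> ^ a j)" using ij True by (simp add: A_def)
    also have "\<dots> = star (\<Theta> ^ a j) * s j" by (simp add: star_mult st)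
    also have "\<dots> = s i * \<Theta> ^ a i"
      using p_even[OF ij(2)] p_odd[OF ij(2)] s_unit[OF ij(2)] a_p[OF ij(2)] True
      by (cases "even (a j)") (auto simp: star_Theta_power)
    finally show ?thesis using ij True e by (simp add: A_def)
  next
    case False then show ?thesis using ij e by (simp add: A_def)
  qed
qed auto

abbreviation Mo :: "int \<Rightarrow> 'd mat set" where "Mo k \<equiv> matrices_over n n (PP k)"

section \<open>Valuation in fractional steps and lattices of matrices\<close>

definition am :: int where "am = (\<Sum>i<n. int (a i))"

text \<open>Every difference \<open>d\<close> of two exponents satisfies
  \<open>\<bar>d\<bar> \<le> am < N - 1\<close>. A shift by \<open>d / N\<close>, even combined with
  one by \<open>1 / N\<close>, therefore moves a bound by less than one step, and the fractional
  bounds used below round to the intended integral ones.\<close>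

definition N :: int where "N = am + 2"

lemma am_ge: "i < n \<Longrightarrow> int (a i) \<le> am"
  unfolding am_def by (rule member_le_sum) auto

lemma am_nonneg: "0 \<le> am"
  unfolding am_def by (rule sum_nonneg) simp

lemma N_pos: "0 < N" using am_nonneg by (simp add: N_def)

text \<open>The ball \<open>N * w x \<ge> r\<close>: the valuation refined to steps of size \<open>1 / N\<close>.\<close>

definition BB :: "int \<Rightarrow> 'd set" where "BB r = PP (- ((- r) div N))"

text \<open>The number \<open>- ((- r) div N)\<close> is \<open>r / N\<close> rounded up.\<close>

lemma BB_iff: "x \<in> BB r \<longleftrightarrow> x = 0 \<or> r \<le> N * w x"
proof -
  have "- ((- r) div N) \<le> k \<longleftrightarrow> r \<le> N * k" for k
  proof -
    define m where "m = (- r) div N"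
    have m: "N * m \<le> - r" "- r < N * (m + 1)"
    proof -
      define e where "e = (- r) mod N"
      have "N * m + e = - r" "0 \<le> e" "e < N"
        using N_pos by (simp_all only: m_def e_def mult_div_mod_eq pos_mod_sign pos_mod_bound)
      then show "N * m \<le> - r" "- r < N * (m + 1)" by (simp_all add: distrib_left)
    qed
    show ?thesis unfolding m_def[symmetric]
    proof
      assume "- m \<le> k"
      then have "- k \<le> m" by simp
      then have "N * (- k) \<le> N * m" using N_pos by (intro mult_left_mono) auto
      then show "r \<le> N * k" using m by simp
    next
      assume "r \<le> N * k"
      then have "N * (- k) < N * (m + 1)" using m by simp
      then have "- k < m + 1" using N_pos by (simp only: mult_less_cancel_left_pos)
      then show "- m \<le> k" by simp
    qed
  qed
  then show ?thesis by (simp add: BB_def PP_iff)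
qed

lemma subgrp_BB: "subgrp (BB r)" unfolding BB_def by (rule subgrp_PP)

lemma BB_mult: "x \<in> BB r \<Longrightarrow> y \<in> BB r' \<Longrightarrow> x * y \<in> BB (r + r')"
  by (cases "x = 0"; cases "y = 0") (auto simp: BB_iff w_mult distrib_left)

lemma BB_mono: "r' \<le> r \<Longrightarrow> BB r \<subseteq> BB r'"
  by (auto simp: BB_iff)

lemma BB_sub_PP: "N * (k - 1) < r \<Longrightarrow> BB r \<subseteq> PP k"
proof
  fix x assume *: "N * (k - 1) < r" "x \<in> BB r"
  show "x \<in> PP k"
  proof (cases "x = 0")
    case False
    then have "N * (k - 1) < N * w x" using * by (simp add: BB_iff)
    then have "k - 1 < w x" using N_pos by simp
    then show ?thesis by (simp add: PP_iff)
  qed simp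
qed

lemma PP_sub_BB: "r \<le> N * k \<Longrightarrow> PP k \<subseteq> BB r"
proof
  fix x assume *: "r \<le> N * k" "x \<in> PP k"
  show "x \<in> BB r"
  proof (cases "x = 0")
    case False
    then have "N * k \<le> N * w x" using * N_pos by (simp add: PP_iff)
    then show ?thesis using * by (simp add: BB_iff)
  qed (simp add: BB_iff)
qed

lemma PP_eq_BB: "PP k = BB (N * k)"
  using PP_sub_BB[of "N * k" k] BB_sub_PP[of k "N * k"] N_pos by (auto simp: algebra_simps)

definition bd :: "(nat \<Rightarrow> nat \<Rightarrow> int) \<Rightarrow> 'd mat set" where
  "bd f = {z \<in> carrier_mat n n. \<forall>i<n. \<forall>j<n. z $$ (i, j) \<in> BB (f i j)}"

lemma bd_carrier: "z \<in> bd f \<Longrightarrow> z \<in> carrier_mat n n"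
  by (simp add: bd_def)

lemma matrices_over_PP: "(Mo k) = bd (\<lambda>_ _. N * k)"
  by (simp add: matrices_over_def bd_def PP_eq_BB)

lemma bd_mono: "(\<And>i j. i < n \<Longrightarrow> j < n \<Longrightarrow> g i j \<le> f i j) \<Longrightarrow> bd f \<subseteq> bd g"
  using BB_mono unfolding bd_def by blast

lemma bd_add: "x \<in> bd f \<Longrightarrow> y \<in> bd f \<Longrightarrow> x + y \<in> bd f"
  by (auto simp: bd_def intro!: subgrp_add[OF subgrp_BB])

lemma bd_diff: "x \<in> bd f \<Longrightarrow> y \<in> bd f \<Longrightarrow> x - y \<in> bd f"
  by (auto simp: bd_def intro!: subgrp_diff[OF subgrp_BB])

lemma bd_uminus: "x \<in> bd f \<Longrightarrow> - x \<in> bd f"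
  by (auto simp: bd_def intro!: subgrp_minus[OF subgrp_BB])

lemma bd_zero: "0\<^sub>m n n \<in> bd f"
  by (auto simp: bd_def intro!: subgrp_zero[OF subgrp_BB])

lemma bd_mult:
  assumes "x \<in> bd f" "y \<in> bd g"
    and "\<And>i j k. i < n \<Longrightarrow> j < n \<Longrightarrow> k < n \<Longrightarrow> h i j \<le> f i k + g k j"
  shows "x * y \<in> bd h"
proof -
  have c: "x \<in> carrier_mat n n" "y \<in> carrier_mat n n" using assms by (auto simp: bd_def)
  have "(x * y) $$ (i, j) \<in> BB (h i j)" if ij: "i < n" "j < n" for i j
  proof -
    have e: "(x * y) $$ (i, j) = (\<Sum>k\<in>{0..<n}. x $$ (i, k) * y $$ (k, j))"
      using c ij by (auto simp: scalar_prod_def intro!: sum.cong)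
    have "x $$ (i, k) * y $$ (k, j) \<in> BB (h i j)" if "k \<in> {0..<n}" for k
    proof -
      have "x $$ (i, k) * y $$ (k, j) \<in> BB (f i k + g k j)"
        using assms ij that by (intro BB_mult) (auto simp: bd_def)
      then show ?thesis using BB_mono[OF assms(3)[OF ij, of k]] that by auto
    qed
    then show ?thesis unfolding e by (rule subgrp_sum[OF subgrp_BB])
  qed
  then show ?thesis using c by (auto simp: bd_def)
qed

lemma bd_adjoint: "x \<in> bd f \<Longrightarrow> adjoint x \<in> bd (\<lambda>i j. f j i)"
  by (auto simp: bd_def BB_iff w_star) blast

lemma A_in_bd: "(\<And>i. i < n \<Longrightarrow> f i (p i) \<le> N * int (a i)) \<Longrightarrow> A \<in> bd f"
  by (auto simp: bd_def BB_iff A_def A_entry_w)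

lemma Ainv_in_bd:
  assumes "\<And>i. i < n \<Longrightarrow> f i (p i) \<le> - (N * int (a i))" shows "Ainv \<in> bd f"
proof -
  have "w (inverse (s (p i) * \<Theta> ^ a (p i))) = - int (a i)" if "i < n" for i
    using that s_nonzero[OF p_less] A_entry_w[OF p_less] a_p by (subst w_inverse) simp_all
  then show ?thesis using assms by (auto simp: bd_def BB_iff Ainv_def)
qed

lemma one_in_bd: "(\<And>i. i < n \<Longrightarrow> f i i \<le> 0) \<Longrightarrow> 1\<^sub>m n \<in> bd f"
  by (auto simp: bd_def BB_iff w_one)

text \<open>
  \<open>E 0\<close> is the ring of integral \<open>u\<close> for which \<open>A\<^sup>-\<^sup>1 u\<^sup>* A\<close> is integral as well, \<open>E 1\<close> is its
  radical, and \<open>HH k = A E k\<close>.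
\<close>

definition E :: "int \<Rightarrow> 'd mat set" where
  "E k = bd (\<lambda>i j. k + max ((N - 1) * (int (a j) - int (a i))) (int (a j) - int (a i)))"

definition HH :: "int \<Rightarrow> 'd mat set" where
  "HH k = bd (\<lambda>i j. k + max ((N - 1) * int (a j) + int (a i)) (int (a j) + (N - 1) * int (a i)))"

text \<open>The entry bound is a maximum of two functions of the positions that are additive along
  chains of indices, hence it is subadditive; the levels \<open>j\<close> and \<open>k\<close>
  simply add.\<close>

lemma E_mult: "x \<in> E j \<Longrightarrow> y \<in> E k \<Longrightarrow> x * y \<in> E (j + k)"
  unfolding E_def by (erule (1) bd_mult) (auto simp: max_def algebra_simps)

lemma HH_E_mult: "x \<in> HH j \<Longrightarrow> y \<in> E k \<Longrightarrow> x * y \<in> HH (j + k)"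
  unfolding E_def HH_def by (erule (1) bd_mult) (auto simp: max_def algebra_simps)

text \<open>The bound of \<open>HH\<close> is symmetric in the two indices, so \<open>HH\<close> is
  a left module for the adjoints of \<open>E\<close> just as it is a right module for
  \<open>E\<close>.\<close>

lemma E_HH_mult: "x \<in> E k \<Longrightarrow> y \<in> HH j \<Longrightarrow> adjoint x * y \<in> HH (j + k)"
  unfolding E_def HH_def by (drule bd_adjoint, erule (1) bd_mult) (auto simp: max_def algebra_simps)

lemma Ainv_HH: "x \<in> HH k \<Longrightarrow> Ainv * x \<in> E k"
proof -
  assume x: "x \<in> HH k"
  have "Ainv \<in> bd (\<lambda>i l. max (- ((N - 1) * int (a i)) - int (a l)) (- int (a i) - (N - 1) * int (a l)))"
    by (rule Ainv_in_bd) (auto simp: a_p algebra_simps)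
  then show ?thesis
    unfolding E_def by (rule bd_mult[OF _ x[unfolded HH_def]]) (auto simp: max_def algebra_simps)
qed

lemma A_HH: "A \<in> HH 0"
  unfolding HH_def by (rule A_in_bd) (auto simp: a_p algebra_simps)

lemma E_mono: "j \<le> k \<Longrightarrow> E k \<subseteq> E j"
  unfolding E_def by (rule bd_mono) simp

lemma HH_mono: "j \<le> k \<Longrightarrow> HH k \<subseteq> HH j"
  unfolding HH_def by (rule bd_mono) simp

lemma E_one: "1\<^sub>m n \<in> E 0"
  unfolding E_def by (rule one_in_bd) simp

lemma E_carrier: "x \<in> E k \<Longrightarrow> x \<in> carrier_mat n n"
  and HH_carrier: "x \<in> HH k \<Longrightarrow> x \<in> carrier_mat n n"
  by (auto simp: E_def HH_def intro: bd_carrier)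

lemma E_int: "E 0 \<subseteq> Mo 0"
proof
  fix x assume x: "x \<in> E 0"
  have "x $$ (i, j) \<in> PP 0" if ij: "i < n" "j < n" for i j
  proof -
    let ?r = "0 + max ((N - 1) * (int (a j) - int (a i))) (int (a j) - int (a i))"
    have "N * (0 - 1) < ?r" using am_ge[OF ij(1)] by (auto simp: N_def)
    from BB_sub_PP[OF this] show ?thesis using x ij by (auto simp: E_def bd_def)
  qed
  then show "x \<in> Mo 0" using E_carrier[OF x] by (simp add: matrices_over_def)
qed

lemma HH_sub: assumes "N * m \<le> k" shows "HH k \<subseteq> Mo m"
  unfolding HH_def matrices_over_PP
proof (rule bd_mono)
  fix i j assume "i < n" "j < n"
  have "0 \<le> (N - 1) * int (a j)" using am_nonneg by (simp add: N_def)
  then show "N * m \<le> k + max ((N - 1) * int (a j) + int (a i)) (int (a j) + (N - 1) * int (a i))"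
    using assms by linarith
qed

text \<open>No entry bound of \<open>HH 1\<close> exceeds \<open>N * am + 1\<close>, and
  \<open>N * (am + 1)\<close> is at least as large.\<close>

lemma sub_HH1: assumes "am + 1 \<le> m" shows "(Mo m) \<subseteq> HH 1"
  unfolding HH_def matrices_over_PP
proof (rule bd_mono)
  fix i j assume ij: "i < n" "j < n"
  have *: "(N - 1) * int (a k) \<le> (N - 1) * am" if "k < n" for k
    using am_ge[OF that] am_nonneg by (intro mult_left_mono) (auto simp: N_def)
  have "N * (am + 1) \<le> N * m" using assms N_pos by simp
  moreover have "N * (am + 1) = (N - 1) * am + am + N" by (simp add: algebra_simps)
  ultimately show "1 + max ((N - 1) * int (a j) + int (a i)) (int (a j) + (N - 1) * int (a i)) \<le> N * m"
    using *[OF ij(1)] *[OF ij(2)] am_ge[OF ij(1)] am_ge[OF ij(2)] N_pos by linarith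
qed

text \<open>The linearised equation \<open>adjoint z * A + A * z = h\<close> is solved by
  \<open>Ainv\<close> times one half of \<open>h\<close>, which stays in the lattice because 2 is a
  unit. Every other term of the expansion contains \<open>z\<close> together with \<open>g\<close>,
  or \<open>z\<close> twice, and gains a step.\<close>

lemma newton_step:
  assumes g: "g \<in> HH 1" and h: "h \<in> HH k" "adjoint h = h" and k: "1 \<le> k"
  obtains z where "z \<in> E k" "act (A + g) (1\<^sub>m n + z) - (A + g + h) \<in> HH (k + 1)"
proof -
  define d where "d = map_mat ((*) (emb (1/2))) h"
  have hc: "h \<in> carrier_mat n n" and gc: "g \<in> carrier_mat n n" using g h HH_carrier by auto
  have two: "emb (1/2) * x + emb (1/2) * x = x" for x
    using emb_add[of "1/2" "1/2"] by (simp flip: distrib_right)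
  have dc: "d \<in> carrier_mat n n" using hc by (simp add: d_def)
  have dd: "d + d = h" using hc by (intro eq_matI) (auto simp: d_def two)
  have dH: "d \<in> HH k"
  proof -
    have "w (emb (1/2) * x) = w x" for x
      by (cases "x = 0") (simp_all add: w_mult w_emb v_divide v_one v_two)
    then show ?thesis using h(1) dc unfolding HH_def bd_def
      by (auto simp: d_def BB_iff) blast
  qed
  have "star (h $$ (j, i)) = h $$ (i, j)" if "i < n" "j < n" for i j
    using h(2) adjoint_index[of i h j] hc that by simp
  then have da: "adjoint d = d"
    using hc by (intro eq_matI) (auto simp: d_def star_mult emb_commute)
  define z where "z = Ainv * d"
  have zE: "z \<in> E k" unfolding z_def by (rule Ainv_HH[OF dH])
  have zc: "z \<in> carrier_mat n n" "adjoint z \<in> carrier_mat n n" using E_carrier[OF zE] by auto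
  have Az: "A * z = d"
    unfolding z_def by (subst assoc_mult_mat[of _ n n _ n _ n, symmetric]) (use dc in \<open>auto simp: A_Ainv\<close>)
  have zA: "adjoint z * A = d"
    using adjoint_mult[of A n n z n] zc by (simp add: Az da adjoint_A)
  have gA: "A + g \<in> HH 0"
    using bd_add A_HH subsetD[OF HH_mono g, of 0] unfolding HH_def by simp
  let ?r = "adjoint z * g + g * z + adjoint z * ((A + g) * z)"
  have r1: "adjoint z * g \<in> HH (k + 1)" using E_HH_mult[OF zE g] by (simp add: add.commute)
  have r2: "g * z \<in> HH (k + 1)" using HH_E_mult[OF g zE] by (simp add: add.commute)
  have r3: "adjoint z * ((A + g) * z) \<in> HH (k + 1)"
    using E_HH_mult[OF zE HH_E_mult[OF gA zE]] subsetD[OF HH_mono, of "k + 1" "0 + k + k"] k by simp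
  have r: "?r \<in> HH (k + 1)"
    using bd_add r1 r2 r3 unfolding HH_def by blast
  have "act (A + g) (1\<^sub>m n + z) = (1\<^sub>m n + adjoint z) * ((A + g) * (1\<^sub>m n + z))"
    unfolding act_def using zc gc
    by (simp add: adjoint_add[of _ n n] assoc_mult_mat[of _ n n _ n _ n])
  also have "(A + g) * (1\<^sub>m n + z) = (A + g) + (d + g * z)"
    using zc gc by (simp add: mult_add_distrib_mat[of _ n n _ n] add_mult_distrib_mat[of _ n n _ _ n] Az)
  also have "(1\<^sub>m n + adjoint z) * \<dots> = (A + g) + (d + g * z) + adjoint z * ((A + g) * (1\<^sub>m n + z))"
    using zc gc dc \<open>(A + g) * (1\<^sub>m n + z) = (A + g) + (d + g * z)\<close>
    by (simp add: add_mult_distrib_mat[of _ n n _ _ n])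
  also have "adjoint z * ((A + g) * (1\<^sub>m n + z)) = d + adjoint z * g + adjoint z * ((A + g) * z)"
  proof -
    have "(A + g) * (1\<^sub>m n + z) = (A + g) + (A + g) * z"
      using zc gc by (simp add: mult_add_distrib_mat[of _ n n _ n])
    then show ?thesis
      using zc gc by (simp add: mult_add_distrib_mat[of _ n n _ n] zA)
  qed
  finally have e: "act (A + g) (1\<^sub>m n + z) =
      (A + g) + (d + g * z) + (d + adjoint z * g + adjoint z * ((A + g) * z))" .
  have "act (A + g) (1\<^sub>m n + z) - (A + g + h) = ?r"
  proof -
    have c: "g * z \<in> carrier_mat n n" "adjoint z * g \<in> carrier_mat n n"
      "adjoint z * ((A + g) * z) \<in> carrier_mat n n" using r1 r2 r3 HH_carrier by auto
    show ?thesis unfolding e dd[symmetric] using c gc dc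
      by (intro eq_matI) (auto simp del: index_mult_mat(1))
  qed
  then show ?thesis using that zE r by simp
qed

lemma act_herm_diff:
  assumes "h \<in> carrier_mat n n" "adjoint h = h" "h' \<in> carrier_mat n n" "adjoint h' = h'" "t \<in> carrier_mat n n"
  shows "adjoint (act (A + h) t - (A + h')) = act (A + h) t - (A + h')"
proof -
  have "adjoint (A + h) = A + h" "adjoint (A + h') = A + h'"
    using assms by (auto simp: adjoint_add[of _ n n] adjoint_A)
  then show ?thesis using assms adjoint_act[of "A + h" n t]
    by (simp add: adjoint_diff[of _ n n])
qed

text \<open>If \<open>r\<close> is the error reached so far, the current form is
  \<open>A + (h' + r)\<close>, and \<open>newton_step\<close> with the correction \<open>- r\<close>
  raises the level. The new factor \<open>1 + z\<close> keeps \<open>t\<close> congruent to 1 modulo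
  \<open>E 1\<close>.\<close>

lemma newton:
  assumes h: "h \<in> HH 1" "adjoint h = h" and h': "h' \<in> HH 1" "adjoint h' = h'"
  shows "\<exists>t. t - 1\<^sub>m n \<in> E 1 \<and> t \<in> carrier_mat n n \<and> act (A + h) t - (A + h') \<in> HH (int k + 1)"
proof (induction k)
  case 0
  have c: "h \<in> carrier_mat n n" "h' \<in> carrier_mat n n" using h h' HH_carrier by auto
  have "A + h - (A + h') = h - h'" using c by (intro eq_matI) auto
  moreover have "h - h' \<in> HH 1" using h h' bd_diff unfolding HH_def by blast
  moreover have "1\<^sub>m n - 1\<^sub>m n = (0\<^sub>m n n :: 'd mat)" by (intro eq_matI) auto
  then have "1\<^sub>m n - 1\<^sub>m n \<in> E 1" unfolding E_def by (simp only: bd_zero)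
  ultimately show ?case using c by (intro exI[of _ "1\<^sub>m n"]) (simp add: act_one)
next
  case (Suc k)
  have c: "h \<in> carrier_mat n n" "h' \<in> carrier_mat n n" using h h' HH_carrier by auto
  obtain t where t: "t - 1\<^sub>m n \<in> E 1" "t \<in> carrier_mat n n"
    "act (A + h) t - (A + h') \<in> HH (int k + 1)" using Suc by blast
  define r where "r = act (A + h) t - (A + h')"
  have rc: "r \<in> carrier_mat n n" using t HH_carrier by (auto simp: r_def)
  have rh: "adjoint r = r" unfolding r_def by (rule act_herm_diff) (use c h h' t in auto)
  have g: "h' + r \<in> HH 1"
    using bd_add h' subsetD[OF HH_mono t(3), of 1] unfolding HH_def r_def by simp
  have mr: "- r \<in> HH (int k + 1)" using bd_uminus t(3) unfolding HH_def r_def by blast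
  have mrh: "adjoint (- r) = - r"
  proof (rule eq_matI)
    fix i j assume "i < dim_row (- r)" "j < dim_col (- r)"
    then have ij: "i < n" "j < n" using rc by auto
    have "star (r $$ (j, i)) = r $$ (i, j)"
      using arg_cong[OF rh, of "\<lambda>x. x $$ (i, j)"] ij rc by simp
    then show "adjoint (- r) $$ (i, j) = (- r) $$ (i, j)" using ij rc by (simp add: star_minus)
  qed (use rc in auto)
  obtain z where z: "z \<in> E (int k + 1)"
    "act (A + (h' + r)) (1\<^sub>m n + z) - (A + (h' + r) + - r) \<in> HH (int k + 1 + 1)"
    using newton_step[OF g mr mrh] by auto
  have zc: "z \<in> carrier_mat n n" using E_carrier[OF z(1)] .
  have e1: "A + (h' + r) + - r = A + h'" using rc c by (intro eq_matI) auto
  have e2: "A + (h' + r) = act (A + h) t"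
  proof -
    have "act (A + h) t \<in> carrier_mat n n" using c t by simp
    then show ?thesis using c unfolding r_def by (intro eq_matI) auto
  qed
  have "act (A + h) (t * (1\<^sub>m n + z)) - (A + h') \<in> HH (int (Suc k) + 1)"
    using z(2) act_mult[of "A + h" n t "1\<^sub>m n + z"] c t(2) zc unfolding e1 unfolding e2 by (simp add: add.commute)
  moreover have "t * (1\<^sub>m n + z) - 1\<^sub>m n \<in> E 1"
  proof -
    have "t = 1\<^sub>m n + (t - 1\<^sub>m n)" using t(2) by (intro eq_matI) auto
    moreover have "\<dots> \<in> E 0"
      using bd_add E_one subsetD[OF E_mono t(1), of 0] unfolding E_def by simp
    ultimately have "t \<in> E 0" by simp
    from E_mult[OF this z(1)] have "t * z \<in> E (int k + 1)" by simp
    then have tz: "t * z \<in> E 1" using E_mono[of 1 "int k + 1"] by auto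
    have "t * (1\<^sub>m n + z) - 1\<^sub>m n = (t - 1\<^sub>m n) + t * z"
      using t(2) zc E_carrier[OF tz]
      by (subst mult_add_distrib_mat[of _ n n _ n]) (auto intro!: eq_matI simp del: index_mult_mat(1))
    then show ?thesis using bd_add t(1) tz unfolding E_def by simp
  qed
  moreover have "t * (1\<^sub>m n + z) \<in> carrier_mat n n" using t(2) zc by simp
  ultimately show ?case by blast
qed

section \<open>Approximate isometries belong to the ring \<open>E 0\<close>\<close>

lemma finite_mat_code:
  "finite ((\<lambda>u. \<lambda>(i, j)\<in>{..<n} \<times> {..<n}. rep (PP (int l)) (u $$ (i, j))) ` Mo 0)"
proof (rule finite_subset)
  show "(\<lambda>u. \<lambda>(i, j)\<in>{..<n} \<times> {..<n}. rep (PP (int l)) (u $$ (i, j))) ` Mo 0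
    \<subseteq> {..<n} \<times> {..<n} \<rightarrow>\<^sub>E rep (PP (int l)) ` PP 0"
    by (auto simp: matrices_over_def PiE_iff extensional_def split: if_splits)
  show "finite ({..<n} \<times> {..<n} \<rightarrow>\<^sub>E rep (PP (int l)) ` PP 0)"
    by (intro finite_PiE) (use ncl_PP(2)[of 0 "int l"] in auto)
qed

lemma mat_code_eq_iff:
  assumes "u \<in> carrier_mat n n" "u' \<in> carrier_mat n n"
  shows "(\<lambda>(i, j)\<in>{..<n} \<times> {..<n}. rep (PP k) (u $$ (i, j))) =
      (\<lambda>(i, j)\<in>{..<n} \<times> {..<n}. rep (PP k) (u' $$ (i, j))) \<longleftrightarrow>
    u - u' \<in> Mo k" (is "?f = ?g \<longleftrightarrow> _")
proof -
  have "?f = ?g \<longleftrightarrow> (\<forall>i<n. \<forall>j<n. rep (PP k) (u $$ (i, j)) = rep (PP k) (u' $$ (i, j)))"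
  proof
    assume "?f = ?g"
    then show "\<forall>i<n. \<forall>j<n. rep (PP k) (u $$ (i, j)) = rep (PP k) (u' $$ (i, j))"
      by (auto dest: fun_cong[of _ _ "(i, j)" for i j] simp: restrict_def split: if_splits)
  qed (auto simp: restrict_def fun_eq_iff)
  then show ?thesis using assms
    by (auto simp: rep_eq_iff subgrp_PP matrices_over_def)
qed

lemma pow_mat_add:
  assumes "u \<in> carrier_mat n n" shows "u ^\<^sub>m (i + j) = u ^\<^sub>m i * u ^\<^sub>m j"
proof (induction j)
  case (Suc j)
  then show ?case using assms by (simp add: assoc_mult_mat[of _ n n _ n _ n])
qed (use assms in auto)

lemma Mo_mult:
  "x \<in> Mo j \<Longrightarrow> y \<in> Mo k \<Longrightarrow> x * y \<in> Mo (j + k)"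
  unfolding matrices_over_PP by (erule (1) bd_mult) (simp add: distrib_left)

lemma Mo_adjoint: "x \<in> Mo j \<Longrightarrow> adjoint x \<in> Mo j"
  unfolding matrices_over_PP by (drule bd_adjoint)

lemma Mo_mono: "j \<le> k \<Longrightarrow> (Mo k) \<subseteq> Mo j"
  unfolding matrices_over_PP using N_pos by (intro bd_mono) simp

lemma Mo_add: "x \<in> Mo j \<Longrightarrow> y \<in> Mo j \<Longrightarrow> x + y \<in> Mo j"
  and Mo_diff: "x \<in> Mo j \<Longrightarrow> y \<in> Mo j \<Longrightarrow> x - y \<in> Mo j"
  unfolding matrices_over_PP by (auto intro: bd_add bd_diff)

lemma Mo_carrier: "x \<in> matrices_over n n S \<Longrightarrow> x \<in> carrier_mat n n"
  by (simp add: matrices_over_def)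

lemma Mo_one: "1\<^sub>m n \<in> Mo 0"
  by (auto simp: matrices_over_def)

lemma Mo_act: "x \<in> Mo j \<Longrightarrow> t \<in> Mo 0 \<Longrightarrow> act x t \<in> Mo j"
  unfolding act_def using Mo_mult[OF Mo_mult[OF Mo_adjoint, of t 0 x j], of t 0] by simp

lemma Mo_A: "A \<in> Mo 0" "Ainv \<in> Mo (- am)"
proof -
  show "A \<in> Mo 0" unfolding matrices_over_PP using N_pos by (intro A_in_bd) simp
  show "Ainv \<in> Mo (- am)"
    unfolding matrices_over_PP using N_pos am_ge by (intro Ainv_in_bd) simp
qed

text \<open>
  Modulo a high power of the maximal ideal the solutions form a finite monoid, so some power of
  \<open>u\<close> is congruent to \<open>1\<close>. This replaces a determinant argument for the invertibility of \<open>u\<close>.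
\<close>

lemma solution_power_cong:
  assumes u: "u \<in> Mo 0"
    and sol: "act A u - A \<in> Mo (int l)"
  obtains d where "u ^\<^sub>m Suc d - 1\<^sub>m n \<in> Mo (int l - am)"
proof -
  let ?M = "\<lambda>k. (Mo k)"
  have uc: "u \<in> carrier_mat n n" using u Mo_carrier by blast
  have pc: "u ^\<^sub>m k \<in> carrier_mat n n" for k using uc by simp
  have pM: "u ^\<^sub>m k \<in> ?M 0" for k
  proof (induction k)
    case (Suc k) then show ?case using Mo_mult[OF Suc u] by simp
  qed (use uc Mo_one in auto)
  have ps: "act A (u ^\<^sub>m k) - A \<in> ?M (int l)" for k
  proof (induction k)
    case 0
    have "act A (u ^\<^sub>m 0) - A = 0\<^sub>m n n" using uc by (intro eq_matI) (auto simp: act_one)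
    then show ?case unfolding matrices_over_PP by (simp only: bd_zero)
  next
    case (Suc k)
    let ?e = "act A (u ^\<^sub>m k) - A"
    have ac: "act A (u ^\<^sub>m k) \<in> carrier_mat n n" using pc by simp
    have ec: "?e \<in> carrier_mat n n" by (rule minus_carrier_mat) simp
    have "act A (u ^\<^sub>m k) = A + ?e" using ac by (intro eq_matI) auto
    then have "act A (u ^\<^sub>m Suc k) = act A u + act ?e u"
      using act_mult[of A n "u ^\<^sub>m k" u] act_add[of A n ?e u] pc uc ec by simp
    then have "act A (u ^\<^sub>m Suc k) - A = (act A u - A) + act ?e u"
      using mat_add_diff[of "act A u" n n "act ?e u" A] uc ec by simp
    then show ?case using Mo_add[OF sol Mo_act[OF Suc u]] by simp
  qed
  let ?c = "\<lambda>u. \<lambda>(i, j)\<in>{..<n} \<times> {..<n}. rep (PP (int l)) (u $$ (i, j))"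
  have "finite (range (\<lambda>k. ?c (u ^\<^sub>m k)))"
    by (rule finite_subset[OF _ finite_mat_code[of l]]) (use pM in blast)
  then have "\<not> inj (\<lambda>k. ?c (u ^\<^sub>m k))" using finite_imageD by blast
  then obtain i j where ij: "i < j" "?c (u ^\<^sub>m i) = ?c (u ^\<^sub>m j)"
    unfolding inj_def by (metis nat_neq_iff)
  then obtain d where d: "j = i + Suc d" using less_imp_Suc_add[of i j] by auto
  let ?x = "u ^\<^sub>m i" and ?y = "u ^\<^sub>m Suc d"
  have "?c (u ^\<^sub>m j) = ?c (u ^\<^sub>m i)" using ij(2) by simp
  then have "u ^\<^sub>m j - ?x \<in> ?M (int l)" by (simp only: mat_code_eq_iff[OF pc pc])
  then have xy: "?x * ?y - ?x \<in> ?M (int l)" by (simp only: d pow_mat_add[OF uc])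
  define y where "y = ?y"
  have yc: "y \<in> carrier_mat n n" and yM: "y \<in> ?M 0" using pc pM unfolding y_def by blast+
  define x where "x = ?x"
  have xc: "x \<in> carrier_mat n n" "adjoint x \<in> carrier_mat n n" and xM: "x \<in> ?M 0"
    using pc pM unfolding x_def by auto
  note xy = xy[folded x_def y_def]
  \<comment> \<open>The power \<open>x\<close> of \<open>u\<close> cannot be cancelled directly.
    Multiplication by \<open>adjoint x * A\<close> turns it into \<open>act A x\<close>, which is
    \<open>A\<close> up to an error in \<open>?M (int l)\<close>; afterwards \<open>Ainv\<close>
    removes \<open>A\<close> at the cost of \<open>am\<close> steps.\<close>
  have 1: "adjoint x * A * (x * y - x) \<in> ?M (int l)"
    using Mo_mult[OF Mo_mult[OF Mo_adjoint[OF xM] Mo_A(1)] xy] by simp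
  have aM: "act A x - A \<in> ?M (int l)" using ps[of i] by (simp add: x_def)
  have ac: "act A x \<in> carrier_mat n n" using xc by simp
  have "adjoint x * A * (x * y - x) = act A x * y - act A x"
    using xc yc unfolding act_def
    by (simp add: mult_minus_distrib_mat[of _ n n _ n] assoc_mult_mat[of _ n n _ n _ n])
  also have "\<dots> = (act A x - A) * y + (A * y - act A x)"
    using yc ac mult_carrier_mat[OF ac yc] mult_carrier_mat[of A n n y n]
    by (subst minus_mult_distrib_mat[of _ n n]) (auto intro!: eq_matI simp del: index_mult_mat(1))
  finally have 2: "(act A x - A) * y + (A * y - act A x) \<in> ?M (int l)" using 1 by simp
  have 3: "(act A x - A) * y \<in> ?M (int l)" using Mo_mult[OF aM yM] by simp
  have "A * y - A = ((act A x - A) * y + (A * y - act A x)) - (act A x - A) * y + (act A x - A)"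
    using yc ac Mo_carrier[OF 3] mult_carrier_mat[of A n n y n]
    by (auto intro!: eq_matI simp del: index_mult_mat(1))
  then have 4: "A * y - A \<in> ?M (int l)" using Mo_add[OF Mo_diff[OF 2 3] aM] by simp
  have "y - 1\<^sub>m n = Ainv * (A * y - A)"
    using yc by (simp add: mult_minus_distrib_mat[of _ n n _ n] Ainv_A
        assoc_mult_mat[of _ n n _ n _ n, symmetric] del: assoc_mult_mat)
  then have "y - 1\<^sub>m n \<in> ?M (int l - am)" using Mo_mult[OF Mo_A(2) 4] by simp
  then show ?thesis using that unfolding y_def by blast
qed

text \<open>The matrix \<open>G = Ainv * (adjoint u * A)\<close> satisfies
  \<open>G * u \<equiv> 1\<close>, so \<open>G\<close> times a positive power of \<open>u\<close> is
  integral; as some such power is congruent to 1, \<open>G\<close> is integral itself. The loss of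
  \<open>am\<close> in \<open>G\<close> and again in \<open>solution_power_cong\<close> explains the
  bound on \<open>l\<close>. Integrality of \<open>G\<close> then bounds the entries of
  \<open>adjoint u = A * (G * Ainv)\<close> by the differences of the exponents.\<close>

lemma solution_in_E:
  assumes u: "u \<in> Mo 0"
    and sol: "act A u - A \<in> Mo (int l)" and l: "2 * am \<le> int l"
  shows "u \<in> E 0"
proof -
  let ?M = "\<lambda>k. (Mo k)"
  obtain d where d: "u ^\<^sub>m Suc d - 1\<^sub>m n \<in> ?M (int l - am)"
    using solution_power_cong[OF u sol] by blast
  have uc: "u \<in> carrier_mat n n" "adjoint u \<in> carrier_mat n n" using u Mo_carrier by auto
  have pc: "u ^\<^sub>m k \<in> carrier_mat n n" for k using uc by simp
  have pM: "u ^\<^sub>m k \<in> ?M 0" for k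
  proof (induction k)
    case (Suc k) then show ?case using Mo_mult[OF Suc u] by simp
  qed (use uc Mo_one in auto)
  define G where "G = Ainv * (adjoint u * A)"
  have Gc: "G \<in> carrier_mat n n" using uc by (simp add: G_def)
  have GM: "G \<in> ?M (- am)"
    using Mo_mult[OF Mo_A(2) Mo_mult[OF Mo_adjoint[OF u] Mo_A(1)]] by (simp add: G_def)
  have ac: "act A u \<in> carrier_mat n n" using uc by simp
  have Gu: "G * u = 1\<^sub>m n + Ainv * (act A u - A)"
  proof -
    have "G * u = Ainv * act A u"
      using uc by (simp add: G_def act_def assoc_mult_mat[of _ n n _ n _ n])
    moreover have "Ainv * (act A u - A) = Ainv * act A u - 1\<^sub>m n"
      using ac by (simp add: mult_minus_distrib_mat[of _ n n _ n] Ainv_A)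
    ultimately show ?thesis
      using mult_carrier_mat[OF A_carrier(2) ac] by (auto intro!: eq_matI simp del: index_mult_mat(1))
  qed
  have "G * u \<in> ?M 0"
  proof -
    have "Ainv * (act A u - A) \<in> ?M (- am + int l)" by (rule Mo_mult[OF Mo_A(2) sol])
    then have "Ainv * (act A u - A) \<in> ?M 0" using Mo_mono[of 0 "- am + int l"] l am_nonneg by auto
    then show ?thesis unfolding Gu by (rule Mo_add[OF Mo_one])
  qed
  then have Gy: "G * u ^\<^sub>m Suc d \<in> ?M 0"
  proof -
    assume "G * u \<in> ?M 0"
    from Mo_mult[OF this pM[of d]] have "G * u * u ^\<^sub>m d \<in> ?M 0" by simp
    moreover have "u ^\<^sub>m Suc d = u * u ^\<^sub>m d" using pow_mat_add[OF uc(1), of 1 d] uc by simp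
    ultimately show ?thesis using Gc uc pc by (simp add: assoc_mult_mat[of _ n n _ n _ n] del: pow_mat.simps)
  qed
  define y where "y = u ^\<^sub>m Suc d"
  have yc: "y \<in> carrier_mat n n" using pc unfolding y_def by blast
  have "G * (y - 1\<^sub>m n) \<in> ?M (- am + (int l - am))"
    unfolding y_def by (rule Mo_mult[OF GM d])
  then have "G * (y - 1\<^sub>m n) \<in> ?M 0" using Mo_mono[of 0 "- am + (int l - am)"] l by auto
  moreover have "G = G * y - G * (y - 1\<^sub>m n)"
    using Gc yc mult_carrier_mat[OF Gc yc]
    by (subst mult_minus_distrib_mat[of _ n n _ n]) (auto intro!: eq_matI simp del: index_mult_mat(1))
  ultimately have G0: "G \<in> ?M 0" using Mo_diff[OF Gy[folded y_def]] by metis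
  have "A * (G * Ainv) = adjoint u"
  proof -
    have "A * (G * Ainv) = (A * Ainv) * (adjoint u * (A * Ainv))"
      using uc by (simp add: G_def assoc_mult_mat[of _ n n _ n _ n])
    then show ?thesis using uc by (simp add: A_Ainv)
  qed
  moreover have "A * (G * Ainv) \<in> bd (\<lambda>i j. N * int (a i) - N * int (a j))"
  proof -
    have A1: "A \<in> bd (\<lambda>i k. N * int (a i) + N * \<bar>int (a i) - int (a k)\<bar>)"
      by (rule A_in_bd) (simp add: a_p)
    have A2: "Ainv \<in> bd (\<lambda>k j. N * \<bar>int (a k) - int (a j)\<bar> - N * int (a j))"
      by (rule Ainv_in_bd) (simp add: a_p)
    have abs: "0 \<le> N * \<bar>x\<bar>" for x using N_pos by simp
    have A3: "G * Ainv \<in> bd (\<lambda>k j. - N * int (a j))"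
      by (rule bd_mult[OF G0[unfolded matrices_over_PP] A2]) (use abs in auto)
    show ?thesis by (rule bd_mult[OF A1 A3]) (use abs in auto)
  qed
  ultimately have "adjoint u \<in> bd (\<lambda>i j. N * int (a i) - N * int (a j))" by simp
  from bd_adjoint[OF this] have ub: "u \<in> bd (\<lambda>i j. N * int (a j) - N * int (a i))" by simp
  have u0: "u \<in> bd (\<lambda>_ _. 0)" using u by (simp add: matrices_over_PP)
  show "u \<in> E 0"
    unfolding E_def bd_def
  proof (intro CollectI conjI allI impI uc)
    fix i j assume ij: "i < n" "j < n"
    let ?r = "0 + max ((N - 1) * (int (a j) - int (a i))) (int (a j) - int (a i))"
    show "u $$ (i, j) \<in> BB ?r"
    proof (cases "a i \<le> a j")
      case True
      have "0 \<le> (N - 2) * (int (a j) - int (a i))" using True am_nonneg by (simp add: N_def)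
      then have "?r \<le> N * int (a j) - N * int (a i)" using True by (auto simp: algebra_simps)
      from BB_mono[OF this] show ?thesis using ub ij by (auto simp: bd_def)
    next
      case False
      have "(N - 1) * (int (a j) - int (a i)) \<le> 0"
        using False N_pos by (intro mult_nonneg_nonpos) auto
      then have "?r \<le> 0" using False by simp
      from BB_mono[OF this] show ?thesis using u0 ij by (auto simp: bd_def)
    qed
  qed
qed

end

section \<open>Counting solutions by translation\<close>

text \<open>The last hypothesis says that the coordinates of the elements of \<open>W\<close> range
  independently over the sets \<open>S x\<close>, so their classes form a full product.\<close>

lemma card_box:
  assumes "finite I" and "\<And>u x. u \<in> W \<Longrightarrow> x \<in> I \<Longrightarrow> val u x \<in> S x"
    and "\<And>f. f \<in> Pi\<^sub>E I S \<Longrightarrow> \<exists>u\<in>W. \<forall>x\<in>I. val u x = f x"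
  shows "card ((\<lambda>u. \<lambda>x\<in>I. r (val u x)) ` W) = (\<Prod>x\<in>I. card (r ` S x))"
proof -
  have "(\<lambda>u. \<lambda>x\<in>I. r (val u x)) ` W = (\<Pi>\<^sub>E x\<in>I. r ` S x)"
  proof (intro subset_antisym subsetI)
    fix g assume g: "g \<in> (\<Pi>\<^sub>E x\<in>I. r ` S x)"
    define f where "f = (\<lambda>x\<in>I. SOME y. y \<in> S x \<and> r y = g x)"
    have f: "f x \<in> S x \<and> r (f x) = g x" if "x \<in> I" for x
    proof -
      have "\<exists>y. y \<in> S x \<and> r y = g x" using g that by fastforce
      from someI_ex[OF this] show ?thesis using that by (simp add: f_def)
    qed
    then have "f \<in> Pi\<^sub>E I S" by (auto simp: f_def)
    then obtain u where u: "u \<in> W" "\<forall>x\<in>I. val u x = f x" using assms(3) by blast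
    have "g = (\<lambda>x\<in>I. r (val u x))"
      using g f u(2) by (intro extensionalityI[of _ I]) (auto simp: PiE_iff)
    then show "g \<in> (\<lambda>u. \<lambda>x\<in>I. r (val u x)) ` W" using u(1) by blast
  qed (use assms(2) in auto)
  then show ?thesis by (simp add: card_PiE assms(1))
qed

context monomial_form
begin

text \<open>The class of a matrix modulo \<open>PP k\<close>, recorded as an extensional function of
  the position, so that \<open>card_box\<close> applies.\<close>

definition code :: "int \<Rightarrow> 'd mat \<Rightarrow> nat \<times> nat \<Rightarrow> 'd" where
  "code k u = (\<lambda>(i, j)\<in>{..<n} \<times> {..<n}. rep (PP k) (u $$ (i, j)))"

lemma code_eq_iff:
  "u \<in> carrier_mat n n \<Longrightarrow> u' \<in> carrier_mat n n \<Longrightarrow>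
    code k u = code k u' \<longleftrightarrow> u - u' \<in> Mo k"
  unfolding code_def by (rule mat_code_eq_iff)

definition Herm :: "'d mat set" where "Herm = {h \<in> HH 1. adjoint h = h}"

text \<open>
  \<open>Gam\<close> contains the solutions \<open>Sol k\<close> for large \<open>k\<close>; unlike them it is cut out by conditions modulo
  \<open>\<P>\<close> on the diagonal blocks, so that it can be counted directly.
\<close>

definition Gam :: "'d mat set" where "Gam = {u \<in> E 0. act A u - A \<in> HH 1}"

definition Sol :: "int \<Rightarrow> 'd mat set" where
  "Sol k = {u \<in> Mo 0. act A u - A \<in> Mo k}"

lemma mat_add_diff_cancel:
  fixes x y z :: "'d mat"
  shows "x \<in> carrier_mat m k \<Longrightarrow> y \<in> carrier_mat m k \<Longrightarrow> z \<in> carrier_mat m k \<Longrightarrow> x + y + z - x = y + z"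
  by (rule eq_matI) auto

lemma E_decomp: assumes "t - 1\<^sub>m n \<in> E 1" "t \<in> carrier_mat n n"
  shows "t = 1\<^sub>m n + (t - 1\<^sub>m n)" "t \<in> E 0"
proof -
  show e: "t = 1\<^sub>m n + (t - 1\<^sub>m n)" using assms(2) by (intro eq_matI) auto
  have "1\<^sub>m n + (t - 1\<^sub>m n) \<in> E 0"
    using bd_add E_one subsetD[OF E_mono assms(1), of 0] unfolding E_def by simp
  then show "t \<in> E 0" using e by simp
qed

lemma E_sub: "N * j + am \<le> k \<Longrightarrow> E k \<subseteq> Mo j"
  unfolding E_def matrices_over_PP
proof (rule bd_mono)
  fix i j' assume *: "N * j + am \<le> k" "i < n" "j' < n"
  show "N * j \<le> k + max ((N - 1) * (int (a j') - int (a i))) (int (a j') - int (a i))"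
    using am_ge[OF *(2)] *(1) by linarith
qed

text \<open>Starting from 1, replacing \<open>t'\<close> by \<open>t' * (1 - e)\<close> turns the
  error \<open>e\<close> into \<open>- (e * e)\<close>. Such an approximate right inverse suffices
  for cancelling \<open>t\<close> modulo a power of the ideal.\<close>

lemma E_unipotent_inverse:
  assumes t: "t - 1\<^sub>m n \<in> E 1" "t \<in> carrier_mat n n"
  shows "\<exists>t'\<in>E 0. t * t' - 1\<^sub>m n \<in> E (int k + 1)"
proof (induction k)
  case 0 then show ?case using E_one t by (intro bexI[of _ "1\<^sub>m n"]) auto
next
  case (Suc k)
  then obtain t' where t': "t' \<in> E 0" "t * t' - 1\<^sub>m n \<in> E (int k + 1)" by blast
  define e where "e = t * t' - 1\<^sub>m n"
  have tc: "t' \<in> carrier_mat n n" and ec: "e \<in> carrier_mat n n"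
    using t' E_carrier unfolding e_def by blast+
  have tt: "t * t' = 1\<^sub>m n + e"
    using mult_carrier_square[OF t(2) tc] unfolding e_def by (auto intro!: eq_matI simp del: index_mult_mat(1))
  have eE: "e \<in> E (int k + 1)" using t' by (simp add: e_def)
  have "1\<^sub>m n - e \<in> E 0"
    using bd_diff E_one subsetD[OF E_mono eE, of 0] unfolding E_def by simp
  then have "t' * (1\<^sub>m n - e) \<in> E 0" using E_mult[OF t'(1)] by fastforce
  moreover have "t * (t' * (1\<^sub>m n - e)) - 1\<^sub>m n = - (e * e)"
  proof -
    have "t * (t' * (1\<^sub>m n - e)) = (1\<^sub>m n + e) * (1\<^sub>m n - e)"
      using t(2) tc minus_carrier_mat[OF ec, of "1\<^sub>m n"]
      by (simp flip: tt add: assoc_mult_mat[of _ n n _ n _ n])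
    also have "\<dots> = (1\<^sub>m n + e) - (e + e * e)"
      using ec by (simp add: mult_minus_distrib_mat[of _ n n _ n] add_mult_distrib_mat[of _ n n _ _ n])
    finally show ?thesis
      using mult_carrier_square[OF ec ec] ec by (auto intro!: eq_matI simp del: index_mult_mat(1))
  qed
  moreover have "- (e * e) \<in> E (int (Suc k) + 1)"
  proof -
    have "e * e \<in> E (int k + 1 + (int k + 1))" by (rule E_mult[OF eE eE])
    then have "e * e \<in> E (int (Suc k) + 1)" using E_mono[of "int (Suc k) + 1" "int k + 1 + (int k + 1)"] by auto
    then show ?thesis using bd_uminus unfolding E_def by blast
  qed
  ultimately show ?case by metis
qed

lemma act_unipotent:
  assumes B: "B \<in> HH 0" and t: "t - 1\<^sub>m n \<in> E 1" "t \<in> carrier_mat n n"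
  shows "act B t - B \<in> HH 1"
proof -
  define z where "z = t - 1\<^sub>m n"
  have t1: "t = 1\<^sub>m n + z" "t \<in> E 0" using E_decomp[OF t] by (auto simp: z_def)
  have zE: "z \<in> E 1" using t by (simp add: z_def)
  have c: "z \<in> carrier_mat n n" "adjoint z \<in> carrier_mat n n" "B \<in> carrier_mat n n"
    "B * t \<in> carrier_mat n n" "B * z \<in> carrier_mat n n" "adjoint z * (B * t) \<in> carrier_mat n n"
    using E_carrier[OF zE] HH_carrier[OF B] t by auto
  have e1: "B * t = B + B * z"
    using c unfolding t1(1) by (simp add: mult_add_distrib_mat[of _ n n _ n])
  have "act B t = (1\<^sub>m n + adjoint z) * (B * t)"
    using c t(2) unfolding act_def t1(1) by (simp add: adjoint_add[of _ n n] assoc_mult_mat[of _ n n _ n _ n])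
  also have "\<dots> = B * t + adjoint z * (B * t)"
    using c by (simp add: add_mult_distrib_mat[of _ n n _ _ n])
  finally have "act B t - B = B * z + adjoint z * (B * t)"
    using c unfolding e1[symmetric] by (subst e1) (auto intro!: eq_matI simp: e1 simp del: index_mult_mat(1))
  moreover have "B * z \<in> HH 1" using HH_E_mult[OF B zE] by simp
  moreover have "adjoint z * (B * t) \<in> HH 1" using E_HH_mult[OF zE HH_E_mult[OF B t1(2)]] by simp
  ultimately show ?thesis using bd_add unfolding HH_def by simp
qed

lemma Gam_carrier: "u \<in> Gam \<Longrightarrow> u \<in> carrier_mat n n"
  by (auto simp: Gam_def intro: E_carrier)

text \<open>The form \<open>act A u\<close> stays in \<open>HH 0\<close>, and a translation
  congruent to 1 modulo \<open>E 1\<close> changes it only within \<open>HH 1\<close>.\<close>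

lemma Gam_mult:
  assumes u: "u \<in> Gam" and t: "t - 1\<^sub>m n \<in> E 1" "t \<in> carrier_mat n n"
  shows "u * t \<in> Gam"
proof -
  have uE: "u \<in> E 0" and g: "act A u - A \<in> HH 1" using u by (auto simp: Gam_def)
  have uc: "u \<in> carrier_mat n n" using uE E_carrier by blast
  have ac: "act A u \<in> carrier_mat n n" using uc by simp
  have "act A u = A + (act A u - A)" using ac by (intro eq_matI) auto
  also have "\<dots> \<in> HH 0" using bd_add A_HH subsetD[OF HH_mono g, of 0] unfolding HH_def by simp
  finally have B: "act A u \<in> HH 0" .
  have bc: "act (act A u) t \<in> carrier_mat n n" using ac t(2) by simp
  have "act A (u * t) - A = (act (act A u) t - act A u) + (act A u - A)"
    unfolding act_mult[OF A_carrier(1) uc t(2)] using ac bc by (intro eq_matI) auto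
  also have "\<dots> \<in> HH 1" using bd_add act_unipotent[OF B t] g unfolding HH_def by simp
  finally have "act A (u * t) - A \<in> HH 1" .
  moreover have "u * t \<in> E 0" using E_mult[OF uE E_decomp(2)[OF t]] by simp
  ultimately show ?thesis by (simp add: Gam_def)
qed

lemma Gam_one: "1\<^sub>m n \<in> Gam"
proof -
  have "act A (1\<^sub>m n) - A = 0\<^sub>m n n" by (intro eq_matI) (auto simp: act_one)
  then show ?thesis using E_one bd_zero unfolding Gam_def HH_def by simp
qed

lemma Gam_int: "Gam \<subseteq> Mo 0"
  using E_int by (auto simp: Gam_def)

lemma finite_code: "W \<subseteq> Mo 0 \<Longrightarrow> 0 \<le> k \<Longrightarrow> finite (code k ` W)"
  using finite_mat_code[of "nat k"] by (auto simp: code_def intro: finite_subset[rotated] image_mono)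

lemma act_diff_PP:
  assumes "u \<in> Mo 0" "u' \<in> Mo 0" "u - u' \<in> Mo k"
  shows "act A u - act A u' \<in> Mo k"
proof -
  define z where "z = u - u'"
  have zM: "z \<in> Mo k" using assms by (simp add: z_def)
  have c: "u \<in> carrier_mat n n" "u' \<in> carrier_mat n n" "z \<in> carrier_mat n n"
    using assms zM Mo_carrier by auto
  have u: "u = u' + z" using c unfolding z_def by (intro eq_matI) auto
  have c2: "A * u \<in> carrier_mat n n" "adjoint z \<in> carrier_mat n n" "adjoint u' \<in> carrier_mat n n"
    "adjoint z * (A * u) \<in> carrier_mat n n" "adjoint u' * (A * u') \<in> carrier_mat n n"
    "adjoint u' * (A * z) \<in> carrier_mat n n"
    using c by auto
  have e1: "act A u = adjoint u' * (A * u) + adjoint z * (A * u)"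
  proof -
    have "act A u = (adjoint u' + adjoint z) * (A * u)"
      using c unfolding act_def by (simp add: assoc_mult_mat[of _ n n _ n _ n])
        (simp add: u adjoint_add[of _ n n])
    then show ?thesis using c2 by (simp add: add_mult_distrib_mat[of _ n n _ _ n])
  qed
  have e2: "adjoint u' * (A * u) = adjoint u' * (A * u') + adjoint u' * (A * z)"
    using c unfolding u by (simp add: mult_add_distrib_mat[of _ n n _ n])
  have e3: "act A u' = adjoint u' * (A * u')"
    using c unfolding act_def by (simp add: assoc_mult_mat[of _ n n _ n _ n])
  have "act A u - act A u' = adjoint u' * (A * z) + adjoint z * (A * u)"
    unfolding e1 e2 e3 by (rule mat_add_diff_cancel[OF c2(5,6,4)])
  moreover have "adjoint u' * (A * z) \<in> Mo k"
    using Mo_mult[OF Mo_adjoint[OF assms(2)] Mo_mult[OF Mo_A(1) zM]] by simp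
  moreover have "adjoint z * (A * u) \<in> Mo k"
    using Mo_mult[OF Mo_adjoint[OF zM] Mo_mult[OF Mo_A(1) assms(1)]] by simp
  ultimately show ?thesis using Mo_add by simp
qed

definition fibre :: "int \<Rightarrow> 'd mat \<Rightarrow> 'd mat set" where
  "fibre k h = {u \<in> Gam. code k (act A u - A) = code k h}"

text \<open>By Newton iteration some \<open>t\<close> carries \<open>A + h\<close> to
  \<open>A + h'\<close> up to high precision. Right translation by \<open>t\<close> maps the first
  fibre into the second, and it is injective on classes since \<open>t\<close> has an approximate
  right inverse. Exchanging \<open>h\<close> and \<open>h'\<close> gives equality.\<close>

lemma fibre_le:
  assumes h: "h \<in> Herm" "h' \<in> Herm" and k: "0 \<le> k" and m: "0 \<le> m"
  shows "card (code m ` fibre k h) \<le> card (code m ` fibre k h')"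
proof -
  \<comment> \<open>Precision enough for both purposes: \<open>HH (K + 1)\<close> has entries in
    \<open>PP k\<close>, and \<open>E (K + 1)\<close> has entries in \<open>PP m\<close>.\<close>
  define K where "K = nat (N * k + N * m + am)"
  have K: "N * k \<le> int K + 1" "N * m + am \<le> int K + 1"
    using k m N_pos am_nonneg by (auto simp: K_def)
  have hc: "h \<in> carrier_mat n n" "h' \<in> carrier_mat n n" using h HH_carrier by (auto simp: Herm_def)
  obtain t where t: "t - 1\<^sub>m n \<in> E 1" "t \<in> carrier_mat n n" "act (A + h) t - (A + h') \<in> HH (int K + 1)"
    using newton[of h h' K] h by (auto simp: Herm_def)
  have tL: "act (A + h) t - (A + h') \<in> Mo k" using HH_sub[OF K(1)] t(3) by blast
  have tM: "t \<in> Mo 0" using E_int E_decomp(2)[OF t(1,2)] by blast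
  obtain t' where t': "t' \<in> E 0" "t * t' - 1\<^sub>m n \<in> E (int K + 1)" using E_unipotent_inverse[OF t(1,2)] by blast
  have t'M: "t' \<in> Mo 0" "t * t' - 1\<^sub>m n \<in> Mo m"
    using E_int E_sub[OF K(2)] t' by blast+
  show ?thesis
  proof (rule card_image_le_kernel[where k = "\<lambda>u. u * t"])
    show "finite (code m ` fibre k h')"
      by (rule finite_code[OF _ m]) (use Gam_int in \<open>auto simp: fibre_def\<close>)
    fix u assume u: "u \<in> fibre k h"
    have uG: "u \<in> Gam" and uc: "u \<in> carrier_mat n n" using u Gam_carrier by (auto simp: fibre_def)
    have ac: "act A u \<in> carrier_mat n n" using uc by simp
    define l where "l = act A u - A - h"
    have lM: "l \<in> Mo k"
      using u hc ac code_eq_iff[of "act A u - A" h k] by (simp add: fibre_def l_def minus_carrier_mat)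
    have lc: "l \<in> carrier_mat n n" using lM Mo_carrier by blast
    have "act A u = (A + h) + l" unfolding l_def using ac hc by (intro eq_matI) auto
    then have e: "act A (u * t) = act (A + h) t + act l t"
      using act_mult[OF A_carrier(1) uc t(2)] act_add[of "A + h" n l t] hc lc t(2) by simp
    have c: "act (A + h) t \<in> carrier_mat n n" "act l t \<in> carrier_mat n n" using hc lc t(2) by auto
    have "act A (u * t) - A - h' = (act (A + h) t - (A + h')) + act l t"
      unfolding e using c hc by (intro eq_matI) auto
    also have "\<dots> \<in> Mo k" by (rule Mo_add[OF tL Mo_act[OF lM tM]])
    finally have "code k (act A (u * t) - A) = code k h'"
      using hc by (subst code_eq_iff) (auto intro!: minus_carrier_mat)
    then show "u * t \<in> fibre k h'" using Gam_mult[OF uG t(1,2)] by (simp add: fibre_def)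
  next
    fix u u' assume "u \<in> fibre k h" "u' \<in> fibre k h"
    then have u: "u \<in> Mo 0" "u' \<in> Mo 0"
      using Gam_int by (auto simp: fibre_def)
    have uc: "u \<in> carrier_mat n n" "u' \<in> carrier_mat n n" using u Mo_carrier by auto
    define z where "z = u - u'"
    have zM: "z \<in> Mo 0" unfolding z_def by (rule Mo_diff[OF u])
    have zc: "z \<in> carrier_mat n n" using zM Mo_carrier by blast
    have zt: "u * t - u' * t = z * t"
      unfolding z_def using uc t(2) by (simp add: minus_mult_distrib_mat[of _ n n _ _ n])
    have t'c: "t' \<in> carrier_mat n n" using t' E_carrier by blast
    have "z * t \<in> Mo m \<longleftrightarrow> z \<in> Mo m"
    proof
      assume "z * t \<in> Mo m"
      from Mo_mult[OF this t'M(1)] have 1: "z * t * t' \<in> Mo m" by simp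
      have 2: "z * (t * t' - 1\<^sub>m n) \<in> Mo m" using Mo_mult[OF zM t'M(2)] by simp
      have "z = z * t * t' - z * (t * t' - 1\<^sub>m n)"
        using zc t(2) t'c mult_carrier_square[OF zc mult_carrier_square[OF t(2) t'c]]
        by (simp add: mult_minus_distrib_mat[of _ n n _ n] assoc_mult_mat[of _ n n _ n _ n])
          (auto intro!: eq_matI simp del: index_mult_mat(1))
      then show "z \<in> Mo m" using Mo_diff[OF 1 2] by simp
    next
      assume "z \<in> Mo m"
      from Mo_mult[OF this tM] show "z * t \<in> Mo m" by simp
    qed
    then show "code m (u * t) = code m (u' * t) \<longleftrightarrow> code m u = code m u'"
      using uc t(2) by (simp add: code_eq_iff zt z_def[symmetric])
  qed
qed

text \<open>At this precision a solution lies in \<open>E 0\<close> and its error lies in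
  \<open>HH 1\<close>, so no solution is lost by restricting to \<open>Gam\<close>.\<close>

lemma fibre_zero: assumes "2 * am + 1 \<le> k" shows "fibre k (0\<^sub>m n n) = Sol k"
proof (intro subset_antisym subsetI)
  fix u assume u: "u \<in> fibre k (0\<^sub>m n n)"
  have ac: "act A u - A \<in> carrier_mat n n" by (rule minus_carrier_mat) simp
  have "act A u - A - 0\<^sub>m n n = act A u - A" using ac by (intro eq_matI) auto
  then show "u \<in> Sol k" using u Gam_int code_eq_iff[OF ac, of "0\<^sub>m n n" k] by (auto simp: fibre_def Sol_def)
next
  fix u assume u: "u \<in> Sol k"
  have ac: "act A u - A \<in> carrier_mat n n" by (rule minus_carrier_mat) simp
  have z: "act A u - A - 0\<^sub>m n n = act A u - A" using ac by (intro eq_matI) auto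
  have "u \<in> E 0" using solution_in_E[of u "nat k"] u assms am_nonneg by (simp add: Sol_def)
  moreover have "act A u - A \<in> HH 1" using sub_HH1[of k] assms am_nonneg u by (auto simp: Sol_def)
  ultimately show "u \<in> fibre k (0\<^sub>m n n)"
    using u z code_eq_iff[OF ac, of "0\<^sub>m n n" k] by (simp add: fibre_def Gam_def Sol_def)
qed

lemma card_Gam:
  assumes k: "2 * am + 1 \<le> k" "k \<le> m"
  shows "card (code m ` Gam) = card (code k ` Herm) * card (code m ` Sol k)"
proof -
  have k0: "0 \<le> k" "0 \<le> m" using k am_nonneg by auto
  have zH: "0\<^sub>m n n \<in> Herm"
    using bd_zero by (auto simp: Herm_def HH_def intro!: eq_matI)
  have ac: "act A u - A \<in> carrier_mat n n" for u by (rule minus_carrier_mat) simp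
  have gH: "act A u - A \<in> Herm" if "u \<in> Gam" for u
  proof -
    have "adjoint (act A u - A) = act A u - A"
      using Gam_carrier[OF that] adjoint_act[of A n u] by (simp add: adjoint_diff[of _ n n] adjoint_A)
    then show ?thesis using that by (simp add: Herm_def Gam_def)
  qed
  have img: "(\<lambda>u. code k (act A u - A)) ` Gam = code k ` Herm"
  proof (intro subset_antisym subsetI)
    fix y assume "y \<in> code k ` Herm"
    then obtain h where h: "h \<in> Herm" "y = code k h" by blast
    \<comment> \<open>The fibre over 0 contains the identity. Since all fibres have equally many
      classes, none is empty, and every class of \<open>Herm\<close> is attained.\<close>
    have "card (code m ` fibre k (0\<^sub>m n n)) \<noteq> 0"
    proof -
      have "act A (1\<^sub>m n) - A = 0\<^sub>m n n" by (intro eq_matI) (auto simp: act_one)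
      then have "1\<^sub>m n \<in> fibre k (0\<^sub>m n n)" using Gam_one by (simp add: fibre_def)
      moreover have "finite (code m ` fibre k (0\<^sub>m n n))"
        by (rule finite_code[OF _ k0(2)]) (use Gam_int in \<open>auto simp: fibre_def\<close>)
      ultimately show ?thesis by auto
    qed
    then have "card (code m ` fibre k h) \<noteq> 0" using fibre_le[OF zH h(1) k0] by simp
    then have "fibre k h \<noteq> {}" by auto
    then show "y \<in> (\<lambda>u. code k (act A u - A)) ` Gam" by (force simp: fibre_def h(2))
  qed (use gH in blast)
  have "card (code m ` Gam) =
      (\<Sum>y\<in>(\<lambda>u. code k (act A u - A)) ` Gam. card (code m ` {u \<in> Gam. code k (act A u - A) = y}))"
  proof (rule card_fibres)
    show "finite (code m ` Gam)" by (rule finite_code[OF Gam_int k0(2)])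
    fix u u' assume u: "u \<in> Gam" "u' \<in> Gam" and e: "code m u = code m u'"
    have uM: "u \<in> Mo 0" "u' \<in> Mo 0" using u Gam_int by auto
    have "u - u' \<in> Mo m"
      using e code_eq_iff[OF Gam_carrier[OF u(1)] Gam_carrier[OF u(2)]] by simp
    then have "act A u - act A u' \<in> Mo k"
      using act_diff_PP[OF uM] Mo_mono[OF k(2)] by blast
    moreover have "(act A u - A) - (act A u' - A) = act A u - act A u'"
      using act_carrier_square[OF A_carrier(1) Gam_carrier[OF u(1)]]
        act_carrier_square[OF A_carrier(1) Gam_carrier[OF u(2)]] by (intro eq_matI) auto
    ultimately show "code k (act A u - A) = code k (act A u' - A)"
      by (simp add: code_eq_iff[OF ac ac])
  qed
  also have "\<dots> = (\<Sum>y\<in>code k ` Herm. card (code m ` Sol k))"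
    unfolding img
  proof (rule sum.cong[OF refl])
    fix y assume "y \<in> code k ` Herm"
    then obtain h where h: "h \<in> Herm" "y = code k h" by blast
    have "card (code m ` fibre k h) = card (code m ` fibre k (0\<^sub>m n n))"
      by (intro antisym fibre_le h(1) zH k0)
    then show "card (code m ` {u \<in> Gam. code k (act A u - A) = y}) = card (code m ` Sol k)"
      by (simp add: fibre_def[symmetric] h(2) fibre_zero[OF k(1)])
  qed
  finally show ?thesis by simp
qed

text \<open>The hypothesis excludes truncation in \<open>2 * l - 1\<close>. Equivalence classes and
  codes are images of the same set with the same kernel.\<close>

lemma N_sol_eq: assumes "1 \<le> l"
  shows "N_sol n n l A A = card (code (2 * int l) ` Sol (2 * int l - 1))"
proof -
  let ?S = "Sol (2 * int l - 1)" and ?M = "(Mo (2 * int l))"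
  let ?r = "{(u, w). u \<in> matrices_over n n \<O> \<and> w \<in> matrices_over n n \<O> \<and>
                u - w \<in> matrices_over n n (ideal_power \<O> \<P> (2*l))}"
  have i: "int (2 * l - 1) = 2 * int l - 1" "int (2 * l) = 2 * int l" using assms by auto
  have "N_sol n n l A A = card (?S // ?r)"
    by (simp only: N_sol_def Sol_def ideal_power_eq i O_eq[symmetric])
  also have "?S // ?r = (\<lambda>u. ?r `` {u}) ` ?S" by (auto simp: quotient_def)
  also have "card \<dots> = card (code (2 * int l) ` ?S)"
  proof (rule card_image_eq_kernel(1))
    fix x y assume "x \<in> ?S" "y \<in> ?S"
    then have xy: "x \<in> Mo 0" "y \<in> Mo 0" by (auto simp: Sol_def)
    have c: "x \<in> carrier_mat n n" "y \<in> carrier_mat n n" using xy Mo_carrier by auto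
    have r: "?r `` {u} = {w \<in> Mo 0. u - w \<in> ?M}" if "u \<in> Mo 0" for u
      using that by (auto simp: ideal_power_eq O_eq[symmetric])
    show "?r `` {x} = ?r `` {y} \<longleftrightarrow> code (2 * int l) x = code (2 * int l) y"
    proof
      assume "?r `` {x} = ?r `` {y}"
      moreover have "y - y = 0\<^sub>m n n" using c by (intro eq_matI) auto
      then have "y \<in> ?r `` {y}"
        unfolding r[OF xy(2)] using xy(2) bd_zero[of "\<lambda>_ _. N * (2 * int l)"]
        by (simp add: matrices_over_PP[of "2 * int l"])
      ultimately have "x - y \<in> ?M" using r[OF xy(1)] by blast
      then show "code (2 * int l) x = code (2 * int l) y" by (simp add: code_eq_iff c)
    next
      assume e: "code (2 * int l) x = code (2 * int l) y"
      have "x - z \<in> ?M \<longleftrightarrow> y - z \<in> ?M" if "z \<in> Mo 0" for z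
        using code_eq_iff[OF c(1) Mo_carrier[OF that]] code_eq_iff[OF c(2) Mo_carrier[OF that]] e by metis
      then show "?r `` {x} = ?r `` {y}" unfolding r[OF xy(1)] r[OF xy(2)] by blast
    qed
  qed
  finally show ?thesis .
qed

end

context padic_quaternion
begin

text \<open>Representatives of the residue field with \<open>q\<^sup>2\<close> elements.\<close>

definition T :: "'d set" where "T = rep (PP 1) ` PP 0"

lemma finite_T: "finite T" and card_T: "card T = residue_card v ^ 2"
  using ncl_PP_0 by (simp_all add: T_def ncl_def)

lemma T_PP: "x \<in> T \<Longrightarrow> x \<in> PP 0"
  using rep_diff[OF subgrp_PP[of 1]] subgrp_diff_right[OF subgrp_PP[of 0]] PP_mono[of 0 1]
  by (auto simp: T_def)

lemma T_rep: "x \<in> T \<Longrightarrow> rep (PP 1) x = x"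
  by (auto simp: T_def rep_rep subgrp_PP)

end

context monomial_form
begin

section \<open>The set \<open>Gam\<close> described by residue conditions on the diagonal
  blocks\<close>

lemma BB_eq_PP: "N * (k - 1) < r \<Longrightarrow> r \<le> N * k \<Longrightarrow> BB r = PP k"
  using BB_sub_PP PP_sub_BB by blast

text \<open>With \<open>d = a j - a i\<close>, the bound in whole steps is \<open>d - d / N\<close>
  for \<open>d \<ge> 0\<close> and \<open>d / N\<close> for \<open>d < 0\<close>; as
  \<open>\<bar>d\<bar> < N\<close>, it rounds up to \<open>max 0 d\<close>.\<close>

lemma BB_E:
  assumes "i < n" "j < n"
  shows "BB (0 + max ((N - 1) * (int (a j) - int (a i))) (int (a j) - int (a i)))
    = PP (max 0 (int (a j) - int (a i)))"
proof -
  define d where "d = int (a j) - int (a i)"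
  have d: "- am \<le> d" "d \<le> am" using am_ge[OF assms(1)] am_ge[OF assms(2)] by (auto simp: d_def)
  define y where "y = am * d"
  have e: "(N - 1) * d = y + d" "N * (d - 1) = y + 2 * d - N" "N * d = y + 2 * d"
    by (simp_all add: y_def N_def algebra_simps)
  have "BB (0 + max ((N - 1) * d) d) = PP (max 0 d)"
  proof (cases "0 \<le> d")
    case True
    then have "0 \<le> y" using am_nonneg by (simp add: y_def)
    then have "max ((N - 1) * d) d = y + d" "max 0 d = d" using True e(1) by auto
    then show ?thesis using d True e N_pos by (simp only: add_0) (rule BB_eq_PP; simp add: N_def)
  next
    case False
    then have "y \<le> 0" unfolding y_def using am_nonneg by (intro mult_nonneg_nonpos) auto
    then have "max ((N - 1) * d) d = d" "max 0 d = 0" using False e(1) by auto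
    then show ?thesis using d False by (simp only: add_0) (rule BB_eq_PP; simp add: N_def)
  qed
  then show ?thesis by (simp add: d_def)
qed

lemma E0_iff:
  "u \<in> E 0 \<longleftrightarrow> u \<in> carrier_mat n n \<and>
    (\<forall>i<n. \<forall>j<n. u $$ (i, j) \<in> PP (max 0 (int (a j) - int (a i))))"
  unfolding E_def bd_def using BB_E by auto

definition e_herm :: "nat \<Rightarrow> nat \<Rightarrow> int" where
  "e_herm i j = max (int (a i)) (int (a j)) + (if a i = a j then 1 else 0)"

text \<open>Away from the diagonal blocks the shift by \<open>1 / N\<close> is absorbed by the
  rounding, so \<open>HH 0\<close> and \<open>HH 1\<close> coincide there. That is why membership in
  \<open>Gam\<close> has to be tested on the blocks only.\<close>

lemma BB_HH:
  assumes "i < n" "j < n"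
  shows "BB (1 + max ((N - 1) * int (a j) + int (a i)) (int (a j) + (N - 1) * int (a i))) = PP (e_herm i j)"
    and "a i \<noteq> a j \<Longrightarrow> BB (0 + max ((N - 1) * int (a j) + int (a i)) (int (a j) + (N - 1) * int (a i)))
      = PP (e_herm i j)"
proof -
  have e: "(N - 1) * int (a k) = N * int (a k) - int (a k)" for k by (simp add: algebra_simps)
  have b: "int (a i) \<le> am" "int (a j) \<le> am" using am_ge assms by auto
  have m: "am * (x - y) = N * x - N * y - 2 * x + 2 * y" for x y by (simp add: N_def algebra_simps)
  consider "a i = a j" | "a i < a j" | "a j < a i" by linarith
  then have "BB (1 + max ((N - 1) * int (a j) + int (a i)) (int (a j) + (N - 1) * int (a i))) = PP (e_herm i j)
     \<and> (a i \<noteq> a j \<longrightarrow> BB (0 + max ((N - 1) * int (a j) + int (a i)) (int (a j) + (N - 1) * int (a i)))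
      = PP (e_herm i j))"
  proof cases
    case 1
    then show ?thesis using N_pos e
      by (auto simp: e_herm_def distrib_left intro!: BB_eq_PP)
  next
    case 2
    then have "0 \<le> am * (int (a j) - int (a i))" using am_nonneg by simp
    then show ?thesis using 2 b unfolding m
      by (auto simp: e_herm_def e right_diff_distrib max_def intro!: BB_eq_PP) (auto simp: N_def)
  next
    case 3
    then have "0 \<le> am * (int (a i) - int (a j))" using am_nonneg by simp
    then show ?thesis using 3 b unfolding m
      by (auto simp: e_herm_def e right_diff_distrib max_def intro!: BB_eq_PP) (auto simp: N_def)
  qed
  then show "BB (1 + max ((N - 1) * int (a j) + int (a i)) (int (a j) + (N - 1) * int (a i))) = PP (e_herm i j)"
    "a i \<noteq> a j \<Longrightarrow> BB (0 + max ((N - 1) * int (a j) + int (a i)) (int (a j) + (N - 1) * int (a i)))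
      = PP (e_herm i j)" by auto
qed

lemma HH1_iff:
  "h \<in> HH 1 \<longleftrightarrow> h \<in> carrier_mat n n \<and> (\<forall>i<n. \<forall>j<n. h $$ (i, j) \<in> PP (e_herm i j))"
  unfolding HH_def bd_def using BB_HH(1) by auto

definition blk :: "nat \<Rightarrow> nat set" where "blk i = {c. c < n \<and> a c = a i}"

definition SB :: "(nat \<times> nat) set" where "SB = {(i, j). i < n \<and> j < n \<and> a i = a j}"

text \<open>
  The entry of \<open>A[u] - A\<close> divided by \<open>\<Theta> ^ a i\<close>, modulo \<open>\<P>\<close>. For odd \<open>a i\<close> moving \<open>\<Theta> ^ a i\<close> past \<open>star x\<close>
  replaces it by \<open>x\<close>, which makes the form alternating.
\<close>

definition cond_entry :: "(nat \<times> nat \<Rightarrow> 'd) \<Rightarrow> nat \<Rightarrow> nat \<Rightarrow> 'd" where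
  "cond_entry g i j =
    (if even (a i) then (\<Sum>c\<in>blk i. star (g (c, i)) * g (c, j)) - (if i = j then 1 else 0)
     else (\<Sum>c\<in>blk i. g (c, i) * s c * g (p c, j)) - (if j = p i then s i else 0))"

definition rescond :: "(nat \<times> nat \<Rightarrow> 'd) \<Rightarrow> bool" where
  "rescond g \<longleftrightarrow> (\<forall>(i, j)\<in>SB. cond_entry g i j \<in> PP 1)"

lemma s_PP: "i < n \<Longrightarrow> s i \<in> PP 0"
  by (simp add: PP_iff w_s)

lemma blk_p: "c \<in> blk i \<Longrightarrow> p c \<in> blk i"
  by (auto simp: blk_def p_less a_p)

lemma cond_entry_cong:
  assumes g: "\<And>x. x \<in> SB \<Longrightarrow> g x \<in> PP 0" "\<And>x. x \<in> SB \<Longrightarrow> g' x \<in> PP 0"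
    and d: "\<And>x. x \<in> SB \<Longrightarrow> g x - g' x \<in> PP 1" and ij: "(i, j) \<in> SB"
  shows "cond_entry g i j \<in> PP 1 \<longleftrightarrow> cond_entry g' i j \<in> PP 1"
proof -
  have SBc: "(c, i) \<in> SB" "(c, j) \<in> SB" "(p c, j) \<in> SB" if "c \<in> blk i" for c
    using that ij blk_p[OF that] by (auto simp: SB_def blk_def)
  have 1: "star (g (c, i)) * g (c, j) - star (g' (c, i)) * g' (c, j) \<in> PP 1" if "c \<in> blk i" for c
    by (rule PP_cong_mult) (use g d SBc[OF that] in \<open>auto simp: PP_star simp flip: star_diff\<close>)
  have 2: "g (c, i) * s c * g (p c, j) - g' (c, i) * s c * g' (p c, j) \<in> PP 1" if "c \<in> blk i" for c
  proof (rule PP_cong_mult)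
    have sc: "s c \<in> PP 0" using that by (auto simp: blk_def intro: s_PP)
    show "g (c, i) * s c - g' (c, i) * s c \<in> PP 1"
      using PP_mult[OF d[OF SBc(1)[OF that]] sc] by (simp add: left_diff_distrib)
    show "g (c, i) * s c \<in> PP 0" using PP_mult[OF g(1)[OF SBc(1)[OF that]] sc] by simp
  qed (use g d SBc[OF that] in auto)
  have "cond_entry g i j - cond_entry g' i j \<in> PP 1"
    unfolding cond_entry_def using 1 2
    by (auto simp: PP_sum simp flip: sum_subtractf)
  then show ?thesis using subgrp_diff_right[OF subgrp_PP] by blast
qed

lemma rescond_cong:
  assumes "\<And>x. x \<in> SB \<Longrightarrow> g x \<in> PP 0" "\<And>x. x \<in> SB \<Longrightarrow> g' x \<in> PP 0"
    and "\<And>x. x \<in> SB \<Longrightarrow> g x - g' x \<in> PP 1"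
  shows "rescond g \<longleftrightarrow> rescond g'"
proof -
  have "cond_entry g i j \<in> PP 1 \<longleftrightarrow> cond_entry g' i j \<in> PP 1" if "(i, j) \<in> SB" for i j
    using assms that by (rule cond_entry_cong)
  then show ?thesis unfolding rescond_def by auto
qed

lemma mat_mult_index:
  assumes "x \<in> carrier_mat n n" "y \<in> carrier_mat n n" "i < n" "j < n"
  shows "(x * y) $$ (i, j) = (\<Sum>c\<in>{0..<n}. x $$ (i, c) * y $$ (c, j :: nat))"
  using assms by (auto simp: scalar_prod_def intro!: sum.cong)

lemma act_entry:
  assumes "u \<in> carrier_mat n n" "i < n" "j < n"
  shows "act A u $$ (i, j) = (\<Sum>c<n. star (u $$ (c, i)) * (s c * \<Theta> ^ a c * u $$ (p c, j)))"
proof -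
  have c: "adjoint u \<in> carrier_mat n n" "A * u \<in> carrier_mat n n" using assms(1) by auto
  have "act A u = adjoint u * (A * u)"
    using assms(1) c unfolding act_def by (simp add: assoc_mult_mat[of _ n n _ n _ n])
  then have "act A u $$ (i, j) = (\<Sum>c\<in>{0..<n}. adjoint u $$ (i, c) * (A * u) $$ (c, j))"
    using mat_mult_index[OF c assms(2,3)] by simp
  also have "\<dots> = (\<Sum>c<n. star (u $$ (c, i)) * (s c * \<Theta> ^ a c * u $$ (p c, j)))"
    using assms by (intro sum.cong) (auto simp: A_mult_index simp del: index_mult_mat(1))
  finally show ?thesis .
qed

lemma Theta_power_even: "\<Theta> ^ (2 * k) = emb (\<pi> ^ k)"
  by (induction k) (simp_all add: Theta_sq emb_mult mult.assoc[symmetric])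

lemma w_Theta_power: "w (\<Theta> ^ k) = int k"
  by (simp add: w_power w_Theta)

text \<open>An odd power of \<Theta> is a central power of \<pi> times \<Theta>, which reduces the
  claim to \<open>star_Theta_cong\<close>.\<close>

lemma star_Theta_power_cong:
  assumes "x \<in> PP 0" "odd k"
  shows "star x * \<Theta> ^ k - \<Theta> ^ k * x \<in> PP (int k + 1)"
proof -
  obtain m where k: "k = 2 * m + 1" using assms(2) by (elim oddE)
  have t: "\<Theta> ^ k = emb (\<pi> ^ m) * \<Theta>" unfolding k by (simp add: Theta_power_even emb_commute[of \<Theta>])
  have "star x * \<Theta> ^ k - \<Theta> ^ k * x = emb (\<pi> ^ m) * (star x * \<Theta> - \<Theta> * x)"
    by (simp add: t right_diff_distrib emb_left_commute mult.assoc)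
  moreover have "w (emb (\<pi> ^ m)) = 2 * int m" using prime_element by (simp add: w_emb v_power)
  ultimately show ?thesis using star_Theta_cong[OF assms(1)] prime_element
    by (simp add: PP_mult_left_iff k)
qed

lemma block_entry:
  assumes u: "u \<in> E 0" and ij: "(i, j) \<in> SB"
  shows "(act A u - A) $$ (i, j) \<in> PP (int (a i) + 1) \<longleftrightarrow> cond_entry (\<lambda>x. u $$ x) i j \<in> PP 1"
proof -
  let ?g = "a i"
  have i: "i < n" "j < n" "a j = a i" using ij by (auto simp: SB_def)
  have uc: "u \<in> carrier_mat n n" using u E_carrier by blast
  have ue: "u $$ (c, d) \<in> PP (max 0 (int (a d) - int (a c)))" if "c < n" "d < n" for c d
    using u that unfolding E0_iff by blast
  have u0: "u $$ (c, d) \<in> PP 0" if "c < n" "d < n" for c d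
    using ue[OF that] PP_mono[of 0 "max 0 (int (a d) - int (a c))"] by auto
  let ?t = "\<lambda>c. star (u $$ (c, i)) * (s c * \<Theta> ^ a c * u $$ (p c, j))"
  \<comment> \<open>A term with \<open>c\<close> outside the block has valuation at least
    \<open>2 * max 0 (a i - a c) + a c\<close>. This exceeds \<open>a i\<close> both for
    \<open>a c > a i\<close> and for \<open>a c < a i\<close>.\<close>
  have far: "?t c \<in> PP (int ?g + 1)" if "c \<in> {..<n} - blk i" for c
  proof -
    have c: "c < n" "a c \<noteq> a i" using that by (auto simp: blk_def)
    let ?d = "max 0 (int (a i) - int (a c))"
    have "s c * \<Theta> ^ a c \<in> PP (int (a c))" using c by (simp add: PP_iff A_entry_w)
    moreover have "u $$ (p c, j) \<in> PP ?d" using ue[of "p c" j] c i p_less by (simp add: a_p)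
    ultimately have "?t c \<in> PP (?d + (int (a c) + ?d))"
      using ue[OF c(1) i(1)] by (intro PP_mult) (auto simp: PP_star)
    moreover have "int ?g + 1 \<le> ?d + (int (a c) + ?d)" using c(2) by (auto simp: max_def)
    ultimately show ?thesis using PP_mono by blast
  qed
  have "blk i \<subseteq> {..<n}" by (auto simp: blk_def)
  then have split: "(\<Sum>c<n. ?t c) = (\<Sum>c\<in>{..<n} - blk i. ?t c) + (\<Sum>c\<in>blk i. ?t c)"
    by (intro sum.subset_diff) auto
  have e: "(act A u - A) $$ (i, j) = (\<Sum>c<n. ?t c) - A $$ (i, j)"
    using uc i act_entry[OF uc i(1,2)] by simp
  have "(act A u - A) $$ (i, j) - ((\<Sum>c\<in>blk i. ?t c) - A $$ (i, j)) = (\<Sum>c\<in>{..<n} - blk i. ?t c)"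
    unfolding e split by simp
  also have "\<dots> \<in> PP (int ?g + 1)" by (rule PP_sum[OF far])
  finally have 1: "(act A u - A) $$ (i, j) \<in> PP (int ?g + 1) \<longleftrightarrow>
      (\<Sum>c\<in>blk i. ?t c) - A $$ (i, j) \<in> PP (int ?g + 1)"
    using subgrp_diff_right[OF subgrp_PP] by blast
  have Th: "\<Theta> ^ ?g * x \<in> PP (int ?g + 1) \<longleftrightarrow> x \<in> PP 1" for x
    by (simp add: PP_mult_left_iff w_Theta_power)
  show ?thesis
  proof (cases "even ?g")
    case True
    then obtain m where m: "?g = 2 * m" by (elim evenE)
    have t: "?t c = \<Theta> ^ ?g * (star (u $$ (c, i)) * u $$ (c, j))" if "c \<in> blk i" for c
    proof -
      have c: "c < n" "a c = a i" using that by (auto simp: blk_def)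
      have "p c = c" "s c = 1" using p_even[OF c(1)] c True by auto
      then show ?thesis unfolding c(2) m Theta_power_even by (simp add: emb_left_commute)
    qed
    have "A $$ (i, j) = \<Theta> ^ ?g * (if i = j then 1 else 0)"
      using i p_even[OF i(1) True] by (auto simp: A_def)
    then have "(\<Sum>c\<in>blk i. ?t c) - A $$ (i, j) = \<Theta> ^ ?g * cond_entry (\<lambda>x. u $$ x) i j"
      using True t by (simp add: cond_entry_def right_diff_distrib sum_distrib_left)
    then show ?thesis using 1 Th by simp
  next
    case False
    have t: "?t c - \<Theta> ^ ?g * (u $$ (c, i) * s c * u $$ (p c, j)) \<in> PP (int ?g + 1)"
      if "c \<in> blk i" for c
    proof -
      have c: "c < n" "a c = a i" using that by (auto simp: blk_def)
      have sc: "x * s c = s c * x" for x using s_unit[OF c(1)] by auto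
      have "?t c - \<Theta> ^ ?g * (u $$ (c, i) * s c * u $$ (p c, j)) =
          (star (u $$ (c, i)) * \<Theta> ^ ?g - \<Theta> ^ ?g * u $$ (c, i)) * (s c * u $$ (p c, j))"
        unfolding c(2) by (simp add: left_diff_distrib mult.assoc) (simp add: sc mult.assoc[symmetric])
      moreover have "s c * u $$ (p c, j) \<in> PP 0"
        using PP_mult[OF s_PP[OF c(1)] u0[OF p_less[OF c(1)] i(2)]] by simp
      ultimately show ?thesis
        using PP_mult[OF star_Theta_power_cong[OF u0[OF c(1) i(1)] False]] by fastforce
    qed
    have Aij: "A $$ (i, j) = \<Theta> ^ ?g * (if j = p i then s i else 0)"
      using i s_unit[OF i(1)] by (auto simp: A_def)
    have "((\<Sum>c\<in>blk i. ?t c) - A $$ (i, j)) - \<Theta> ^ ?g * cond_entry (\<lambda>x. u $$ x) i j =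
        (\<Sum>c\<in>blk i. ?t c - \<Theta> ^ ?g * (u $$ (c, i) * s c * u $$ (p c, j)))"
      using False by (simp add: cond_entry_def Aij right_diff_distrib sum_distrib_left sum_subtractf)
    also have "\<dots> \<in> PP (int ?g + 1)" by (rule PP_sum[OF t])
    finally have "(\<Sum>c\<in>blk i. ?t c) - A $$ (i, j) \<in> PP (int ?g + 1) \<longleftrightarrow>
        \<Theta> ^ ?g * cond_entry (\<lambda>x. u $$ x) i j \<in> PP (int ?g + 1)"
      using subgrp_diff_right[OF subgrp_PP] by blast
    then show ?thesis using 1 Th by simp
  qed
qed

lemma Gam_iff: assumes u: "u \<in> E 0" shows "u \<in> Gam \<longleftrightarrow> rescond (\<lambda>x. u $$ x)"
proof -
  have uc: "u \<in> carrier_mat n n" using u E_carrier by blast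
  have dc: "act A u - A \<in> carrier_mat n n" by (rule minus_carrier_mat) simp
  have "act A u \<in> HH 0"
  proof -
    have "A * u \<in> HH 0" using HH_E_mult[OF A_HH u] by simp
    from E_HH_mult[OF u this] show ?thesis
      using uc unfolding act_def by (simp add: assoc_mult_mat[of _ n n _ n _ n])
  qed
  then have d0: "act A u - A \<in> HH 0" using A_HH bd_diff unfolding HH_def by blast
  have off: "(act A u - A) $$ (i, j) \<in> PP (e_herm i j)" if "i < n" "j < n" "a i \<noteq> a j" for i j
  proof -
    have "(act A u - A) $$ (i, j) \<in>
        BB (0 + max ((N - 1) * int (a j) + int (a i)) (int (a j) + (N - 1) * int (a i)))"
      using d0 that unfolding HH_def bd_def by blast
    then show ?thesis by (simp only: BB_HH(2)[OF that])
  qed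
  have "u \<in> Gam \<longleftrightarrow> (\<forall>i<n. \<forall>j<n. (act A u - A) $$ (i, j) \<in> PP (e_herm i j))"
    using u dc by (simp add: Gam_def HH1_iff del: index_minus_mat)
  also have "\<dots> \<longleftrightarrow> (\<forall>(i, j)\<in>SB. (act A u - A) $$ (i, j) \<in> PP (int (a i) + 1))"
    using off by (auto simp: SB_def e_herm_def simp del: index_minus_mat)
  also have "\<dots> \<longleftrightarrow> rescond (\<lambda>x. u $$ x)"
    unfolding rescond_def using block_entry[OF u] by blast
  finally show ?thesis .
qed

section \<open>The number of classes in \<open>Gam\<close> and in \<open>Herm\<close>\<close>

definition G0 :: "(nat \<times> nat \<Rightarrow> 'd) set" where
  "G0 = {g \<in> SB \<rightarrow>\<^sub>E T. rescond g}"

text \<open>Once the residues on the diagonal blocks are fixed, the entry at \<open>x\<close> ranges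
  over a coset of \<open>PP (off_val x)\<close>: a residue class inside a block, the lattice of
  \<open>E 0\<close> outside.\<close>

definition off_val :: "nat \<times> nat \<Rightarrow> int" where
  "off_val x = (if x \<in> SB then 1 else max 0 (int (a (snd x)) - int (a (fst x))))"

text \<open>The set \<open>Gam\<close> is partitioned by the residues of its block entries. These
  range over \<open>G0\<close>, and with fixed residues the entries are independent of each other,
  so each part is a box.\<close>

lemma card_code_Gam:
  assumes m: "am + 1 \<le> m"
  shows "card (code m ` Gam) =
    card G0 * (\<Prod>x\<in>{..<n} \<times> {..<n}. residue_card v ^ (2 * nat (m - off_val x)))"
proof -
  let ?I = "{..<n} \<times> {..<n}"
  define res where "res u = (\<lambda>x\<in>SB. rep (PP 1) (u $$ x))" for u :: "'d mat"
  have SBI: "x \<in> SB \<Longrightarrow> x \<in> ?I" for x by (auto simp: SB_def)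
  have u0: "u $$ x \<in> PP 0" if "u \<in> Gam" "x \<in> SB" for u x
    using that(1) Gam_int SBI[OF that(2)] by (cases x) (auto simp: matrices_over_def)
  have cod: "code k u = (\<lambda>x\<in>?I. rep (PP k) (u $$ x))" for k u
    unfolding code_def by (rule restrict_ext) auto
  have resG: "res u \<in> G0" if "u \<in> Gam" for u
  proof -
    have E: "u \<in> E 0" using that by (simp add: Gam_def)
    have "rescond (\<lambda>x. u $$ x) \<longleftrightarrow> rescond (res u)"
    proof (rule rescond_cong)
      fix x assume x: "x \<in> SB"
      have r: "res u x = rep (PP 1) (u $$ x)" using x by (simp add: res_def)
      show "u $$ x \<in> PP 0" by (rule u0[OF that x])
      show "res u x \<in> PP 0" unfolding r by (rule T_PP) (use u0[OF that x] in \<open>auto simp: T_def\<close>)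
      show "u $$ x - res u x \<in> PP 1"
        unfolding r using rep_diff[OF subgrp_PP] subgrp_diff_commute[OF subgrp_PP] by blast
    qed
    then show ?thesis using Gam_iff[OF E] that u0[OF that] by (auto simp: G0_def res_def T_def)
  qed
  define S where "S g x = (if x \<in> SB then (+) (g x) ` PP 1 else PP (off_val x))"
    for g :: "nat \<times> nat \<Rightarrow> 'd" and x
  define W where "W g = {u \<in> Gam. res u = g}" for g
  have wit: "\<exists>u\<in>W g. \<forall>x\<in>?I. u $$ x = f x" if g: "g \<in> G0" and f: "f \<in> Pi\<^sub>E ?I (S g)" for g f
  proof -
    define u where "u = mat n n f"
    have uf: "u $$ x = f x" if "x \<in> ?I" for x using that by (auto simp: u_def)
    have gT: "g x \<in> T" if "x \<in> SB" for x using g that by (auto simp: G0_def)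
    have fS: "f x \<in> S g x" if "x \<in> ?I" for x using f that by blast
    have d: "u $$ x - g x \<in> PP 1" if "x \<in> SB" for x
      using fS[OF SBI[OF that]] that uf[OF SBI[OF that]] by (auto simp: S_def)
    have u0: "u $$ x \<in> PP 0" if "x \<in> SB" for x
      using subgrp_diff_right[OF subgrp_PP[of 0], of "u $$ x" "g x"] d[OF that] T_PP[OF gT[OF that]]
        PP_mono[of 0 1] by auto
    have uE: "u \<in> E 0"
      unfolding E0_iff
    proof (intro conjI allI impI)
      show "u \<in> carrier_mat n n" by (simp add: u_def)
      fix i j assume ij: "i < n" "j < n"
      show "u $$ (i, j) \<in> PP (max 0 (int (a j) - int (a i)))"
      proof (cases "(i, j) \<in> SB")
        case True then show ?thesis using u0[OF True] by (simp add: SB_def)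
      next
        case False then show ?thesis using fS[of "(i, j)"] uf[of "(i, j)"] ij by (simp add: S_def off_val_def)
      qed
    qed
    have "rescond (\<lambda>x. u $$ x) \<longleftrightarrow> rescond g"
      using u0 T_PP[OF gT] d by (intro rescond_cong)
    then have "u \<in> Gam" using Gam_iff[OF uE] g by (simp add: G0_def)
    moreover have "res u = g"
    proof (rule extensionalityI[of _ SB])
      fix x assume x: "x \<in> SB"
      have "rep (PP 1) (u $$ x) = rep (PP 1) (g x)" using d[OF x] by (simp add: rep_eq_iff subgrp_PP)
      then show "res u x = g x" using x by (simp add: res_def T_rep[OF gT[OF x]])
    qed (use g in \<open>auto simp: res_def G0_def PiE_iff\<close>)
    ultimately have "u \<in> W g" by (simp add: W_def)
    then show ?thesis using uf by blast
  qed
  have WS: "u $$ x \<in> S g x" if u: "u \<in> W g" and x: "x \<in> ?I" for u g x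
  proof (cases "x \<in> SB")
    case True
    have "g x = rep (PP 1) (u $$ x)" using u True by (auto simp: W_def res_def)
    then have "u $$ x - g x \<in> PP 1"
      using rep_diff[OF subgrp_PP[of 1], of "u $$ x"]
        subgrp_diff_commute[OF subgrp_PP[of 1], of "rep (PP 1) (u $$ x)" "u $$ x"] by simp
    then show ?thesis using True by (auto simp: S_def intro!: image_eqI[of _ _ "u $$ x - g x"])
  next
    case False
    have "u \<in> E 0" using u by (simp add: W_def Gam_def)
    then show ?thesis using False x by (auto simp: S_def E0_iff off_val_def)
  qed
  have off: "0 \<le> off_val x" "off_val x \<le> m" if "x \<in> ?I" for x
    using that m am_ge[of "snd x"] am_nonneg by (auto simp: off_val_def)
  \<comment> \<open>Inside a block \<open>S g x\<close> is a translate of \<open>PP 1\<close>, and a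
    translation preserves the number of classes.\<close>
  have cS: "card (rep (PP m) ` S g x) = residue_card v ^ (2 * nat (m - off_val x))" if x: "x \<in> ?I" for g x
  proof -
    have "ncl (PP m) (S g x) = ncl (PP m) (PP (off_val x))"
      by (cases "x \<in> SB") (auto simp: S_def off_val_def intro!: ncl_transport(1) subgrp_PP)
    then show ?thesis using ncl_PP(1)[OF off[OF x]] by (simp add: ncl_def)
  qed
  have cW: "card (code m ` W g) = (\<Prod>x\<in>?I. residue_card v ^ (2 * nat (m - off_val x)))"
    if g: "g \<in> G0" for g
  proof -
    have "card (code m ` W g) = (\<Prod>x\<in>?I. card (rep (PP m) ` S g x))"
      unfolding cod by (rule card_box[where val = "\<lambda>u x. u $$ x"]) (use WS wit[OF g] in auto)
    then show ?thesis using cS by simp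
  qed
  have img: "res ` Gam = G0"
  proof (intro subset_antisym subsetI)
    fix g assume g: "g \<in> G0"
    have "\<exists>f. f \<in> Pi\<^sub>E ?I (S g)"
      by (rule exI[of _ "\<lambda>x\<in>?I. if x \<in> SB then g x else 0"])
        (auto simp: S_def intro!: image_eqI[of _ _ 0])
    then show "g \<in> res ` Gam" using wit[OF g] by (fastforce simp: W_def)
  qed (use resG in blast)
  have "card (code m ` Gam) = (\<Sum>g\<in>res ` Gam. card (code m ` W g))"
    unfolding W_def
  proof (rule card_fibres)
    show "finite (code m ` Gam)" by (rule finite_code[OF Gam_int]) (use m am_nonneg in simp)
    fix u u' assume u: "u \<in> Gam" "u' \<in> Gam" "code m u = code m u'"
    have "u - u' \<in> Mo m"
      using u code_eq_iff[OF Gam_carrier[OF u(1)] Gam_carrier[OF u(2)]] by simp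
    then have "u - u' \<in> Mo 1" using Mo_mono[of 1 m] m am_nonneg by auto
    then have e: "code 1 u = code 1 u'"
      using code_eq_iff[OF Gam_carrier[OF u(1)] Gam_carrier[OF u(2)]] by simp
    show "res u = res u'" unfolding res_def
    proof (rule restrict_ext)
      fix x assume "x \<in> SB"
      then show "rep (PP 1) (u $$ x) = rep (PP 1) (u' $$ x)"
        using fun_cong[OF e, of x] SBI by (simp add: cod)
    qed
  qed
  then show ?thesis unfolding img by (simp add: cW)
qed

text \<open>The entries on and above the diagonal determine a hermitian matrix and can be chosen
  independently. Those on the diagonal are scalars in \<open>PP (a i + 1)\<close>, whence the
  rounding \<open>(a i + 2) div 2\<close> and a single factor \<open>q\<close> for two
  steps.\<close>

lemma card_code_Herm:
  assumes k: "am + 1 \<le> k"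
  shows "card (code k ` Herm) =
    (\<Prod>(i, j)\<in>{(i, j). i \<le> j \<and> j < n}.
      if i = j then residue_card v ^ nat ((k + 1) div 2 - (int (a i) + 2) div 2)
      else residue_card v ^ (2 * nat (k - e_herm i j)))"
proof -
  let ?U = "{(i, j). i \<le> j \<and> j < n}"
  have finU: "finite ?U" by (rule finite_subset[of _ "{..<n} \<times> {..<n}"]) auto
  define S where "S x = (case x of (i, j) \<Rightarrow>
      if i = j then {y \<in> PP (int (a i) + 1). star y = y} else PP (e_herm i j))" for x
  let ?c = "\<lambda>h. \<lambda>x\<in>?U. rep (PP k) (h $$ x)"
  have hc: "h \<in> carrier_mat n n" if "h \<in> Herm" for h using that HH_carrier by (auto simp: Herm_def)
  have hs: "h $$ (j, i) = star (h $$ (i, j))" if "h \<in> Herm" "i < n" "j < n" for h i j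
    using that hc[OF that(1)] adjoint_index[of j h i] by (simp add: Herm_def)
  have "card (code k ` Herm) = card (?c ` Herm)"
  proof (rule card_image_eq_kernel(1))
    fix h h' assume h: "h \<in> Herm" "h' \<in> Herm"
    have "code k h = code k h' \<longleftrightarrow> (\<forall>i<n. \<forall>j<n. h $$ (i, j) - h' $$ (i, j) \<in> PP k)"
      using hc[OF h(1)] hc[OF h(2)] by (simp add: code_eq_iff matrices_over_def minus_carrier_mat)
    also have "\<dots> \<longleftrightarrow> (\<forall>x\<in>?U. h $$ x - h' $$ x \<in> PP k)"
    proof
      assume r: "\<forall>x\<in>?U. h $$ x - h' $$ x \<in> PP k"
      show "\<forall>i<n. \<forall>j<n. h $$ (i, j) - h' $$ (i, j) \<in> PP k"
      proof (intro allI impI)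
        fix i j assume ij: "i < n" "j < n"
        show "h $$ (i, j) - h' $$ (i, j) \<in> PP k"
        proof (cases "i \<le> j")
          case False
          then have "h $$ (j, i) - h' $$ (j, i) \<in> PP k" using r ij by auto
          then show ?thesis
            using hs[OF h(1) ij(2,1)] hs[OF h(2) ij(2,1)] by (simp add: PP_star flip: star_diff)
        qed (use r ij in auto)
      qed
    qed auto
    also have "\<dots> \<longleftrightarrow> ?c h = ?c h'"
      by (auto simp: restrict_def fun_eq_iff rep_eq_iff subgrp_PP)
    finally show "code k h = code k h' \<longleftrightarrow> ?c h = ?c h'" .
  qed
  also have "\<dots> = (\<Prod>x\<in>?U. card (rep (PP k) ` S x))"
  proof (rule card_box[where val = "\<lambda>u x. u $$ x", OF finU])
    fix h x assume h: "h \<in> Herm" and x: "x \<in> ?U"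
    obtain i j where x': "x = (i, j)" "i \<le> j" "j < n" using x by auto
    have "h $$ (i, j) \<in> PP (e_herm i j)" using h x' by (auto simp: Herm_def HH1_iff)
    then show "h $$ x \<in> S x" using hs[OF h, of j j] x' by (auto simp: S_def e_herm_def)
  next
    fix f assume f: "f \<in> Pi\<^sub>E ?U S"
    define h where "h = mat n n (\<lambda>(i, j). if i \<le> j then f (i, j) else star (f (j, i)))"
    have fS: "f (i, j) \<in> S (i, j)" if "i \<le> j" "j < n" for i j using f that by (auto simp: PiE_iff)
    have fd: "f (i, i) \<in> PP (int (a i) + 1)" "star (f (i, i)) = f (i, i)" if "i < n" for i
      using fS[of i i] that by (auto simp: S_def)
    have fe: "f (i, j) \<in> PP (e_herm i j)" if "i \<le> j" "j < n" for i j
      using fS[OF that] fd[of i] that by (cases "i = j") (auto simp: S_def e_herm_def)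
    have "h \<in> HH 1" unfolding HH1_iff
    proof (intro conjI allI impI)
      fix i j assume ij: "i < n" "j < n"
      have "e_herm i j = e_herm j i" by (auto simp: e_herm_def)
      then show "h $$ (i, j) \<in> PP (e_herm i j)"
        using ij fe[of i j] fe[of j i] by (cases "i \<le> j") (auto simp: h_def PP_star)
    qed (simp add: h_def)
    moreover have "adjoint h = h"
    proof (rule eq_matI)
      fix i j assume "i < dim_row h" "j < dim_col h"
      then have "i < n" "j < n" by (auto simp: h_def)
      then show "adjoint h $$ (i, j) = h $$ (i, j)"
        using fd(2)[of i] by (cases i j rule: linorder_cases) (auto simp: h_def star_star)
    qed (simp_all add: h_def)
    ultimately have "h \<in> Herm" by (simp add: Herm_def)
    moreover have "\<forall>x\<in>?U. h $$ x = f x" by (auto simp: h_def)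
    ultimately show "\<exists>u\<in>Herm. \<forall>x\<in>?U. u $$ x = f x" by blast
  qed
  also have "\<dots> = (\<Prod>(i, j)\<in>?U.
      if i = j then residue_card v ^ nat ((k + 1) div 2 - (int (a i) + 2) div 2)
      else residue_card v ^ (2 * nat (k - e_herm i j)))"
  proof (rule prod.cong[OF refl], clarify)
    fix i j assume ij: "i \<le> j" "j < n"
    have b: "int (a i) + 1 \<le> k" "0 \<le> e_herm i j" "e_herm i j \<le> k"
      using am_ge[of i] am_ge[of j] ij k by (auto simp: e_herm_def)
    show "card (rep (PP k) ` S (i, j)) =
      (if i = j then residue_card v ^ nat ((k + 1) div 2 - (int (a i) + 2) div 2)
      else residue_card v ^ (2 * nat (k - e_herm i j)))"
      using ncl_PP(1)[OF b(2,3)] ncl_PP_fixed(1)[OF b(1)] by (auto simp: S_def ncl_def add.commute)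
  qed
  finally show ?thesis .
qed

end

section \<open>Frames over the residue field\<close>

text \<open>A tuple on \<open>insert a J\<close> is its restriction to \<open>J\<close> together
  with its value at \<open>a\<close>. Frames are counted by this extension, one vector at a
  time.\<close>

lemma card_PiE_insert:
  assumes "a \<notin> J" "finite J" "finite X"
  shows "card {f \<in> insert a J \<rightarrow>\<^sub>E X. R (restrict f J) \<and> S (restrict f J) (f a)} =
    (\<Sum>u \<in> {u \<in> J \<rightarrow>\<^sub>E X. R u}. card {x \<in> X. S u x})"
proof -
  let ?L = "{f \<in> insert a J \<rightarrow>\<^sub>E X. R (restrict f J) \<and> S (restrict f J) (f a)}"
  let ?D = "SIGMA u:{u \<in> J \<rightarrow>\<^sub>E X. R u}. {x \<in> X. S u x}"
  have r: "restrict (u(a := x)) J = u" if "u \<in> J \<rightarrow>\<^sub>E X" for u x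
    using that assms(1) by (auto simp: restrict_def fun_eq_iff PiE_iff extensional_def)
  have "bij_betw (\<lambda>f. (restrict f J, f a)) ?L ?D"
  proof (rule bij_betw_byWitness[where f' = "\<lambda>(u, x). u(a := x)"])
    show "\<forall>f\<in>?L. (case (restrict f J, f a) of (u, x) \<Rightarrow> u(a := x)) = f"
      by (auto simp: restrict_def fun_eq_iff PiE_iff extensional_def)
    show "\<forall>y\<in>?D. (restrict (case y of (u, x) \<Rightarrow> u(a := x)) J, (case y of (u, x) \<Rightarrow> u(a := x)) a) = y"
      by (auto simp: r)
    show "(\<lambda>f. (restrict f J, f a)) ` ?L \<subseteq> ?D" by auto
    show "(\<lambda>(u, x). u(a := x)) ` ?D \<subseteq> ?L"
      using r by (auto simp: PiE_iff extensional_def fun_upd_def split: if_splits)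
  qed
  then have "card ?L = card ?D" by (rule bij_betw_same_card)
  also have "\<dots> = (\<Sum>u \<in> {u \<in> J \<rightarrow>\<^sub>E X. R u}. card {x \<in> X. S u x})"
  proof (rule card_SigmaI)
    have "finite (J \<rightarrow>\<^sub>E X)" using assms by (intro finite_PiE) auto
    then show "finite {u \<in> J \<rightarrow>\<^sub>E X. R u}" by simp
  qed (use assms in auto)
  finally show ?thesis .
qed

context padic_quaternion
begin

section \<open>Vectors over the residue field and dual systems\<close>

abbreviation vec :: "nat set \<Rightarrow> (nat \<Rightarrow> 'd) set" where "vec I \<equiv> I \<rightarrow>\<^sub>E T"

lemma finite_vec: "finite I \<Longrightarrow> finite (vec I)"
  by (intro finite_PiE) (auto simp: finite_T)

lemma card_vec: "finite I \<Longrightarrow> card (vec I) = residue_card v ^ (2 * card I)"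
  by (simp add: card_PiE card_T power_mult)

lemma vec_PP: "x \<in> vec I \<Longrightarrow> c \<in> I \<Longrightarrow> x c \<in> PP 0"
  by (auto intro: T_PP)

lemma rep_in_T: "x \<in> PP 0 \<Longrightarrow> rep (PP 1) x \<in> T"
  by (simp add: T_def)

lemma T_eqI: "x \<in> T \<Longrightarrow> y \<in> T \<Longrightarrow> x - y \<in> PP 1 \<Longrightarrow> x = y"
  using rep_eq_iff[OF subgrp_PP, of 1 x y] by (simp add: T_rep)

text \<open>The coordinates are chosen representatives, so congruent vectors are equal and subspaces
  can be counted as sets of functions.\<close>

lemma vec_eqI: "x \<in> vec I \<Longrightarrow> y \<in> vec I \<Longrightarrow> (\<And>c. c \<in> I \<Longrightarrow> x c - y c \<in> PP 1) \<Longrightarrow> x = y"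
  by (rule extensionalityI[of _ I]) (auto simp: PiE_iff intro: T_eqI)

lemma rep_diff_PP: "rep (PP 1) x - x \<in> PP 1" "x - rep (PP 1) x \<in> PP 1"
  using rep_diff[OF subgrp_PP[of 1], of x]
    subgrp_diff_commute[OF subgrp_PP[of 1], of "rep (PP 1) x" x] by auto

lemma PP_mult_0_1: "x \<in> PP 0 \<Longrightarrow> y \<in> PP 1 \<Longrightarrow> x * y \<in> PP 1"
  and PP_mult_1_0: "x \<in> PP 1 \<Longrightarrow> y \<in> PP 0 \<Longrightarrow> x * y \<in> PP 1"
  and PP_mult_0_0: "x \<in> PP 0 \<Longrightarrow> y \<in> PP 0 \<Longrightarrow> x * y \<in> PP 0"
  using PP_mult[of x 0 y 1] PP_mult[of x 1 y 0] PP_mult[of x 0 y 0] by simp_all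

end

text \<open>Linear algebra over the residue field: the forms \<open>\<beta> b\<close> are dual to the vectors \<open>d b\<close>.\<close>

locale dual_system = padic_quaternion v scale star \<O> \<P> \<pi> \<Theta> \<epsilon>
  for v :: "'k::field_char_0 \<Rightarrow> int"
    and scale :: "'k \<Rightarrow> 'd::division_ring \<Rightarrow> 'd"
    and star :: "'d \<Rightarrow> 'd"
    and \<O> \<P> :: "'d set" and \<pi> :: 'k and \<Theta> \<epsilon> :: 'd +
  fixes I J :: "nat set" and \<beta> d :: "nat \<Rightarrow> nat \<Rightarrow> 'd"
  assumes fin: "finite I" "finite J"
    and beta_int: "b \<in> J \<Longrightarrow> c \<in> I \<Longrightarrow> \<beta> b c \<in> PP 0"
    and d_int: "b \<in> J \<Longrightarrow> c \<in> I \<Longrightarrow> d b c \<in> PP 0"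
    and dual: "b \<in> J \<Longrightarrow> b' \<in> J \<Longrightarrow> (\<Sum>c\<in>I. \<beta> b c * d b' c) - (if b = b' then 1 else 0) \<in> PP 1"
begin

definition pr :: "nat \<Rightarrow> (nat \<Rightarrow> 'd) \<Rightarrow> 'd" where "pr b x = (\<Sum>c\<in>I. \<beta> b c * x c)"

text \<open>The common kernel of the forms, a complement of the span of the vectors
  \<open>d b\<close>.\<close>

definition V :: "(nat \<Rightarrow> 'd) set" where "V = {x \<in> vec I. \<forall>b\<in>J. pr b x \<in> PP 1}"

definition comb :: "(nat \<Rightarrow> 'd) \<Rightarrow> (nat \<Rightarrow> 'd) \<Rightarrow> nat \<Rightarrow> 'd" where
  "comb k x c = (\<Sum>b\<in>J. d b c * k b) + x c"

text \<open>The sum of a combination of the vectors \<open>d b\<close> and a further vector, each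
  coordinate being replaced by its representative; identities for \<open>Psi\<close> thus hold
  modulo \<open>PP 1\<close>.\<close>

definition Psi :: "(nat \<Rightarrow> 'd) \<times> (nat \<Rightarrow> 'd) \<Rightarrow> nat \<Rightarrow> 'd" where
  "Psi = (\<lambda>(k, x). \<lambda>c\<in>I. rep (PP 1) (comb k x c))"

lemma finite_V: "finite V" unfolding V_def using finite_vec[OF fin(1)] by simp

lemma comb_int: "k \<in> vec J \<Longrightarrow> (\<And>c. c \<in> I \<Longrightarrow> x c \<in> PP 0) \<Longrightarrow> c \<in> I \<Longrightarrow> comb k x c \<in> PP 0"
  unfolding comb_def using d_int vec_PP by (intro PP_add PP_sum PP_mult_0_0) auto

lemma pr_cong:
  "b \<in> J \<Longrightarrow> (\<And>c. c \<in> I \<Longrightarrow> x c - y c \<in> PP 1) \<Longrightarrow> pr b x - pr b y \<in> PP 1"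
  unfolding pr_def sum_subtractf[symmetric] right_diff_distrib[symmetric]
  using beta_int by (intro PP_sum PP_mult_0_1) auto

text \<open>By duality the form \<open>\<beta> b\<close> reads off the coefficient
  \<open>k b\<close>, apart from its value on \<open>x\<close>.\<close>

lemma pr_comb:
  assumes k: "k \<in> vec J" and b: "b \<in> J"
  shows "pr b (comb k x) - (k b + pr b x) \<in> PP 1"
proof -
  have "pr b (comb k x) = (\<Sum>c\<in>I. \<Sum>b'\<in>J. \<beta> b c * d b' c * k b') + pr b x"
    by (simp add: pr_def comb_def distrib_left sum.distrib sum_distrib_left mult.assoc)
  also have "(\<Sum>c\<in>I. \<Sum>b'\<in>J. \<beta> b c * d b' c * k b') = (\<Sum>b'\<in>J. (\<Sum>c\<in>I. \<beta> b c * d b' c) * k b')"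
    by (subst sum.swap) (simp add: sum_distrib_right)
  finally have 1: "pr b (comb k x) = (\<Sum>b'\<in>J. (\<Sum>c\<in>I. \<beta> b c * d b' c) * k b') + pr b x" .
  have 2: "k b = (\<Sum>b'\<in>J. (if b = b' then 1 else 0) * k b')"
    using b fin by (simp add: if_distrib[of "\<lambda>x. x * _"] cong: if_cong)
  have "pr b (comb k x) - (k b + pr b x) =
      (\<Sum>b'\<in>J. ((\<Sum>c\<in>I. \<beta> b c * d b' c) - (if b = b' then 1 else 0)) * k b')"
    by (subst 2) (simp add: 1 left_diff_distrib sum_subtractf)
  also have "\<dots> \<in> PP 1"
    using dual[OF b] k by (intro PP_sum PP_mult_1_0) (auto intro: vec_PP)
  finally show ?thesis .
qed

lemma Psi_vec: "k \<in> vec J \<Longrightarrow> x \<in> vec I \<Longrightarrow> Psi (k, x) \<in> vec I"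
proof -
  assume k: "k \<in> vec J" and x: "x \<in> vec I"
  have "rep (PP 1) (comb k x c) \<in> T" if "c \<in> I" for c
    using comb_int[OF k vec_PP[OF x] that] by (rule rep_in_T)
  then show ?thesis by (auto simp: Psi_def)
qed

lemma pr_Psi:
  assumes "k \<in> vec J" "x \<in> V" "b \<in> J"
  shows "pr b (Psi (k, x)) - k b \<in> PP 1"
proof -
  have 1: "pr b (Psi (k, x)) - pr b (comb k x) \<in> PP 1"
    by (rule pr_cong[OF assms(3)]) (simp add: Psi_def rep_diff_PP)
  have 2: "pr b x \<in> PP 1" using assms by (simp add: V_def)
  have "pr b (Psi (k, x)) - k b = (pr b (Psi (k, x)) - pr b (comb k x)) +
      ((pr b (comb k x) - (k b + pr b x)) + pr b x)" by simp
  then show ?thesis using PP_add[OF 1 PP_add[OF pr_comb[OF assms(1,3), of x] 2]] by simp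
qed

text \<open>The coefficients of a vector are its values under the forms, and what is left after
  subtracting the corresponding combination lies in \<open>V\<close>.\<close>

lemma bij_Psi: "bij_betw Psi (vec J \<times> V) (vec I)"
  unfolding bij_betw_def
proof
  show "inj_on Psi (vec J \<times> V)"
  proof (rule inj_onI, clarify)
    fix k x k' x' assume *: "k \<in> vec J" "k' \<in> vec J" "x \<in> V" "x' \<in> V" and e: "Psi (k, x) = Psi (k', x')"
    have "k b - k' b \<in> PP 1" if "b \<in> J" for b
      using PP_diff[OF pr_Psi[OF *(2,4) that] pr_Psi[OF *(1,3) that]] e by simp
    then have k: "k = k'" using vec_eqI * by blast
    have "x c - x' c \<in> PP 1" if "c \<in> I" for c
    proof -
      have "rep (PP 1) (comb k x c) = rep (PP 1) (comb k' x' c)"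
        using fun_cong[OF e, of c] that by (simp add: Psi_def)
      then show ?thesis by (simp add: rep_eq_iff subgrp_PP comb_def k)
    qed
    then have "x = x'" using vec_eqI[of x I x'] * by (simp add: V_def)
    with k show "k = k' \<and> x = x'" by simp
  qed
  show "Psi ` (vec J \<times> V) = vec I"
  proof (intro subset_antisym subsetI)
    fix y assume y: "y \<in> vec I"
    define k where "k = (\<lambda>b\<in>J. rep (PP 1) (pr b y))"
    define z where "z c = y c - (\<Sum>b\<in>J. d b c * k b)" for c
    define x where "x = (\<lambda>c\<in>I. rep (PP 1) (z c))"
    have yi: "y c \<in> PP 0" if "c \<in> I" for c using y that vec_PP by blast
    have pi: "pr b y \<in> PP 0" if "b \<in> J" for b
      unfolding pr_def using yi beta_int that by (intro PP_sum PP_mult_0_0) auto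
    have k: "k \<in> vec J" using pi by (auto simp: k_def intro: rep_in_T)
    have "z c \<in> PP 0" if "c \<in> I" for c
      unfolding z_def using yi d_int that vec_PP[OF k] by (intro PP_diff PP_sum PP_mult_0_0) auto
    then have x: "x \<in> vec I" by (auto simp: x_def intro: rep_in_T)
    have yz: "comb k z = y" by (simp add: comb_def z_def fun_eq_iff)
    have "pr b x \<in> PP 1" if b: "b \<in> J" for b
    proof -
      have 1: "pr b x - pr b z \<in> PP 1" by (rule pr_cong[OF b]) (simp add: x_def rep_diff_PP)
      have 2: "pr b y - (k b + pr b z) \<in> PP 1" using pr_comb[OF k b, of z] by (simp add: yz)
      have 3: "pr b y - k b \<in> PP 1" using b by (simp add: k_def rep_diff_PP)
      have "pr b x = (pr b x - pr b z) + ((pr b y - k b) - (pr b y - (k b + pr b z)))" by simp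
      then show ?thesis using PP_add[OF 1 PP_diff[OF 3 2]] by simp
    qed
    then have "x \<in> V" using x by (simp add: V_def)
    moreover have "Psi (k, x) = y"
    proof (rule vec_eqI[OF Psi_vec[OF k x] y])
      fix c assume c: "c \<in> I"
      have "comb k x c - y c \<in> PP 1" using c by (simp add: comb_def x_def z_def flip: rep_diff_PP)
          (metis rep_diff_PP(1) z_def add_diff_eq diff_diff_eq2 add.commute)
      then show "Psi (k, x) c - y c \<in> PP 1"
        using c subgrp_diff_trans[OF subgrp_PP rep_diff_PP(1)] by (simp add: Psi_def)
    qed
    ultimately show "y \<in> Psi ` (vec J \<times> V)" using k by blast
  next
    fix y assume "y \<in> Psi ` (vec J \<times> V)"
    then obtain k x where "k \<in> vec J" "x \<in> V" "y = Psi (k, x)" by blast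
    then show "y \<in> vec I" using Psi_vec[of k x] by (simp add: V_def)
  qed
qed

lemma card_V: "residue_card v ^ (2 * card J) * card V = residue_card v ^ (2 * card I)"
  using bij_betw_same_card[OF bij_Psi] fin by (simp add: card_cartesian_product card_vec)

text \<open>Since \<open>card V\<close> times a power of \<open>q\<close> is a power of
  \<open>q\<close>, divisibility of powers yields the inequality of dimensions, and cancellation
  yields the size of \<open>V\<close>.\<close>

lemma card_V': "card V = residue_card v ^ (2 * (card I - card J))" and card_J_le: "card J \<le> card I"
proof -
  have q: "residue_card v > 1" by (rule residue_card_gt_1)
  have "residue_card v ^ (2 * card J) dvd residue_card v ^ (2 * card I)" by (metis card_V dvd_triv_left)
  then show le: "card J \<le> card I" using power_dvd_imp_le[OF _ q] by fastforce
  have "residue_card v ^ (2 * card I) = residue_card v ^ (2 * card J) * residue_card v ^ (2 * (card I - card J))"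
    unfolding power_add[symmetric] using le by (intro arg_cong[where f = "power _"]) simp
  then show "card V = residue_card v ^ (2 * (card I - card J))" using card_V q by simp
qed

text \<open>The set is a translate of \<open>V\<close>, the coefficients being the representatives
  of the values \<open>y b\<close>.\<close>

lemma card_pr_eq:
  assumes y: "\<And>b. b \<in> J \<Longrightarrow> y b \<in> PP 0"
  shows "card {x \<in> vec I. \<forall>b\<in>J. pr b x - y b \<in> PP 1} = card V"
proof -
  define k where "k = (\<lambda>b\<in>J. rep (PP 1) (y b))"
  have k: "k \<in> vec J" using y by (auto simp: k_def intro: rep_in_T)
  have ky: "k b - y b \<in> PP 1" "y b - k b \<in> PP 1" if "b \<in> J" for b
    using that by (simp_all add: k_def rep_diff_PP)
  have "{x \<in> vec I. \<forall>b\<in>J. pr b x - y b \<in> PP 1} = Psi ` ({k} \<times> V)"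
  proof (intro subset_antisym subsetI)
    fix x assume x: "x \<in> {x \<in> vec I. \<forall>b\<in>J. pr b x - y b \<in> PP 1}"
    then obtain k' z where z: "k' \<in> vec J" "z \<in> V" "x = Psi (k', z)"
      using bij_betw_imp_surj_on[OF bij_Psi] by blast
    have "k' = k"
    proof (rule vec_eqI[OF z(1) k])
      fix b assume b: "b \<in> J"
      have "pr b x - y b \<in> PP 1" using x b by blast
      from PP_diff[OF PP_diff[OF this pr_Psi[OF z(1,2) b, folded z(3)]] ky(1)[OF b]]
      show "k' b - k b \<in> PP 1" by simp
    qed
    then show "x \<in> Psi ` ({k} \<times> V)" using z by blast
  next
    fix x assume "x \<in> Psi ` ({k} \<times> V)"
    then obtain z where z: "z \<in> V" "x = Psi (k, z)" by blast
    then show "x \<in> {x \<in> vec I. \<forall>b\<in>J. pr b x - y b \<in> PP 1}"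
      using subgrp_diff_trans[OF subgrp_PP pr_Psi[OF k z(1)] ky(1)] Psi_vec[OF k, of z]
      by (simp add: V_def)
  qed
  moreover have "inj_on Psi ({k} \<times> V)"
    by (rule inj_on_subset[OF bij_betw_imp_inj_on[OF bij_Psi]]) (use k in auto)
  ultimately show ?thesis by (simp add: card_image card_cartesian_product_singleton)
qed

end

section \<open>Norms on the residue field and hermitian vectors of given norm\<close>

context padic_quaternion
begin

lemma star_mult_self: "star x * x = emb (nrd x)"
  using nrd[of "star x"] by (simp add: star_star nrd_star)

lemma nrd_val_ring: "x \<in> PP 0 \<Longrightarrow> nrd x \<in> val_ring v"
  by (simp add: PP_def)

lemma nrd_val_ideal: "nrd x \<in> val_ideal v \<longleftrightarrow> x \<in> PP 1"
  by (simp add: PP_def)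

lemma nrd_cong: assumes "x - y \<in> PP 1" "x \<in> PP 0" "y \<in> PP 0" shows "nrd x - nrd y \<in> val_ideal v"
proof -
  have "star x * x - star y * y \<in> PP 1"
    by (rule PP_cong_mult) (use assms in \<open>auto simp: PP_star simp flip: star_diff\<close>)
  then show ?thesis by (simp add: star_mult_self PP_emb flip: emb_diff)
qed

lemma nrd_quad: "nrd (quad a b) = a\<^sup>2 - dlt * b\<^sup>2"
  using nrd_coords[of a b 0 0] by (simp add: quad_def[of 0 0])

lemma val_ideal_mult: "x \<in> val_ring v \<Longrightarrow> y \<in> val_ideal v \<Longrightarrow> x * y \<in> val_ideal v"
  using pp_mult[of x 0 y 1] by simp

lemma val_ring_mult: "x \<in> val_ring v \<Longrightarrow> y \<in> val_ring v \<Longrightarrow> x * y \<in> val_ring v"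
  using pp_mult[of x 0 y 0] by simp

text \<open>
  The two sets \<open>{x\<^sup>2}\<close> and \<open>{\<tau> + dlt y\<^sup>2}\<close> each contain more than half of the residue classes,
  hence they meet.
\<close>

lemma nrd_residue_surj:
  assumes t: "\<tau> \<in> val_ring v" shows "\<exists>x\<in>PP 0. nrd x - \<tau> \<in> val_ideal v"
proof -
  let ?o = "val_ring v" and ?r = "rep (val_ideal v)"
  define Q where "Q = (\<lambda>x. ?r (x\<^sup>2)) ` ?o"
  define Q' where "Q' = (\<lambda>y. ?r (\<tau> + dlt * y\<^sup>2)) ` ?o"
  have fin: "finite (?r ` ?o)" and cq: "card (?r ` ?o) = residue_card v"
    using finite_rep_val_ring by (simp_all add: residue_card_eq_ncl ncl_def)
  have sq: "x\<^sup>2 \<in> ?o" if "x \<in> ?o" for x using val_ring_mult[OF that that] by (simp add: power2_eq_square)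
  have dv: "dlt \<in> ?o" using dlt by (simp add: pp_iff)
  have Qs: "Q \<subseteq> ?r ` ?o" unfolding Q_def using sq by blast
  have Qs': "Q' \<subseteq> ?r ` ?o"
    unfolding Q'_def using pp_add[OF t val_ring_mult[OF dv sq]] by blast
  have "card Q' = card Q"
    unfolding Q_def Q'_def
  proof (rule card_image_eq_kernel(1))
    fix x y
    have "\<tau> + dlt * x\<^sup>2 - (\<tau> + dlt * y\<^sup>2) = dlt * (x\<^sup>2 - y\<^sup>2)" by (simp add: algebra_simps)
    then have "\<tau> + dlt * x\<^sup>2 - (\<tau> + dlt * y\<^sup>2) \<in> val_ideal v \<longleftrightarrow> x\<^sup>2 - y\<^sup>2 \<in> val_ideal v"
      by (simp only: pp_mult_left_iff[OF dlt(1)] dlt(2)) simp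
    then show "?r (\<tau> + dlt * x\<^sup>2) = ?r (\<tau> + dlt * y\<^sup>2) \<longleftrightarrow> ?r (x\<^sup>2) = ?r (y\<^sup>2)"
      by (simp add: rep_eq_iff subgrp_pp)
  qed
  have key: "residue_card v < 2 * card Q"
  proof -
    have sqi: "x\<^sup>2 - y\<^sup>2 \<in> val_ideal v \<longleftrightarrow> x - y \<in> val_ideal v \<or> x + y \<in> val_ideal v"
      if "x \<in> ?o" "y \<in> ?o" for x y
    proof
      assume *: "x\<^sup>2 - y\<^sup>2 \<in> val_ideal v"
      have e: "x\<^sup>2 - y\<^sup>2 = (x - y) * (x + y)" by (simp add: power2_eq_square algebra_simps)
      show "x - y \<in> val_ideal v \<or> x + y \<in> val_ideal v"
      proof (cases "x - y = 0 \<or> x + y = 0")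
        case False
        then have "1 \<le> v (x - y) + v (x + y)" using * unfolding e by (simp add: pp_iff v_mult)
        then show ?thesis by (auto simp: pp_iff)
      qed auto
    next
      assume *: "x - y \<in> val_ideal v \<or> x + y \<in> val_ideal v"
      have e: "x\<^sup>2 - y\<^sup>2 = (x - y) * (x + y)" "x\<^sup>2 - y\<^sup>2 = (x + y) * (x - y)"
        by (simp_all add: power2_eq_square algebra_simps)
      show "x\<^sup>2 - y\<^sup>2 \<in> val_ideal v"
        using * val_ideal_mult[OF pp_diff[OF that]] val_ideal_mult[OF pp_add[OF that]] e by metis
    qed
    have "card (?r ` ?o) = (\<Sum>y\<in>(\<lambda>x. ?r (x\<^sup>2)) ` ?o. card (?r ` {x \<in> ?o. ?r (x\<^sup>2) = y}))"
    proof (rule card_fibres[OF fin])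
      fix x y assume "x \<in> ?o" "y \<in> ?o" "?r x = ?r y"
      then show "?r (x\<^sup>2) = ?r (y\<^sup>2)" by (simp add: rep_eq_iff subgrp_pp sqi)
    qed
    \<comment> \<open>Squaring identifies at most a class and its negative, while over 0 there is
      only one class; the latter makes the final inequality strict.\<close>
    also have "\<dots> \<le> (\<Sum>y\<in>Q. if y = ?r 0 then 1 else 2)"
      unfolding Q_def
    proof (rule sum_mono)
      fix y assume "y \<in> (\<lambda>x. ?r (x\<^sup>2)) ` ?o"
      then obtain x where x: "x \<in> ?o" "y = ?r (x\<^sup>2)" by blast
      have sub: "?r ` {z \<in> ?o. ?r (z\<^sup>2) = y} \<subseteq> {?r x, ?r (- x)}"
        unfolding x(2) using sqi[OF _ x(1)] by (auto simp: rep_eq_iff subgrp_pp)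
      show "card (?r ` {z \<in> ?o. ?r (z\<^sup>2) = y}) \<le> (if y = ?r 0 then 1 else 2)"
      proof (cases "y = ?r 0")
        case True
        then have "x\<^sup>2 - 0\<^sup>2 \<in> val_ideal v" unfolding x(2) by (simp add: rep_eq_iff subgrp_pp)
        then have "x \<in> val_ideal v" using sqi[OF x(1), of 0] by simp
        then have "?r (- x) = ?r x"
          using pp_minus[OF pp_add[of x 1 x]] by (simp add: rep_eq_iff subgrp_pp)
        then show ?thesis using card_mono[OF _ sub] True by simp
      next
        case False
        have "card {?r x, ?r (- x)} \<le> 2" by (simp add: card_insert_if)
        then show ?thesis using card_mono[OF _ sub] False by simp
      qed
    qed
    also have "\<dots> < 2 * card Q"
    proof -
      have finQ: "finite Q" using Qs fin finite_subset by blast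
      have z: "?r 0 \<in> Q" unfolding Q_def by (rule image_eqI[of _ _ 0]) auto
      have "(\<Sum>y\<in>Q. if y = ?r 0 then 1 else 2) < (\<Sum>y\<in>Q. 2::nat)"
        by (rule sum_strict_mono_ex1[OF finQ]) (use z in auto)
      then show ?thesis by simp
    qed
    finally show ?thesis by (simp add: cq)
  qed
  have "Q \<inter> Q' \<noteq> {}"
  proof
    assume "Q \<inter> Q' = {}"
    then have "card (Q \<union> Q') = card Q + card Q'"
      using Qs Qs' fin by (intro card_Un_disjoint) (auto intro: finite_subset)
    moreover have "card (Q \<union> Q') \<le> residue_card v" using card_mono[OF fin] Qs Qs' by (simp add: cq)
    ultimately show False using key \<open>card Q' = card Q\<close> by simp
  qed
  then obtain x y where xy: "x \<in> ?o" "y \<in> ?o" "?r (x\<^sup>2) = ?r (\<tau> + dlt * y\<^sup>2)"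
    unfolding Q_def Q'_def by blast
  then have "nrd (quad x y) - \<tau> \<in> val_ideal v"
    by (simp add: rep_eq_iff subgrp_pp nrd_quad algebra_simps)
  moreover have "quad x y \<in> PP 0" using xy by (simp add: PP_quad)
  ultimately show ?thesis by blast
qed

text \<open>Multiplication by an element of norm \<open>\<sigma>' / \<sigma>\<close> shows that all
  fibres over nonzero residues have the same size. The fibre over 0 is a point, so
  \<open>q^2 - 1\<close> elements are spread evenly over \<open>q - 1\<close> fibres.\<close>

lemma card_norm_fibre:
  assumes t: "\<tau> \<in> val_ring v"
  shows "card {x \<in> T. nrd x - \<tau> \<in> val_ideal v} = (if \<tau> \<in> val_ideal v then 1 else residue_card v + 1)"
proof -
  define F where "F \<sigma> = {x \<in> T. nrd x - \<sigma> \<in> val_ideal v}" for \<sigma>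
  have finF: "finite (F \<sigma>)" for \<sigma> by (simp add: F_def finite_T)
  have F0: "card (F \<sigma>) = 1" if "\<sigma> \<in> val_ideal v" for \<sigma>
  proof -
    have "F \<sigma> = {rep (PP 1) 0}"
    proof (intro subset_antisym subsetI)
      fix x assume "x \<in> F \<sigma>"
      then have x: "x \<in> T" "nrd x - \<sigma> \<in> val_ideal v" by (auto simp: F_def)
      then have "x \<in> PP 1" using pp_add[OF x(2) that] by (simp add: nrd_val_ideal)
      then have "x = rep (PP 1) 0"
        using PP_diff[OF _ rep_diff_PP(1)[of 0], of x] x by (intro T_eqI rep_in_T) auto
      then show "x \<in> {rep (PP 1) 0}" by simp
    next
      fix x assume "x \<in> {rep (PP 1) 0}"
      then have x: "x = rep (PP 1) 0" by simp
      then have "nrd x \<in> val_ideal v" using rep_diff_PP(1)[of 0] by (simp add: nrd_val_ideal)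
      then show "x \<in> F \<sigma>" using that x by (simp add: F_def pp_diff rep_in_T)
    qed
    then show ?thesis by simp
  qed
  have F_le: "card (F \<sigma>) \<le> card (F \<sigma>')"
    if s: "\<sigma> \<in> val_ring v" "\<sigma> \<notin> val_ideal v" "\<sigma>' \<in> val_ring v" "\<sigma>' \<notin> val_ideal v" for \<sigma> \<sigma>'
  proof -
    have s0: "\<sigma> \<noteq> 0" "v \<sigma> = 0" "v \<sigma>' = 0" "\<sigma>' \<noteq> 0" using s by (auto simp: pp_iff)
    have "\<sigma>' / \<sigma> \<in> val_ring v" using s0 by (simp add: pp_iff v_divide)
    then obtain z where z: "z \<in> PP 0" "nrd z - \<sigma>' / \<sigma> \<in> val_ideal v" using nrd_residue_surj by blast
    have z1: "z \<notin> PP 1"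
    proof
      assume "z \<in> PP 1"
      then have "nrd z \<in> val_ideal v" by (simp add: nrd_val_ideal)
      then have "\<sigma>' / \<sigma> \<in> val_ideal v" using subgrp_diff_right[OF subgrp_pp z(2)] by simp
      then show False using s0 by (simp add: pp_iff v_divide)
    qed
    then have wz: "w z = 0" "z \<noteq> 0" using z(1) by (auto simp: PP_iff)
    have "inj_on (\<lambda>x. rep (PP 1) (z * x)) (F \<sigma>)"
    proof (rule inj_onI)
      fix x y assume xy: "x \<in> F \<sigma>" "y \<in> F \<sigma>" "rep (PP 1) (z * x) = rep (PP 1) (z * y)"
      then have "z * (x - y) \<in> PP 1" by (simp add: rep_eq_iff subgrp_PP right_diff_distrib)
      then have "x - y \<in> PP 1" using wz by (simp add: PP_mult_left_iff)
      then show "x = y" using xy by (intro T_eqI) (auto simp: F_def)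
    qed
    moreover have "(\<lambda>x. rep (PP 1) (z * x)) ` F \<sigma> \<subseteq> F \<sigma>'"
    proof (rule image_subsetI)
      fix x assume "x \<in> F \<sigma>"
      then have x: "x \<in> T" "x \<in> PP 0" "nrd x - \<sigma> \<in> val_ideal v" by (auto simp: F_def intro: T_PP)
      have zx: "z * x \<in> PP 0" by (rule PP_mult_0_0[OF z(1) x(2)])
      have 1: "nrd (rep (PP 1) (z * x)) - nrd (z * x) \<in> val_ideal v"
        by (rule nrd_cong[OF rep_diff_PP(1) T_PP[OF rep_in_T[OF zx]] zx])
      have "nrd (z * x) - \<sigma>' = nrd z * (nrd x - \<sigma>) + \<sigma> * (nrd z - \<sigma>' / \<sigma>)"
        using s0 by (simp add: nrd_mult field_simps)
      then have 2: "nrd (z * x) - \<sigma>' \<in> val_ideal v"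
        using val_ideal_mult[OF nrd_val_ring[OF z(1)] x(3)] val_ideal_mult[OF s(1) z(2)]
        by (simp add: pp_add)
      show "rep (PP 1) (z * x) \<in> F \<sigma>'"
        using subgrp_diff_trans[OF subgrp_pp 1 2] rep_in_T[OF zx] by (simp add: F_def)
    qed
    ultimately show ?thesis using card_inj_on_le finF by blast
  qed
  let ?r = "rep (val_ideal v)" and ?o = "val_ring v"
  have o1: "1 \<in> ?o" "1 \<notin> val_ideal v" by (auto simp: pp_one) (simp add: pp_iff v_one)
  have To: "\<sigma> \<in> ?o" if "\<sigma> \<in> ?r ` ?o" for \<sigma>
    using that rep_diff[OF subgrp_pp[of 1]] subgrp_diff_right[OF subgrp_pp[of 0]] pp_mono[of 0 1] by auto
  have To0: "\<sigma> \<in> val_ideal v \<longleftrightarrow> \<sigma> = ?r 0" if "\<sigma> \<in> ?r ` ?o" for \<sigma>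
  proof -
    have "?r \<sigma> = \<sigma>" using that by (auto simp: rep_rep subgrp_pp)
    then show ?thesis using rep_eq_iff[OF subgrp_pp, of 1 \<sigma> 0] by simp
  qed
  have "card T = (\<Sum>\<sigma>\<in>?r ` ?o. card (F \<sigma>))"
  proof -
    have "T = (\<Union>\<sigma>\<in>?r ` ?o. F \<sigma>)"
    proof (intro subset_antisym subsetI)
      fix x assume x: "x \<in> T"
      have "nrd x - ?r (nrd x) \<in> val_ideal v"
        using rep_diff[OF subgrp_pp[of 1], of "nrd x"] subgrp_diff_commute[OF subgrp_pp[of 1]] by blast
      then show "x \<in> (\<Union>\<sigma>\<in>?r ` ?o. F \<sigma>)"
        using x nrd_val_ring[OF T_PP[OF x]] by (auto simp: F_def)
    qed (auto simp: F_def)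
    moreover have "card (\<Union>\<sigma>\<in>?r ` ?o. F \<sigma>) = (\<Sum>\<sigma>\<in>?r ` ?o. card (F \<sigma>))"
    proof (rule card_UN_disjoint[OF finite_rep_val_ring])
      show "\<forall>\<sigma>\<in>?r ` ?o. \<forall>\<sigma>'\<in>?r ` ?o. \<sigma> \<noteq> \<sigma>' \<longrightarrow> F \<sigma> \<inter> F \<sigma>' = {}"
      proof (intro ballI impI)
        fix \<sigma> \<sigma>' assume s: "\<sigma> \<in> ?r ` ?o" "\<sigma>' \<in> ?r ` ?o" "\<sigma> \<noteq> \<sigma>'"
        show "F \<sigma> \<inter> F \<sigma>' = {}"
        proof (rule ccontr)
          assume "F \<sigma> \<inter> F \<sigma>' \<noteq> {}"
          then obtain x where "nrd x - \<sigma> \<in> val_ideal v" "nrd x - \<sigma>' \<in> val_ideal v" by (auto simp: F_def)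
          from pp_diff[OF this(2,1)] have "?r \<sigma> = ?r \<sigma>'" by (simp add: rep_eq_iff subgrp_pp)
          moreover have "?r \<sigma> = \<sigma>" "?r \<sigma>' = \<sigma>'" using s by (auto simp: rep_rep subgrp_pp)
          ultimately show False using s by simp
        qed
      qed
    qed (simp add: finF)
    ultimately show ?thesis by simp
  qed
  also have "\<dots> = (\<Sum>\<sigma>\<in>?r ` ?o. if \<sigma> = ?r 0 then 1 else card (F 1))"
  proof (rule sum.cong[OF refl])
    fix \<sigma> assume s: "\<sigma> \<in> ?r ` ?o"
    show "card (F \<sigma>) = (if \<sigma> = ?r 0 then 1 else card (F 1))"
    proof (cases "\<sigma> = ?r 0")
      case True then show ?thesis using F0 To0[OF s] by simp
    next
      case False
      then have n: "\<sigma> \<notin> val_ideal v" using To0[OF s] by simp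
      show ?thesis using False F_le[OF To[OF s] n o1] F_le[OF o1 To[OF s] n] by simp
    qed
  qed
  also have "\<dots> = 1 + (residue_card v - 1) * card (F 1)"
  proof -
    have z: "?r 0 \<in> ?r ` ?o" by (rule imageI) simp
    have "(\<Sum>\<sigma>\<in>?r ` ?o. if \<sigma> = ?r 0 then 1 else card (F 1)) =
        1 + (\<Sum>\<sigma>\<in>?r ` ?o - {?r 0}. if \<sigma> = ?r 0 then 1 else card (F 1))"
      by (subst sum.remove[OF finite_rep_val_ring z]) simp
    also have "(\<Sum>\<sigma>\<in>?r ` ?o - {?r 0}. if \<sigma> = ?r 0 then 1 else card (F 1)) =
        (\<Sum>\<sigma>\<in>?r ` ?o - {?r 0}. card (F 1))" by (intro sum.cong) auto
    finally show ?thesis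
      using z finite_rep_val_ring by (simp add: card_Diff_singleton residue_card_eq_ncl ncl_def)
  qed
  finally have c: "residue_card v ^ 2 = 1 + (residue_card v - 1) * card (F 1)" by (simp add: card_T)
  have "card (F 1) = residue_card v + 1"
  proof -
    \<comment> \<open>Writing \<open>q\<close> as \<open>k + 2\<close> turns the truncated
      difference \<open>q - 1\<close> into \<open>k + 1\<close>, which can be cancelled.\<close>
    obtain k where k: "residue_card v = k + 2"
      using residue_card_gt_1 by (metis add.commute add_2_eq_Suc less_iff_Suc_add One_nat_def plus_1_eq_Suc)
    have "(k + 1) * (k + 3) = (k + 1) * card (F 1)" using c unfolding k by (simp add: power2_eq_square algebra_simps)
    then have "k + 3 = card (F 1)" by (simp only: mult_cancel_left) simp
    then show ?thesis by (simp add: k)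
  qed
  then show ?thesis using F0[of \<tau>] F_le[OF t _ o1] F_le[OF o1 t] by (auto simp: F_def intro: antisym)
qed

end

lemma sum_if_filter: "finite X \<Longrightarrow> (\<Sum>x\<in>X. if R x then (k::int) else 0) = k * int (card {x \<in> X. R x})"
  by (simp add: sum.If_cases Int_def)

lemma ball_insert2:
  "(\<forall>x\<in>insert a (insert c J). \<forall>y\<in>insert a (insert c J). R x y) \<longleftrightarrow>
    (\<forall>x\<in>J. \<forall>y\<in>J. R x y) \<and> (\<forall>x\<in>J. R x a \<and> R x c \<and> R a x \<and> R c x) \<and> R a a \<and> R c c \<and> R a c \<and> R c a"
  by auto

context padic_quaternion
begin

definition hn :: "nat set \<Rightarrow> (nat \<Rightarrow> 'd) \<Rightarrow> 'k" where "hn I x = (\<Sum>c\<in>I. nrd (x c))"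

lemma hn_int: "(\<And>c. c \<in> I \<Longrightarrow> x c \<in> PP 0) \<Longrightarrow> hn I x \<in> val_ring v"
  unfolding hn_def by (intro subgrp_sum[OF subgrp_pp] nrd_val_ring)

lemma emb_sum: "emb (sum f I) = (\<Sum>i\<in>I. emb (f i))"
  by (induction I rule: infinite_finite_induct) (auto simp: emb_add)

lemma emb_hn: "(\<Sum>c\<in>I. star (x c) * x c) = emb (hn I x)"
  by (simp add: hn_def emb_sum star_mult_self)

lemma hn_cong:
  assumes "\<And>c. c \<in> I \<Longrightarrow> x c - y c \<in> PP 1" "\<And>c. c \<in> I \<Longrightarrow> x c \<in> PP 0" "\<And>c. c \<in> I \<Longrightarrow> y c \<in> PP 0"
  shows "hn I x - hn I y \<in> val_ideal v"
  unfolding hn_def sum_subtractf[symmetric]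
  by (intro subgrp_sum[OF subgrp_pp] nrd_cong) (use assms in auto)

text \<open>A further coordinate must have norm \<tau> minus the norm of the others: there are
  \<open>q + 1\<close> choices, or one if this difference is 0 in the residue field. The factor
  \<open>q\<close> on the left avoids a negative exponent when \<open>I\<close> is empty.\<close>

lemma card_hn_fibre:
  assumes "finite I" "\<tau> \<in> val_ring v"
  shows "int (residue_card v) * int (card {x \<in> vec I. hn I x - \<tau> \<in> val_ideal v}) =
    int (residue_card v) ^ (2 * card I) - (- int (residue_card v)) ^ card I
    + (if \<tau> \<in> val_ideal v then int (residue_card v) * (- int (residue_card v)) ^ card I else 0)"
  using assms
proof (induction I arbitrary: \<tau> rule: finite_induct)
  case empty
  have "{x \<in> vec {}. hn {} x - \<tau> \<in> val_ideal v} = (if \<tau> \<in> val_ideal v then {\<lambda>_. undefined} else {})"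
    using pp_minus[of \<tau> 1] pp_minus[of "- \<tau>" 1] by (auto simp: hn_def)
  then show ?case by simp
next
  case (insert a I)
  let ?q = "int (residue_card v)" and ?p = "val_ideal v"
  let ?S = "\<lambda>u x. nrd x - (\<tau> - hn I u) \<in> ?p"
  have "{x \<in> vec (insert a I). hn (insert a I) x - \<tau> \<in> ?p} =
      {x \<in> vec (insert a I). True \<and> ?S (restrict x I) (x a)}"
    using insert.hyps by (simp add: hn_def algebra_simps cong: sum.cong)
  then have "int (card {x \<in> vec (insert a I). hn (insert a I) x - \<tau> \<in> ?p}) =
      (\<Sum>u\<in>{u \<in> vec I. True}. int (card {x \<in> T. ?S u x}))"
    using card_PiE_insert[OF insert.hyps(2,1) finite_T, of "\<lambda>_. True" ?S] by simp
  also have "\<dots> = (\<Sum>u\<in>vec I. (?q + 1) + (if hn I u - \<tau> \<in> ?p then - ?q else 0))"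
  proof (rule sum.cong)
    fix u assume "u \<in> vec I"
    then have "hn I u \<in> val_ring v" by (intro hn_int) (auto intro: T_PP)
    then have "\<tau> - hn I u \<in> val_ring v" using insert.prems by (simp add: pp_diff)
    moreover have "\<tau> - hn I u \<in> ?p \<longleftrightarrow> hn I u - \<tau> \<in> ?p" by (rule subgrp_diff_commute[OF subgrp_pp])
    ultimately show "int (card {x \<in> T. ?S u x}) = (?q + 1) + (if hn I u - \<tau> \<in> ?p then - ?q else 0)"
      by (simp add: card_norm_fibre)
  qed simp
  also have "\<dots> = (?q + 1) * ?q ^ (2 * card I) - ?q * int (card {u \<in> vec I. hn I u - \<tau> \<in> ?p})"
    using insert.hyps by (simp add: sum.distrib sum_if_filter finite_vec card_vec)
  finally have "?q * int (card {x \<in> vec (insert a I). hn (insert a I) x - \<tau> \<in> ?p}) =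
      ?q * ((?q + 1) * ?q ^ (2 * card I)) - ?q * (?q * int (card {u \<in> vec I. hn I u - \<tau> \<in> ?p}))"
    by (simp only: right_diff_distrib)
  then show ?case
    unfolding insert.IH[OF insert.prems] using insert.hyps
    by (cases "\<tau> \<in> ?p") (simp_all add: algebra_simps power2_eq_square)
qed

definition herm_frames :: "nat set \<Rightarrow> nat set \<Rightarrow> (nat \<Rightarrow> nat \<Rightarrow> 'd) set" where
  "herm_frames I J = {u \<in> J \<rightarrow>\<^sub>E vec I. \<forall>b\<in>J. \<forall>b'\<in>J.
     (\<Sum>c\<in>I. star (u b c) * u b' c) - (if b = b' then 1 else 0) \<in> PP 1}"

end

context dual_system
begin

text \<open>When \<open>\<beta> b\<close> is the conjugate of \<open>d b\<close>, the vectors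
  \<open>d b\<close> are orthonormal and orthogonal to \<open>V\<close>, so norms add.\<close>

lemma hn_Psi:
  assumes herm: "\<And>b c. b \<in> J \<Longrightarrow> c \<in> I \<Longrightarrow> \<beta> b c = star (d b c)"
    and k: "k \<in> vec J" and x: "x \<in> V"
  shows "hn I (Psi (k, x)) - (hn J k + hn I x) \<in> val_ideal v"
proof -
  have xv: "x \<in> vec I" using x by (simp add: V_def)
  define e where "e = comb k x"
  have ei: "e c \<in> PP 0" if "c \<in> I" for c unfolding e_def using comb_int[OF k vec_PP[OF xv] that] .
  have S: "(\<Sum>c\<in>I. star (e c) * y c) = (\<Sum>b\<in>J. star (k b) * pr b y) + (\<Sum>c\<in>I. star (x c) * y c)" for y
  proof -
    have "(\<Sum>c\<in>I. star (e c) * y c) =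
        (\<Sum>c\<in>I. (\<Sum>b\<in>J. star (k b) * (\<beta> b c * y c)) + star (x c) * y c)"
      using herm by (intro sum.cong)
        (auto simp: e_def comb_def star_add star_sum star_mult distrib_right sum_distrib_right mult.assoc)
    also have "\<dots> = (\<Sum>c\<in>I. \<Sum>b\<in>J. star (k b) * (\<beta> b c * y c)) + (\<Sum>c\<in>I. star (x c) * y c)"
      by (rule sum.distrib)
    also have "(\<Sum>c\<in>I. \<Sum>b\<in>J. star (k b) * (\<beta> b c * y c)) = (\<Sum>b\<in>J. star (k b) * pr b y)"
      by (subst sum.swap) (simp add: pr_def sum_distrib_left)
    finally show ?thesis .
  qed
  have "(\<Sum>c\<in>I. star (x c) * e c) = star (\<Sum>c\<in>I. star (e c) * x c)"
    by (simp add: star_sum star_mult star_star)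
  also have "\<dots> = star (\<Sum>b\<in>J. star (k b) * pr b x) + emb (hn I x)"
    by (simp add: S[of x] emb_hn star_add)
  finally have 1: "(\<Sum>c\<in>I. star (x c) * e c) = star (\<Sum>b\<in>J. star (k b) * pr b x) + emb (hn I x)" .
  have "emb (hn I e - (hn J k + hn I x)) =
      (\<Sum>b\<in>J. star (k b) * (pr b e - k b)) + star (\<Sum>b\<in>J. star (k b) * pr b x)"
    using S[of e] 1 emb_hn[of e I] emb_hn[of k J]
    by (simp add: emb_diff emb_add right_diff_distrib sum_subtractf)
  also have "\<dots> \<in> PP 1"
  proof -
    have kk: "star (k b) \<in> PP 0" if "b \<in> J" for b using vec_PP[OF k that] by (simp add: PP_star)
    have px: "pr b x \<in> PP 1" if "b \<in> J" for b using x that by (simp add: V_def)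
    have "pr b e - k b \<in> PP 1" if b: "b \<in> J" for b
      using PP_add[OF pr_comb[OF k b, of x] px[OF b]] by (simp add: e_def)
    then show ?thesis using kk px by (intro PP_add PP_sum PP_mult_0_1) (auto simp: PP_star intro!: PP_sum PP_mult_0_1)
  qed
  finally have 2: "hn I e - (hn J k + hn I x) \<in> val_ideal v" by (simp add: PP_emb)
  have 3: "hn I (Psi (k, x)) - hn I e \<in> val_ideal v"
  proof (rule hn_cong)
    fix c assume c: "c \<in> I"
    show "Psi (k, x) c - e c \<in> PP 1" using c by (simp add: Psi_def e_def rep_diff_PP)
    show "Psi (k, x) c \<in> PP 0" using vec_PP[OF Psi_vec[OF k xv] c] .
  qed (rule ei)
  show ?thesis using subgrp_diff_trans[OF subgrp_pp 3 2] .
qed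

text \<open>
  By \<open>hn_Psi\<close> the counting function of the norm on \<open>vec I\<close> is the convolution of those on \<open>vec J\<close> and
  on the complement \<open>V\<close>. Inverting it avoids the choice of an orthonormal basis of \<open>V\<close>.
\<close>

lemma card_unit_vectors:
  assumes herm: "\<And>b c. b \<in> J \<Longrightarrow> c \<in> I \<Longrightarrow> \<beta> b c = star (d b c)"
  shows "int (residue_card v) * int (card {x \<in> V. hn I x - 1 \<in> val_ideal v}) =
    int (residue_card v) ^ (2 * (card I - card J)) - (- int (residue_card v)) ^ (card I - card J)"
proof -
  let ?q = "int (residue_card v)" and ?p = "val_ideal v"
  define m j where "m = card I - card J" and "j = card J"
  have cI: "card I = j + m" using card_J_le by (simp add: m_def j_def)
  have one: "1 \<in> val_ring v" "1 \<notin> ?p" by (auto simp: pp_one) (simp add: pp_iff v_one)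
  let ?D = "SIGMA x:V. {k \<in> vec J. hn J k - (1 - hn I x) \<in> ?p}"
  have e: "hn I (Psi (k, x)) - 1 \<in> ?p \<longleftrightarrow> hn J k - (1 - hn I x) \<in> ?p" if "k \<in> vec J" "x \<in> V" for k x
  proof -
    have e': "(hn I (Psi (k, x)) - 1) - (hn J k - (1 - hn I x)) = hn I (Psi (k, x)) - (hn J k + hn I x)"
      by simp
    have "(hn I (Psi (k, x)) - 1) - (hn J k - (1 - hn I x)) \<in> ?p"
      unfolding e' by (rule hn_Psi[OF herm that])
    then show ?thesis by (rule subgrp_diff_right[OF subgrp_pp])
  qed
  have "bij_betw (\<lambda>(x, k). Psi (k, x)) ?D {y \<in> vec I. hn I y - 1 \<in> ?p}"
    unfolding bij_betw_def
  proof
    show "inj_on (\<lambda>(x, k). Psi (k, x)) ?D"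
    proof (rule inj_onI, clarify)
      fix x k x' k'
      assume "x \<in> V" "k \<in> vec J" "x' \<in> V" "k' \<in> vec J" "Psi (k, x) = Psi (k', x')"
      then show "x = x' \<and> k = k'"
        using inj_onD[OF bij_betw_imp_inj_on[OF bij_Psi], of "(k, x)" "(k', x')"] by blast
    qed
    show "(\<lambda>(x, k). Psi (k, x)) ` ?D = {y \<in> vec I. hn I y - 1 \<in> ?p}"
    proof (intro subset_antisym subsetI)
      fix y assume y: "y \<in> {y \<in> vec I. hn I y - 1 \<in> ?p}"
      then obtain k x where kx: "k \<in> vec J" "x \<in> V" "y = Psi (k, x)"
        using bij_betw_imp_surj_on[OF bij_Psi] by blast
      then have "(x, k) \<in> ?D" using y e by simp
      then show "y \<in> (\<lambda>(x, k). Psi (k, x)) ` ?D" using kx(3) by (intro image_eqI[of _ _ "(x, k)"]) auto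
    next
      fix y assume "y \<in> (\<lambda>(x, k). Psi (k, x)) ` ?D"
      then obtain k x where kx: "k \<in> vec J" "x \<in> V" "hn J k - (1 - hn I x) \<in> ?p" "y = Psi (k, x)" by auto
      then show "y \<in> {y \<in> vec I. hn I y - 1 \<in> ?p}" using e Psi_vec[of k x] by (simp add: V_def)
    qed
  qed
  then have "card {y \<in> vec I. hn I y - 1 \<in> ?p} = card ?D" by (simp add: bij_betw_same_card)
  also have "\<dots> = (\<Sum>x\<in>V. card {k \<in> vec J. hn J k - (1 - hn I x) \<in> ?p})"
    using finite_V finite_vec[OF fin(2)] by (intro card_SigmaI) auto
  finally have "?q * int (card {y \<in> vec I. hn I y - 1 \<in> ?p}) =
      (\<Sum>x\<in>V. ?q * int (card {k \<in> vec J. hn J k - (1 - hn I x) \<in> ?p}))"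
    by (simp add: sum_distrib_left)
  \<comment> \<open>The count on \<open>vec J\<close> only distinguishes whether
    \<open>1 - hn I x\<close> is 0 modulo the ideal. The sum therefore depends on \<open>V\<close>
    only through its size and its number of unit vectors, and the resulting equation is solved for
    the latter.\<close>
  also have "\<dots> = (\<Sum>x\<in>V. (?q ^ (2 * j) - (- ?q) ^ j) + (if hn I x - 1 \<in> ?p then ?q * (- ?q) ^ j else 0))"
  proof (rule sum.cong[OF refl])
    fix x assume "x \<in> V"
    then have "hn I x \<in> val_ring v" by (intro hn_int) (auto simp: V_def intro: T_PP)
    then have "1 - hn I x \<in> val_ring v" using one by (simp add: pp_diff)
    moreover have "1 - hn I x \<in> ?p \<longleftrightarrow> hn I x - 1 \<in> ?p" by (rule subgrp_diff_commute[OF subgrp_pp])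
    ultimately show "?q * int (card {k \<in> vec J. hn J k - (1 - hn I x) \<in> ?p}) =
        (?q ^ (2 * j) - (- ?q) ^ j) + (if hn I x - 1 \<in> ?p then ?q * (- ?q) ^ j else 0)"
      by (simp add: card_hn_fibre[OF fin(2)] j_def)
  qed
  also have "\<dots> = ?q ^ (2 * m) * (?q ^ (2 * j) - (- ?q) ^ j) +
      ?q * (- ?q) ^ j * int (card {x \<in> V. hn I x - 1 \<in> ?p})"
    by (simp add: sum.distrib sum_if_filter finite_V card_V' m_def)
  finally have "?q ^ (2 * (j + m)) - (- ?q) ^ (j + m) = ?q ^ (2 * m) * (?q ^ (2 * j) - (- ?q) ^ j) +
      ?q * (- ?q) ^ j * int (card {x \<in> V. hn I x - 1 \<in> ?p})"
    using card_hn_fibre[OF fin(1) one(1)] one(2) by (simp add: cI)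
  then have "(- ?q) ^ j * (?q * int (card {x \<in> V. hn I x - 1 \<in> ?p})) =
      (- ?q) ^ j * (?q ^ (2 * m) - (- ?q) ^ m)"
    by (simp add: power_add distrib_left algebra_simps)
  moreover have "(- ?q) ^ j \<noteq> 0" using residue_card_gt_1 by simp
  ultimately show ?thesis unfolding m_def by (simp only: mult_cancel_left) simp
qed

end

context padic_quaternion
begin

text \<open>The vector added to a frame is any unit vector of its complement, which is the set
  \<open>V\<close> of the dual system formed by the frame and its conjugates. Each vector brings one
  factor \<open>q\<close> on the left, as in \<open>card_unit_vectors\<close>.\<close>

lemma card_herm_frames:
  assumes "finite J" "finite I"
  shows "int (residue_card v) ^ card J * int (card (herm_frames I J)) =
    (\<Prod>i<card J. int (residue_card v) ^ (2 * (card I - i)) - (- int (residue_card v)) ^ (card I - i))"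
  using assms(1)
proof (induction J rule: finite_induct)
  case empty
  have "herm_frames I {} = {\<lambda>_. undefined}" by (auto simp: herm_frames_def)
  then show ?case by simp
next
  case (insert a J)
  let ?q = "int (residue_card v)"
  let ?R = "\<lambda>u. \<forall>b\<in>J. \<forall>b'\<in>J. (\<Sum>c\<in>I. star (u b c) * u b' c) - (if b = b' then 1 else 0) \<in> PP 1"
  let ?S = "\<lambda>u x. (\<forall>b\<in>J. (\<Sum>c\<in>I. star (u b c) * x c) \<in> PP 1) \<and> hn I x - 1 \<in> val_ideal v"
  have st: "(\<Sum>c\<in>I. star (x c) * y c) \<in> PP 1 \<longleftrightarrow> (\<Sum>c\<in>I. star (y c) * x c) \<in> PP 1" for x y
    using PP_star[of "\<Sum>c\<in>I. star (y c) * x c" 1] by (simp add: star_sum star_mult star_star)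
  have hh: "(\<Sum>c\<in>I. star (x c) * x c) - 1 \<in> PP 1 \<longleftrightarrow> hn I x - 1 \<in> val_ideal v" for x
    using PP_emb[of "hn I x - 1" 1] by (simp add: emb_hn emb_diff)
  have "herm_frames I (insert a J) = {f \<in> insert a J \<rightarrow>\<^sub>E vec I. ?R (restrict f J) \<and> ?S (restrict f J) (f a)}"
  proof (rule Set.set_eqI)
    fix f
    have na: "b \<noteq> a" "a \<noteq> b" if "b \<in> J" for b using that insert.hyps by auto
    have "(\<forall>b\<in>insert a J. \<forall>b'\<in>insert a J.
        (\<Sum>c\<in>I. star (f b c) * f b' c) - (if b = b' then 1 else 0) \<in> PP 1) \<longleftrightarrow>
      ?R f \<and> (\<forall>b\<in>J. (\<Sum>c\<in>I. star (f b c) * f a c) \<in> PP 1) \<and>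
      (\<forall>b\<in>J. (\<Sum>c\<in>I. star (f a c) * f b c) \<in> PP 1) \<and> (\<Sum>c\<in>I. star (f a c) * f a c) - 1 \<in> PP 1"
      using na by auto
    also have "\<dots> \<longleftrightarrow> ?R f \<and> ?S f (f a)" unfolding hh using st by blast
    also have "\<dots> \<longleftrightarrow> ?R (restrict f J) \<and> ?S (restrict f J) (f a)" by simp
    finally show "f \<in> herm_frames I (insert a J) \<longleftrightarrow>
        f \<in> {f \<in> insert a J \<rightarrow>\<^sub>E vec I. ?R (restrict f J) \<and> ?S (restrict f J) (f a)}"
      unfolding herm_frames_def by blast
  qed
  then have "card (herm_frames I (insert a J)) = (\<Sum>u\<in>herm_frames I J. card {x \<in> vec I. ?S u x})"
    using card_PiE_insert[OF insert.hyps(2,1) finite_vec[OF assms(2)], of ?R ?S] by (simp add: herm_frames_def)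
  then have "?q * int (card (herm_frames I (insert a J))) = (\<Sum>u\<in>herm_frames I J. ?q * int (card {x \<in> vec I. ?S u x}))"
    by (simp add: sum_distrib_left)
  also have "\<dots> = (\<Sum>u\<in>herm_frames I J. ?q ^ (2 * (card I - card J)) - (- ?q) ^ (card I - card J))"
  proof (rule sum.cong[OF refl])
    fix u assume u: "u \<in> herm_frames I J"
    have ui: "u b c \<in> PP 0" if "b \<in> J" "c \<in> I" for b c
      using u that by (auto simp: herm_frames_def PiE_iff intro: T_PP)
    interpret D: dual_system v scale star \<O> \<P> \<pi> \<Theta> \<epsilon> I J "\<lambda>b c. star (u b c)" u
      by unfold_locales (use assms insert.hyps u ui in \<open>auto simp: herm_frames_def PP_star\<close>)
    have "{x \<in> vec I. ?S u x} = {x \<in> D.V. hn I x - 1 \<in> val_ideal v}"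
      by (auto simp: D.V_def D.pr_def)
    then show "?q * int (card {x \<in> vec I. ?S u x}) =
        ?q ^ (2 * (card I - card J)) - (- ?q) ^ (card I - card J)"
      using D.card_unit_vectors by simp
  qed
  also have "\<dots> = int (card (herm_frames I J)) * (?q ^ (2 * (card I - card J)) - (- ?q) ^ (card I - card J))"
    by simp
  finally have "?q ^ card (insert a J) * int (card (herm_frames I (insert a J))) =
      (?q ^ card J * int (card (herm_frames I J))) * (?q ^ (2 * (card I - card J)) - (- ?q) ^ (card I - card J))"
    using insert.hyps by simp
  then show ?case unfolding insert.IH using insert.hyps by simp
qed

end

section \<open>Symplectic frames over the residue field\<close>

locale alternating_form = padic_quaternion v scale star \<O> \<P> \<pi> \<Theta> \<epsilon>
  for v :: "'k::field_char_0 \<Rightarrow> int"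
    and scale :: "'k \<Rightarrow> 'd::division_ring \<Rightarrow> 'd"
    and star :: "'d \<Rightarrow> 'd"
    and \<O> \<P> :: "'d set" and \<pi> :: 'k and \<Theta> \<epsilon> :: 'd +
  fixes I :: "nat set" and p :: "nat \<Rightarrow> nat" and s :: "nat \<Rightarrow> 'd"
  assumes finI: "finite I"
    and pI: "c \<in> I \<Longrightarrow> p c \<in> I"
    and pp: "c \<in> I \<Longrightarrow> p (p c) = c"
    and s1: "c \<in> I \<Longrightarrow> s c = 1 \<or> s c = - 1"
    and sp: "c \<in> I \<Longrightarrow> s (p c) = - s c"
begin

definition B :: "(nat \<Rightarrow> 'd) \<Rightarrow> (nat \<Rightarrow> 'd) \<Rightarrow> 'd" where
  "B x y = (\<Sum>c\<in>I. x c * s c * y (p c))"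

text \<open>Systems of vectors with the Gram matrix of the standard basis; for \<open>J = I\<close>
  they are the elements of the symplectic group, given by their columns.\<close>

definition sympl_frames :: "nat set \<Rightarrow> (nat \<Rightarrow> nat \<Rightarrow> 'd) set" where
  "sympl_frames J = {u \<in> J \<rightarrow>\<^sub>E vec I. \<forall>b\<in>J. \<forall>b'\<in>J. B (u b) (u b') - (if b' = p b then s b else 0) \<in> PP 1}"

lemma bij_p: "bij_betw p I I"
  by (rule bij_betwI[where g = p]) (auto simp: pI pp)

lemma s_square: "c \<in> I \<Longrightarrow> s c * s c = 1"
  using s1[of c] by auto

lemma s_comm: "c \<in> I \<Longrightarrow> s c * x = x * s c"
  using s1[of c] by auto

lemma s_int: "c \<in> I \<Longrightarrow> s c \<in> PP 0"
  using s1[of c] by (auto simp: PP_minus)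

lemma s_not: "c \<in> I \<Longrightarrow> s c \<notin> PP 1"
  using s1[of c] by (auto simp: PP_iff w_one w_minus)

text \<open>It excludes fixed points of \<open>p\<close>, at which the sign \<open>s\<close> would
  equal its own negative.\<close>

lemma one_neq_minus_one: "(1::'d) \<noteq> - 1"
  using double_eq_0[of 1] by (auto simp: eq_neg_iff_add_eq_0)

lemma B_reindex: "B x y = (\<Sum>c\<in>I. x (p c) * s (p c) * y c)"
  unfolding B_def by (rule sum.reindex_bij_betw[OF bij_p, symmetric, THEN trans]) (auto simp: pp intro!: sum.cong)

text \<open>Reindexing by \<open>p\<close> exchanges the arguments and flips the signs; what remains
  are commutators, which vanish in the residue field.\<close>

lemma B_antisym:
  assumes "\<And>c. c \<in> I \<Longrightarrow> x c \<in> PP 0" "\<And>c. c \<in> I \<Longrightarrow> y c \<in> PP 0"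
  shows "B x y + B y x \<in> PP 1"
proof -
  have "B x y + B y x = (\<Sum>c\<in>I. s c * (x c * y (p c) - y (p c) * x c))"
    unfolding B_def[of x y] B_reindex[of y x] sum.distrib[symmetric]
  proof (rule sum.cong[OF refl])
    fix c assume c: "c \<in> I"
    have "x c * s c * y (p c) = s c * (x c * y (p c))" by (simp add: s_comm[OF c] mult.assoc)
    moreover have "y (p c) * s (p c) * x c = - (s c * (y (p c) * x c))"
      by (simp add: sp[OF c] s_comm[OF c] mult.assoc)
    ultimately show "x c * s c * y (p c) + y (p c) * s (p c) * x c = s c * (x c * y (p c) - y (p c) * x c)"
      by (simp add: right_diff_distrib)
  qed
  also have "\<dots> \<in> PP 1"
    using assms pI s_int by (intro PP_sum PP_mult_0_1 PP_commute) auto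
  finally show ?thesis .
qed

text \<open>Antisymmetry gives the claim for twice \<open>B x x\<close>, and 2 is a unit.\<close>

lemma B_alt:
  assumes "\<And>c. c \<in> I \<Longrightarrow> x c \<in> PP 0" shows "B x x \<in> PP 1"
proof -
  have "emb 2 * B x x \<in> PP 1"
    using B_antisym[of x x] assms emb_add[of 1 1] by (simp add: mult_2)
  moreover have "w (emb 2) = 0" "emb 2 \<noteq> 0" by (simp_all add: w_emb v_two)
  ultimately show ?thesis by (metis PP_mult_left_iff diff_zero)
qed

lemma B_sym_iff:
  assumes "\<And>c. c \<in> I \<Longrightarrow> x c \<in> PP 0" "\<And>c. c \<in> I \<Longrightarrow> y c \<in> PP 0"
  shows "B x y - t \<in> PP 1 \<longleftrightarrow> B y x + t \<in> PP 1"
proof -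
  have "(B x y - t) - (- (B y x + t)) \<in> PP 1" using B_antisym[OF assms] by simp
  moreover have "- z \<in> PP 1 \<longleftrightarrow> z \<in> PP 1" for z using PP_minus[of z 1] PP_minus[of "- z" 1] by auto
  ultimately show ?thesis using subgrp_diff_right[OF subgrp_PP] by metis
qed

lemma B_diff_sum:
  "finite J \<Longrightarrow> B x (\<lambda>c. y c - (\<Sum>b\<in>J. z b c * k b)) = B x y - (\<Sum>b\<in>J. B x (z b) * k b)"
  unfolding B_def
  by (simp add: right_diff_distrib sum_subtractf sum_distrib_left sum_distrib_right mult.assoc)
    (rule sum.swap)

lemma sympl_frames_int: "u \<in> sympl_frames J \<Longrightarrow> b \<in> J \<Longrightarrow> c \<in> I \<Longrightarrow> u b c \<in> PP 0"
  by (auto simp: sympl_frames_def PiE_iff intro: T_PP)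

text \<open>A symplectic frame is its own dual up to order and sign: the partner
  \<open>u (p b)\<close>, with the sign \<open>s b\<close>, is dual to the form given by
  \<open>u b\<close>.\<close>

lemma frame_dual_system:
  assumes J: "J \<subseteq> I" "\<And>b. b \<in> J \<Longrightarrow> p b \<in> J" and u: "u \<in> sympl_frames J"
  shows "dual_system v scale star \<O> \<P> \<pi> \<Theta> \<epsilon> I J (\<lambda>b c. u b (p c) * s (p c)) (\<lambda>b c. u (p b) c * s b)"
proof unfold_locales
  show "finite I" "finite J" using finI J finite_subset by auto
next
  fix b c assume bc: "b \<in> J" "c \<in> I"
  show "u b (p c) * s (p c) \<in> PP 0" using sympl_frames_int[OF u] bc pI s_int by (intro PP_mult_0_0) auto
  show "u (p b) c * s b \<in> PP 0" using sympl_frames_int[OF u] bc J s_int by (intro PP_mult_0_0) auto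
next
  fix b b' assume b: "b \<in> J" "b' \<in> J"
  have bI: "b \<in> I" "b' \<in> I" using b J by auto
  have "(\<Sum>c\<in>I. u b (p c) * s (p c) * (u (p b') c * s b')) = B (u b) (u (p b')) * s b'"
    unfolding B_reindex by (simp add: sum_distrib_right mult.assoc)
  moreover have "p b' = p b \<longleftrightarrow> b = b'" using pp[OF bI(1)] pp[OF bI(2)] by metis
  moreover have "(B (u b) (u (p b')) - (if p b' = p b then s b else 0)) * s b' \<in> PP 1"
    using u b J s_int[OF bI(2)] by (intro PP_mult_1_0) (auto simp: sympl_frames_def)
  ultimately show "(\<Sum>c\<in>I. u b (p c) * s (p c) * (u (p b') c * s b')) - (if b = b' then 1 else 0) \<in> PP 1"
    using s_square[OF bI(1)] by (cases "b = b'") (auto simp: left_diff_distrib)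
qed

definition orth :: "nat set \<Rightarrow> (nat \<Rightarrow> nat \<Rightarrow> 'd) \<Rightarrow> (nat \<Rightarrow> 'd) set" where
  "orth J u = {x \<in> vec I. \<forall>b\<in>J. B (u b) x \<in> PP 1}"

lemma card_orth:
  assumes J: "J \<subseteq> I" "\<And>b. b \<in> J \<Longrightarrow> p b \<in> J" and u: "u \<in> sympl_frames J"
  shows "card (orth J u) = residue_card v ^ (2 * (card I - card J))"
proof -
  interpret D: dual_system v scale star \<O> \<P> \<pi> \<Theta> \<epsilon> I J "\<lambda>b c. u b (p c) * s (p c)" "\<lambda>b c. u (p b) c * s b"
    by (rule frame_dual_system[OF J u])
  have "orth J u = D.V" by (simp add: orth_def D.V_def D.pr_def B_reindex)
  then show ?thesis using D.card_V' by simp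
qed

definition nonnull :: "(nat \<Rightarrow> 'd) \<Rightarrow> bool" where "nonnull x \<longleftrightarrow> (\<exists>c\<in>I. x c \<notin> PP 1)"

lemma card_orth_nonnull:
  assumes J: "J \<subseteq> I" "\<And>b. b \<in> J \<Longrightarrow> p b \<in> J" and u: "u \<in> sympl_frames J"
  shows "card {x \<in> orth J u. nonnull x} = residue_card v ^ (2 * (card I - card J)) - 1"
proof -
  define z where "z = (\<lambda>c\<in>I. rep (PP 1) 0)"
  have z1: "z c \<in> PP 1" if "c \<in> I" for c using rep_diff_PP(1)[of 0] that by (simp add: z_def)
  have zv: "z \<in> vec I" by (auto simp: z_def intro: rep_in_T)
  have "B (u b) z \<in> PP 1" if "b \<in> J" for b
    unfolding B_def using sympl_frames_int[OF u that] z1 pI s_int by (intro PP_sum PP_mult_0_1 PP_mult_0_0) auto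
  then have zo: "z \<in> orth J u" using zv by (simp add: orth_def)
  have "x = z" if "x \<in> vec I" "\<not> nonnull x" for x
  proof (rule vec_eqI[OF that(1) zv])
    fix c assume "c \<in> I"
    then show "x c - z c \<in> PP 1" using that(2) z1 by (intro PP_diff) (auto simp: nonnull_def)
  qed
  moreover have "\<not> nonnull z" using z1 by (simp add: nonnull_def)
  ultimately have "nonnull x \<longleftrightarrow> x \<noteq> z" if "x \<in> vec I" for x using that by blast
  then have "{x \<in> orth J u. nonnull x} = orth J u - {z}" unfolding orth_def by blast
  then show ?thesis using card_orth[OF J u] zo by (simp add: card_Diff_singleton)
qed

text \<open>The complement of a symplectic frame is nondegenerate, so the form \<open>B f\<close>
  does not vanish on it. Adjoining \<open>f\<close> and a vector dual to it under the new index
  \<open>r\<close> gives a dual system with one more form, and the set counted is a translate of its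
  kernel.\<close>

lemma card_partner:
  assumes J: "J \<subseteq> I" "\<And>b. b \<in> J \<Longrightarrow> p b \<in> J" and u: "u \<in> sympl_frames J"
    and f: "f \<in> orth J u" "nonnull f" and r: "r \<notin> J" and t: "t \<in> PP 0"
  shows "card {x \<in> orth J u. B f x - t \<in> PP 1} = residue_card v ^ (2 * (card I - card J - 1))"
proof -
  have finJ: "finite J" using J finI finite_subset by blast
  have fi: "f c \<in> PP 0" if "c \<in> I" for c using f(1) that by (auto simp: orth_def intro: T_PP)
  have ui: "u b c \<in> PP 0" if "b \<in> J" "c \<in> I" for b c by (rule sympl_frames_int[OF u that])
  obtain c0 where c0: "c0 \<in> I" "f c0 \<notin> PP 1" using f(2) by (auto simp: nonnull_def)
  have f0: "f c0 \<noteq> 0" using c0(2) by auto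
  \<comment> \<open>This vector is supported at the partner of a coordinate where \<open>f\<close>
    is a unit, and is scaled so that \<open>B f x0 = 1\<close>.\<close>
  define x0 where "x0 c = (if c = p c0 then s c0 * inverse (f c0) else 0)" for c
  define d where "d b c = u (p b) c * s b" for b c
  \<comment> \<open>The projection of \<open>x0\<close> to the complement of the frame. As
    \<open>f\<close> is orthogonal to the frame, the pairing with \<open>f\<close> is still 1 modulo
    \<open>PP 1\<close>.\<close>
  define dd where "dd c = x0 c - (\<Sum>b\<in>J. d b c * B (u b) x0)" for c
  have x0i: "x0 c \<in> PP 0" for c
    unfolding x0_def using s_int[OF c0(1)] PP_inverse[OF fi[OF c0(1)] c0(2)] by (auto intro: PP_mult_0_0)
  have Bi: "B x y \<in> PP 0" if "\<And>c. c \<in> I \<Longrightarrow> x c \<in> PP 0" "\<And>c. c \<in> I \<Longrightarrow> y c \<in> PP 0" for x y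
    unfolding B_def using that pI s_int by (intro PP_sum PP_mult_0_0) auto
  have di: "d b c \<in> PP 0" if "b \<in> J" "c \<in> I" for b c
    unfolding d_def using ui J that s_int by (intro PP_mult_0_0) auto
  have ddi: "dd c \<in> PP 0" if "c \<in> I" for c
    unfolding dd_def using di that x0i ui Bi by (intro PP_diff PP_sum PP_mult_0_0) auto
  have Bfx: "B f x0 = 1"
  proof -
    have "B f x0 = (\<Sum>c\<in>I. if c = c0 then f c0 * s c0 * (s c0 * inverse (f c0)) else 0)"
      unfolding B_def x0_def
    proof (rule sum.cong[OF refl])
      fix c assume "c \<in> I"
      then have "p c = p c0 \<longleftrightarrow> c = c0" using pp c0(1) by metis
      then show "f c * s c * (if p c = p c0 then s c0 * inverse (f c0) else 0) =
          (if c = c0 then f c0 * s c0 * (s c0 * inverse (f c0)) else 0)" by simp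
    qed
    also have "\<dots> = f c0 * (s c0 * s c0) * inverse (f c0)" using finI c0(1) by (simp add: mult.assoc)
    finally show ?thesis using s_square[OF c0(1)] f0 by simp
  qed
  interpret D: dual_system v scale star \<O> \<P> \<pi> \<Theta> \<epsilon> I J "\<lambda>b c. u b (p c) * s (p c)" "\<lambda>b c. u (p b) c * s b"
    by (rule frame_dual_system[OF J u])
  have dualB: "B (u b) (d b') - (if b = b' then 1 else 0) \<in> PP 1" if "b \<in> J" "b' \<in> J" for b b'
    using D.dual[OF that] by (simp add: B_reindex d_def)
  have fd: "B f (d b) \<in> PP 1" if b: "b \<in> J" for b
  proof -
    have "B (u (p b)) f \<in> PP 1" using f(1) J b by (simp add: orth_def)
    then have "B f (u (p b)) \<in> PP 1"
      using B_sym_iff[of f "u (p b)" 0] fi ui J b by simp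
    moreover have "B f (d b) = B f (u (p b)) * s b"
      unfolding B_def d_def by (simp add: sum_distrib_right mult.assoc)
    ultimately show ?thesis using s_int b J by (auto intro: PP_mult_1_0)
  qed
  have Bdd: "B y dd = B y x0 - (\<Sum>b\<in>J. B y (d b) * B (u b) x0)" for y
    unfolding dd_def by (rule B_diff_sum[OF finJ])
  have Bux: "B (u b) x0 \<in> PP 0" if "b \<in> J" for b using Bi ui that x0i by blast
  have fdd: "B f dd - 1 \<in> PP 1"
    unfolding Bdd Bfx using fd Bux by (auto intro!: PP_minus PP_sum PP_mult_1_0)
  have udd: "B (u b) dd \<in> PP 1" if b: "b \<in> J" for b
  proof -
    have "(\<Sum>b'\<in>J. B (u b) (d b') * B (u b') x0) - B (u b) x0 =
        (\<Sum>b'\<in>J. (B (u b) (d b') - (if b = b' then 1 else 0)) * B (u b') x0)"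
      using finJ b by (simp add: left_diff_distrib sum_subtractf if_distrib[of "\<lambda>x. x * _"] cong: if_cong)
    also have "\<dots> \<in> PP 1" using dualB[OF b] Bux by (intro PP_sum PP_mult_1_0) auto
    finally show ?thesis unfolding Bdd using subgrp_diff_commute[OF subgrp_PP] by blast
  qed
  define \<beta>2 where "\<beta>2 b c = (if b = r then f (p c) * s (p c) else u b (p c) * s (p c))" for b c
  define d2 where "d2 b = (if b = r then dd else d b)" for b
  have pr2: "(\<Sum>c\<in>I. \<beta>2 b c * y c) = B (if b = r then f else u b) y" for b y
    by (auto simp: \<beta>2_def B_reindex)
  have rJ: "b \<noteq> r" "r \<noteq> b" if "b \<in> J" for b using that r by auto
  interpret D2: dual_system v scale star \<O> \<P> \<pi> \<Theta> \<epsilon> I "insert r J" \<beta>2 d2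
  proof unfold_locales
    show "finite I" "finite (insert r J)" using finI finJ by auto
  next
    fix b c assume bc: "b \<in> insert r J" "c \<in> I"
    show "\<beta>2 b c \<in> PP 0" unfolding \<beta>2_def using bc fi ui pI s_int by (auto intro!: PP_mult_0_0)
    show "d2 b c \<in> PP 0" unfolding d2_def using bc ddi di by auto
  next
    fix b b' assume b: "b \<in> insert r J" "b' \<in> insert r J"
    show "(\<Sum>c\<in>I. \<beta>2 b c * d2 b' c) - (if b = b' then 1 else 0) \<in> PP 1"
      unfolding pr2 d2_def using b fdd udd fd dualB[of b b'] rJ by (cases "b = b'") auto
  qed
  have "{x \<in> orth J u. B f x - t \<in> PP 1} =
      {x \<in> vec I. \<forall>b\<in>insert r J. D2.pr b x - (if b = r then t else 0) \<in> PP 1}"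
    unfolding D2.pr_def pr2 orth_def using rJ by auto
  also have "card \<dots> = card D2.V" by (rule D2.card_pr_eq) (use t in auto)
  also have "\<dots> = residue_card v ^ (2 * (card I - card (insert r J)))" by (rule D2.card_V')
  finally show ?thesis using finJ r by simp
qed

text \<open>Antisymmetry matches each condition with the one for the exchanged pair, and alternation
  supplies the conditions on the diagonal. The conditions that remain describe the choice of a
  vector at \<open>p a\<close> in the complement, followed by that of its partner at
  \<open>a\<close>.\<close>

lemma sympl_frames_insert_pair:
  assumes J: "J \<subseteq> I" "\<And>b. b \<in> J \<Longrightarrow> p b \<in> J" and a: "a \<in> I" "a \<notin> J"
  shows "sympl_frames (insert a (insert (p a) J)) =
    {f \<in> insert a (insert (p a) J) \<rightarrow>\<^sub>E vec I.
      (restrict (restrict f (insert (p a) J)) J \<in> sympl_frames J \<and>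
        f (p a) \<in> orth J f) \<and>
      (f a \<in> orth J (restrict f (insert (p a) J)) \<and> B (f (p a)) (f a) - s (p a) \<in> PP 1)}"
    (is "_ = {f \<in> ?X. ?C f}")
proof -
  have pa: "p a \<in> I" "p a \<notin> J" "p a \<noteq> a" "p (p a) = a"
  proof -
    show "p a \<in> I" "p (p a) = a" using a pI pp by auto
    show "p a \<notin> J" using J(2)[of "p a"] a pp[OF a(1)] by auto
    show "p a \<noteq> a" using sp[OF a(1)] s1[OF a(1)] one_neq_minus_one by auto
  qed
  have ne: "b \<noteq> a" "b \<noteq> p a" "p b \<noteq> a" "p b \<noteq> p a" if "b \<in> J" for b
    using that J a pa pp[of b] pp[of a] by (metis subsetD)+
  have "(f \<in> sympl_frames (insert a (insert (p a) J))) \<longleftrightarrow> f \<in> ?X \<and> ?C f" for f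
  proof (cases "f \<in> ?X")
    case False then show ?thesis by (simp add: sympl_frames_def)
  next
    case X: True
    have fi: "f b c \<in> PP 0" if "b \<in> insert a (insert (p a) J)" "c \<in> I" for b c
      using X that by (auto simp: PiE_iff intro: T_PP)
    have fv: "f b \<in> vec I" if "b \<in> insert a (insert (p a) J)" for b using X that by (auto simp: PiE_iff)
    have rJ: "restrict (restrict f (insert (p a) J)) J = restrict f J" by (auto simp: restrict_def)
    let ?cond = "\<lambda>b b'. B (f b) (f b') - (if b' = p b then s b else 0) \<in> PP 1"
    have sym: "B (f b) (f b') \<in> PP 1 \<longleftrightarrow> B (f b') (f b) \<in> PP 1"
      if "b \<in> insert a (insert (p a) J)" "b' \<in> insert a (insert (p a) J)" for b b'
      using B_sym_iff[of "f b" "f b'" 0] fi that by simp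
    have alt: "B (f b) (f b) \<in> PP 1" if "b \<in> insert a (insert (p a) J)" for b
      using B_alt fi that by blast
    have asy: "B (f a) (f (p a)) - s a \<in> PP 1 \<longleftrightarrow> B (f (p a)) (f a) - s (p a) \<in> PP 1"
      using B_sym_iff[of "f a" "f (p a)" "s a"] fi by (simp add: sp[OF a(1)])
    have "f \<in> sympl_frames (insert a (insert (p a) J)) \<longleftrightarrow>
        (\<forall>b\<in>J. \<forall>b'\<in>J. ?cond b b') \<and> (\<forall>b\<in>J. ?cond b a \<and> ?cond b (p a) \<and> ?cond a b \<and> ?cond (p a) b)
        \<and> ?cond a a \<and> ?cond (p a) (p a) \<and> ?cond a (p a) \<and> ?cond (p a) a"
    proof -
      have "f \<in> sympl_frames (insert a (insert (p a) J)) \<longleftrightarrow>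
          (\<forall>b\<in>insert a (insert (p a) J). \<forall>b'\<in>insert a (insert (p a) J). ?cond b b')"
        using X unfolding sympl_frames_def by blast
      then show ?thesis by (simp only: ball_insert2)
    qed
    also have "\<dots> \<longleftrightarrow> (\<forall>b\<in>J. \<forall>b'\<in>J. ?cond b b') \<and>
        (\<forall>b\<in>J. B (f b) (f a) \<in> PP 1 \<and> B (f b) (f (p a)) \<in> PP 1) \<and> B (f (p a)) (f a) - s (p a) \<in> PP 1"
    proof -
      have 1: "?cond b a \<and> ?cond b (p a) \<and> ?cond a b \<and> ?cond (p a) b \<longleftrightarrow>
          B (f b) (f a) \<in> PP 1 \<and> B (f b) (f (p a)) \<in> PP 1" if "b \<in> J" for b
        using ne[OF that] pa(4) sym[of b a] sym[of b "p a"] that by auto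
      have 2: "?cond a a" "?cond (p a) (p a)" using alt pa by auto
      have 3: "?cond a (p a) \<longleftrightarrow> B (f (p a)) (f a) - s (p a) \<in> PP 1"
        "?cond (p a) a \<longleftrightarrow> B (f (p a)) (f a) - s (p a) \<in> PP 1" using asy pa(4) by auto
      show ?thesis using 1 2 3 by blast
    qed
    also have "\<dots> \<longleftrightarrow> ?C f"
    proof -
      have "restrict f J \<in> sympl_frames J \<longleftrightarrow> (\<forall>b\<in>J. \<forall>b'\<in>J. ?cond b b')"
        using fv by (auto simp: sympl_frames_def)
      then show ?thesis unfolding rJ orth_def using fv by auto
    qed
    finally show ?thesis using X by blast
  qed
  then show ?thesis by blast
qed

text \<open>The vector at \<open>p a\<close> is any nonzero vector of the complement, and its
  partner ranges over an affine hyperplane there. A zero vector has no partner, because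
  \<open>s (p a)\<close> is a unit.\<close>

lemma card_sympl_frames_insert_pair:
  assumes J: "J \<subseteq> I" "\<And>b. b \<in> J \<Longrightarrow> p b \<in> J" and a: "a \<in> I" "a \<notin> J"
  shows "card (sympl_frames (insert a (insert (p a) J))) =
    card (sympl_frames J) * ((residue_card v ^ (2 * (card I - card J)) - 1) * residue_card v ^ (2 * (card I - card J - 1)))"
proof -
  let ?J1 = "insert (p a) J"
  let ?K = "residue_card v ^ (2 * (card I - card J - 1))"
  have finJ: "finite J" "finite ?J1" using J finI finite_subset by auto
  have pa: "p a \<in> I" "p a \<notin> J" "p a \<noteq> a"
  proof -
    show "p a \<in> I" using a pI by auto
    show "p a \<notin> J" using J(2)[of "p a"] a pp[OF a(1)] by auto
    show "p a \<noteq> a" using sp[OF a(1)] s1[OF a(1)] one_neq_minus_one by auto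
  qed
  have aJ1: "a \<notin> ?J1" using a pa by auto
  let ?R = "\<lambda>u1. restrict u1 J \<in> sympl_frames J \<and> u1 (p a) \<in> orth J (restrict u1 J)"
  let ?S = "\<lambda>u1 x. x \<in> orth J u1 \<and> B (u1 (p a)) x - s (p a) \<in> PP 1"
  have orth_restrict: "orth J (restrict u J) = orth J u" for u by (simp add: orth_def)
  have orth_restrict1: "orth J (restrict u ?J1) = orth J u" for u by (simp add: orth_def)
  have "sympl_frames (insert a ?J1) = {f \<in> insert a ?J1 \<rightarrow>\<^sub>E vec I. ?R (restrict f ?J1) \<and> ?S (restrict f ?J1) (f a)}"
    by (subst sympl_frames_insert_pair[OF J a], assumption)
      (simp only: orth_restrict orth_restrict1 restrict_apply insertI1 if_True)
  then have "card (sympl_frames (insert a ?J1)) = (\<Sum>u1\<in>{u1 \<in> ?J1 \<rightarrow>\<^sub>E vec I. ?R u1}. card {x \<in> vec I. ?S u1 x})"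
    using card_PiE_insert[OF aJ1 finJ(2) finite_vec[OF finI], of ?R ?S] by simp
  also have "\<dots> = (\<Sum>u1\<in>{u1 \<in> ?J1 \<rightarrow>\<^sub>E vec I. ?R u1}. if nonnull (u1 (p a)) then ?K else 0)"
  proof (rule sum.cong[OF refl])
    fix u1 assume "u1 \<in> {u1 \<in> ?J1 \<rightarrow>\<^sub>E vec I. ?R u1}"
    then have u1: "restrict u1 J \<in> sympl_frames J" "u1 (p a) \<in> orth J (restrict u1 J)" by auto
    have e: "{x \<in> vec I. ?S u1 x} = {x \<in> orth J (restrict u1 J). B (u1 (p a)) x - s (p a) \<in> PP 1}"
      unfolding orth_restrict by (auto simp: orth_def)
    show "card {x \<in> vec I. ?S u1 x} = (if nonnull (u1 (p a)) then ?K else 0)"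
    proof (cases "nonnull (u1 (p a))")
      case True
      then show ?thesis unfolding e using card_partner[OF J u1 True a(2) s_int[OF pa(1)]] by simp
    next
      case False
      have "x \<notin> {x \<in> vec I. ?S u1 x}" for x
      proof
        assume "x \<in> {x \<in> vec I. ?S u1 x}"
        then have x: "x \<in> vec I" "B (u1 (p a)) x - s (p a) \<in> PP 1" by auto
        have "B (u1 (p a)) x \<in> PP 1"
          unfolding B_def using False vec_PP[OF x(1)] pI s_int
          by (intro PP_sum PP_mult_1_0) (auto simp: nonnull_def)
        then have "s (p a) \<in> PP 1" using subgrp_diff_right[OF subgrp_PP x(2)] by blast
        then show False using s_not[OF pa(1)] by simp
      qed
      then have em: "{x \<in> vec I. ?S u1 x} = {}" by blast
      show ?thesis unfolding em using False by simp
    qed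
  qed
  also have "\<dots> = card {u1 \<in> {u1 \<in> ?J1 \<rightarrow>\<^sub>E vec I. ?R u1}. nonnull (u1 (p a))} * ?K"
  proof -
    have "finite (?J1 \<rightarrow>\<^sub>E vec I)" using finJ finI finite_T by (auto intro!: finite_PiE)
    then show ?thesis by (simp add: sum.If_cases Int_def conj_ac)
  qed
  also have "{u1 \<in> {u1 \<in> ?J1 \<rightarrow>\<^sub>E vec I. ?R u1}. nonnull (u1 (p a))} =
      {f \<in> ?J1 \<rightarrow>\<^sub>E vec I. restrict f J \<in> sympl_frames J \<and> (f (p a) \<in> orth J (restrict f J) \<and> nonnull (f (p a)))}"
    by blast
  also have "card \<dots> = (\<Sum>u\<in>{u \<in> J \<rightarrow>\<^sub>E vec I. u \<in> sympl_frames J}. card {x \<in> vec I. x \<in> orth J u \<and> nonnull x})"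
    by (rule card_PiE_insert[OF pa(2) finJ(1) finite_vec[OF finI],
          of "\<lambda>u. u \<in> sympl_frames J" "\<lambda>u x. x \<in> orth J u \<and> nonnull x"])
  also have "{u \<in> J \<rightarrow>\<^sub>E vec I. u \<in> sympl_frames J} = sympl_frames J" by (auto simp: sympl_frames_def)
  also have "(\<Sum>u\<in>sympl_frames J. card {x \<in> vec I. x \<in> orth J u \<and> nonnull x}) =
      (\<Sum>u\<in>sympl_frames J. residue_card v ^ (2 * (card I - card J)) - 1)"
  proof (rule sum.cong[OF refl])
    fix u assume u: "u \<in> sympl_frames J"
    have "{x \<in> vec I. x \<in> orth J u \<and> nonnull x} = {x \<in> orth J u. nonnull x}" by (auto simp: orth_def)
    then show "card {x \<in> vec I. x \<in> orth J u \<and> nonnull x} = residue_card v ^ (2 * (card I - card J)) - 1"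
      using card_orth_nonnull[OF J u] by simp
  qed
  finally show ?thesis by simp
qed

text \<open>The set \<open>R\<close> contains only indices of sign 1, one from each of the pairs
  concerned, so enlarging \<open>R\<close> by one element adds exactly one new pair.\<close>

lemma card_sympl_frames_pairs:
  assumes "finite R" "R \<subseteq> I" "\<And>c. c \<in> R \<Longrightarrow> s c = 1"
  shows "card (R \<union> p ` R) = 2 * card R \<and> card (sympl_frames (R \<union> p ` R)) =
    (\<Prod>i<card R. (residue_card v ^ (2 * (card I - 2 * i)) - 1) * residue_card v ^ (2 * (card I - 2 * i - 1)))"
  using assms
proof (induction R rule: finite_induct)
  case empty
  have "sympl_frames {} = {\<lambda>_. undefined}" by (auto simp: sympl_frames_def)
  then show ?case by simp
next
  case (insert a R)
  let ?J = "R \<union> p ` R"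
  have a: "a \<in> I" "s a = 1" using insert.prems by auto
  have J: "?J \<subseteq> I" "\<And>b. b \<in> ?J \<Longrightarrow> p b \<in> ?J"
    using insert.prems pI pp by auto
  have neg: "s (p c) = - 1" if "c \<in> insert a R" for c using that insert.prems sp[of c] by auto
  have aJ: "a \<notin> ?J"
    using insert.hyps neg a one_neq_minus_one by auto
  have paJ: "p a \<notin> ?J" using J(2)[of "p a"] aJ pp[OF a(1)] by auto
  have apa: "a \<noteq> p a" using neg[of a] a one_neq_minus_one by auto
  have e: "insert a R \<union> p ` insert a R = insert a (insert (p a) ?J)" by auto
  have IH: "card ?J = 2 * card R" "card (sympl_frames ?J) =
    (\<Prod>i<card R. (residue_card v ^ (2 * (card I - 2 * i)) - 1) * residue_card v ^ (2 * (card I - 2 * i - 1)))"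
    using insert.IH insert.prems by auto
  have "card (insert a (insert (p a) ?J)) = 2 * card (insert a R)"
    using aJ paJ apa insert.hyps IH(1) by simp
  moreover have "card (sympl_frames (insert a (insert (p a) ?J))) = (\<Prod>i<card (insert a R).
      (residue_card v ^ (2 * (card I - 2 * i)) - 1) * residue_card v ^ (2 * (card I - 2 * i - 1)))"
    using card_sympl_frames_insert_pair[OF J a(1) aJ] IH insert.hyps by simp
  ultimately show ?case unfolding e by simp
qed

lemma card_sympl_frames:
  "card (sympl_frames I) = (\<Prod>i<card I div 2.
     (residue_card v ^ (2 * (card I - 2 * i)) - 1) * residue_card v ^ (2 * (card I - 2 * i - 1)))"
  and even_card_I: "even (card I)"
proof -
  define R where "R = {c \<in> I. s c = 1}"
  have R: "finite R" "R \<subseteq> I" "\<And>c. c \<in> R \<Longrightarrow> s c = 1" using finI by (auto simp: R_def)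
  have "R \<union> p ` R = I"
  proof (intro subset_antisym subsetI)
    fix c assume c: "c \<in> I"
    show "c \<in> R \<union> p ` R"
    proof (cases "s c = 1")
      case False
      then have "s (p c) = 1" using s1[OF c] sp[OF c] by auto
      then have "p c \<in> R" using c pI by (simp add: R_def)
      then show ?thesis using pp[OF c] by (metis UnCI imageI)
    qed (use c in \<open>simp add: R_def\<close>)
  qed (use pI in \<open>auto simp: R_def\<close>)
  then have c: "card I = 2 * card R" "card (sympl_frames I) = (\<Prod>i<card R.
     (residue_card v ^ (2 * (card I - 2 * i)) - 1) * residue_card v ^ (2 * (card I - 2 * i - 1)))"
    using card_sympl_frames_pairs[OF R] by auto
  show "even (card I)" using c(1) by simp
  show "card (sympl_frames I) = (\<Prod>i<card I div 2.
     (residue_card v ^ (2 * (card I - 2 * i)) - 1) * residue_card v ^ (2 * (card I - 2 * i - 1)))"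
    using c by simp
qed

end

section \<open>The density of the monomial form\<close>

lemma prod_reverse: "(\<Prod>i<m. g (m - i)) = (\<Prod>i=1..m. g (i::nat))"
  by (rule prod.reindex_bij_witness[of _ "\<lambda>i. m - i" "\<lambda>i. m - i"]) auto

lemma w_poly_Suc: "w_poly (Suc m) t = w_poly m t * (1 - t ^ Suc m)"
  by (simp add: w_poly_def)

lemma w_poly_0: "w_poly 0 t = 1"
  by (simp add: w_poly_def)

text \<open>Taking \<open>q ^ (2 * i)\<close> out of the factor with index \<open>i\<close> leaves
  \<open>1 - (- (1 / q)) ^ i\<close>.\<close>

lemma w_poly_unitary:
  fixes q :: real assumes "q \<noteq> 0"
  shows "(\<Prod>i=1..m. q ^ (2 * i) - (- q) ^ i) = q ^ (m * (m + 1)) * w_poly m (- (1 / q))"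
proof (induction m)
  case (Suc m)
  have *: "q ^ (2 * Suc m) * (- (1 / q)) ^ Suc m = (q * q * (- (1 / q))) ^ Suc m"
    by (simp only: power_mult power_mult_distrib power2_eq_square)
  have "q * q * (- (1 / q)) = - q" using assms by simp
  then have f: "q ^ (2 * Suc m) - (- q) ^ Suc m = q ^ (2 * Suc m) * (1 - (- (1 / q)) ^ Suc m)"
    by (simp only: right_diff_distrib * mult_1_right)
  have e: "Suc m * (Suc m + 1) = m * (m + 1) + 2 * Suc m" by (simp add: algebra_simps)
  have "(\<Prod>i=1..Suc m. q ^ (2 * i) - (- q) ^ i) =
      (\<Prod>i=1..m. q ^ (2 * i) - (- q) ^ i) * (q ^ (2 * Suc m) - (- q) ^ Suc m)" by simp
  also have "\<dots> = q ^ (Suc m * (Suc m + 1)) * w_poly (Suc m) (- (1 / q))"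
    unfolding Suc f e w_poly_Suc power_add by (simp only: mult_ac)
  finally show ?case .
qed (simp add: w_poly_0)

lemma w_poly_symplectic:
  fixes q :: real assumes "q \<noteq> 0"
  shows "(\<Prod>i=1..t. (q ^ (4 * i) - 1) * q ^ (4 * i - 2)) = q ^ (2 * t * (2 * t + 1)) * w_poly t (1 / q ^ 4)"
proof (induction t)
  case (Suc t)
  have f: "q ^ (4 * Suc t) - 1 = q ^ (4 * Suc t) * (1 - (1 / q ^ 4) ^ Suc t)"
    using assms by (simp only: power_mult power_one_over right_diff_distrib) simp
  have e: "2 * Suc t * (2 * Suc t + 1) = 2 * t * (2 * t + 1) + (4 * Suc t + (4 * Suc t - 2))"
    by (simp add: algebra_simps)
  have "(\<Prod>i=1..Suc t. (q ^ (4 * i) - 1) * q ^ (4 * i - 2)) =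
      (\<Prod>i=1..t. (q ^ (4 * i) - 1) * q ^ (4 * i - 2)) * ((q ^ (4 * Suc t) - 1) * q ^ (4 * Suc t - 2))" by simp
  also have "\<dots> = q ^ (2 * Suc t * (2 * Suc t + 1)) * w_poly (Suc t) (1 / q ^ 4)"
    unfolding Suc f e w_poly_Suc power_add by (simp only: mult_ac)
  finally show ?case .
qed (simp add: w_poly_0)

lemma sum_triangle_diff:
  fixes f f' :: "nat \<Rightarrow> int" and g g' :: "nat \<Rightarrow> nat \<Rightarrow> int"
  shows "(\<Sum>i<n. f i) + (\<Sum>j<n. \<Sum>i<j. g i j) - ((\<Sum>i<n. f' i) + (\<Sum>j<n. \<Sum>i<j. g' i j)) =
    (\<Sum>j<n. f j - f' j + (\<Sum>i<j. g i j - g' i j))"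
  by (simp add: sum.distrib sum_subtractf)

context padic_quaternion
begin

lemma card_herm_frames_self:
  assumes "finite I"
  shows "real (card (herm_frames I I)) = real q ^ (card I ^ 2) * w_poly (card I) (- (1 / real q))"
proof -
  have q: "real q \<noteq> 0" using residue_card_pos by (simp add: q_eq)
  have "real_of_int (int (residue_card v) ^ card I * int (card (herm_frames I I))) =
    (\<Prod>i<card I. real q ^ (2 * (card I - i)) - (- real q) ^ (card I - i))"
    unfolding card_herm_frames[OF assms assms] by (simp add: q_eq)
  then have "real q ^ card I * real (card (herm_frames I I)) =
    (\<Prod>i<card I. real q ^ (2 * (card I - i)) - (- real q) ^ (card I - i))"
    by (simp add: q_eq)
  also have "\<dots> = real q ^ (card I * (card I + 1)) * w_poly (card I) (- (1 / real q))"
    unfolding prod_reverse[of "\<lambda>i. real q ^ (2 * i) - (- real q) ^ i"] by (rule w_poly_unitary[OF q])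
  also have "\<dots> = real q ^ card I * (real q ^ (card I ^ 2) * w_poly (card I) (- (1 / real q)))"
    by (simp add: power_add power2_eq_square)
  finally show ?thesis using q by simp
qed

end

context alternating_form
begin

text \<open>The product over the pairs is reversed, so that its index becomes half the dimension of
  the complement still available.\<close>

lemma card_sympl_frames_self:
  "real (card (sympl_frames I)) = real q ^ (card I * (card I + 1)) * w_poly (card I div 2) (1 / real q ^ 4)"
proof -
  obtain t where t: "card I = 2 * t" using even_card_I by (elim evenE)
  have q: "real q \<noteq> 0" using residue_card_pos by (simp add: q_eq)
  have "real (card (sympl_frames I)) = (\<Prod>i<t. (real q ^ (4 * (t - i)) - 1) * real q ^ (4 * (t - i) - 2))"
    unfolding card_sympl_frames t of_nat_prod
  proof (rule prod.cong)
    fix i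
    have e: "2 * (2 * t - 2 * i) = 4 * (t - i)" "2 * (2 * t - 2 * i - 1) = 4 * (t - i) - 2" by auto
    have "1 \<le> residue_card v ^ (4 * (t - i))" using residue_card_pos by simp
    then show "real ((residue_card v ^ (2 * (2 * t - 2 * i)) - 1) * residue_card v ^ (2 * (2 * t - 2 * i - 1))) =
      (real q ^ (4 * (t - i)) - 1) * real q ^ (4 * (t - i) - 2)"
      unfolding e by (simp add: q_eq of_nat_diff)
  qed simp
  also have "\<dots> = real q ^ (2 * t * (2 * t + 1)) * w_poly t (1 / real q ^ 4)"
    unfolding prod_reverse[of "\<lambda>j. (real q ^ (4 * j) - 1) * real q ^ (4 * j - 2)"]
    by (rule w_poly_symplectic[OF q])
  finally show ?thesis by (simp add: t)
qed

end

context monomial_form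
begin

section \<open>Decomposition of the residue conditions into blocks\<close>

definition blkv :: "nat \<Rightarrow> nat set" where "blkv g = {c. c < n \<and> a c = g}"

text \<open>This is \<open>cond_entry\<close> with the columns of a block regarded as the vectors of
  a frame.\<close>

definition frame_entry :: "nat \<Rightarrow> (nat \<Rightarrow> nat \<Rightarrow> 'd) \<Rightarrow> nat \<Rightarrow> nat \<Rightarrow> 'd" where
  "frame_entry g u b b' =
    (if even g then (\<Sum>c\<in>blkv g. star (u b c) * u b' c) - (if b = b' then 1 else 0)
     else (\<Sum>c\<in>blkv g. u b c * s c * u b' (p c)) - (if b' = p b then s b else 0))"

definition block_frames :: "nat \<Rightarrow> (nat \<Rightarrow> nat \<Rightarrow> 'd) set" where
  "block_frames g = {u \<in> blkv g \<rightarrow>\<^sub>E vec (blkv g). \<forall>b\<in>blkv g. \<forall>b'\<in>blkv g. frame_entry g u b b' \<in> PP 1}"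

lemma finite_blkv: "finite (blkv g)"
  by (simp add: blkv_def)

lemma card_block_frames:
  "real (card (block_frames g)) =
    (if even g then real q ^ (card (blkv g) ^ 2) * w_poly (card (blkv g)) (- (1 / real q))
     else real q ^ (card (blkv g) * (card (blkv g) + 1)) * w_poly (card (blkv g) div 2) (1 / real q ^ 4))"
proof (cases "even g")
  case True
  then have "block_frames g = herm_frames (blkv g) (blkv g)" by (simp add: block_frames_def herm_frames_def frame_entry_def)
  then show ?thesis using True card_herm_frames_self[OF finite_blkv] by simp
next
  case False
  interpret F: alternating_form v scale star \<O> \<P> \<pi> \<Theta> \<epsilon> "blkv g" p s
    by unfold_locales (use False finite_blkv p_less a_p p_p s_unit p_odd in \<open>auto simp: blkv_def\<close>)
  have "block_frames g = F.sympl_frames (blkv g)" using False by (simp add: block_frames_def F.sympl_frames_def F.B_def frame_entry_def)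
  then show ?thesis using False F.card_sympl_frames_self by simp
qed

text \<open>The conditions in \<open>rescond\<close> relate only positions of the same block.
  Regrouping a residue matrix by blocks and columns with \<open>\<Phi>\<close>, and back with
  \<open>\<Psi>\<close>, is therefore a bijection onto the product of the sets of frames.\<close>

lemma card_G0: "card G0 = (\<Prod>g\<in>a ` {..<n}. card (block_frames g))"
proof -
  define \<Phi> where "\<Phi> f = (\<lambda>g\<in>a ` {..<n}. \<lambda>j\<in>blkv g. \<lambda>c\<in>blkv g. f (c, j))" for f :: "nat \<times> nat \<Rightarrow> 'd"
  define \<Psi> where "\<Psi> U = (\<lambda>x\<in>SB. U (a (snd x)) (snd x) (fst x))" for U :: "nat \<Rightarrow> nat \<Rightarrow> nat \<Rightarrow> 'd"
  have fe: "frame_entry (a i) (\<Phi> f (a i)) i j = cond_entry f i j" if "(i, j) \<in> SB" for f i j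
  proof -
    have ij: "i < n" "j < n" "a j = a i" using that by (auto simp: SB_def)
    have b: "blk i = blkv (a i)" by (simp add: blk_def blkv_def)
    have mem: "i \<in> blkv (a i)" "j \<in> blkv (a i)" using ij by (auto simp: blkv_def)
    have pm: "p c \<in> blkv (a i)" if "c \<in> blkv (a i)" for c using that by (auto simp: blkv_def p_less a_p)
    have val: "\<Phi> f (a i) k c = f (c, k)" if "k \<in> blkv (a i)" "c \<in> blkv (a i)" for k c
      using that ij(1) by (simp add: \<Phi>_def)
    show ?thesis
      unfolding frame_entry_def cond_entry_def b using mem pm by (simp add: val cong: sum.cong)
  qed
  have SBI: "(c, j) \<in> SB \<longleftrightarrow> j < n \<and> c \<in> blkv (a j)" for c j by (auto simp: SB_def blkv_def)
  have \<Psi>\<Phi>: "\<Psi> (\<Phi> f) = f" if "f \<in> SB \<rightarrow>\<^sub>E T" for f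
  proof (rule extensionalityI[of _ SB])
    fix x assume "x \<in> SB"
    then show "\<Psi> (\<Phi> f) x = f x" by (cases x) (auto simp: \<Psi>_def \<Phi>_def SB_def blkv_def)
  qed (use that in \<open>auto simp: \<Psi>_def PiE_iff\<close>)
  have \<Phi>\<Psi>: "\<Phi> (\<Psi> U) = U" if U: "U \<in> Pi\<^sub>E (a ` {..<n}) block_frames" for U
  proof (rule extensionalityI[of _ "a ` {..<n}"])
    fix g assume g: "g \<in> a ` {..<n}"
    then have "U g \<in> block_frames g" using U by blast
    then have Ug: "U g \<in> blkv g \<rightarrow>\<^sub>E vec (blkv g)" by (simp add: block_frames_def)
    have "\<Phi> (\<Psi> U) g j = U g j" if j: "j \<in> blkv g" for j
    proof (rule extensionalityI[of _ "blkv g"])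
      fix c assume "c \<in> blkv g"
      then show "\<Phi> (\<Psi> U) g j c = U g j c"
        using j g by (auto simp: \<Phi>_def \<Psi>_def SB_def blkv_def)
    qed (use g j Ug in \<open>auto simp: \<Phi>_def PiE_iff\<close>)
    then show "\<Phi> (\<Psi> U) g = U g"
      using g Ug by (intro extensionalityI[of _ "blkv g"]) (auto simp: \<Phi>_def PiE_iff)
  qed (use U in \<open>auto simp: \<Phi>_def PiE_iff\<close>)
  have "bij_betw \<Phi> G0 (Pi\<^sub>E (a ` {..<n}) block_frames)"
  proof (rule bij_betw_byWitness[where f' = \<Psi>])
    show "\<forall>f\<in>G0. \<Psi> (\<Phi> f) = f" using \<Psi>\<Phi> by (simp add: G0_def)
    show "\<forall>U\<in>Pi\<^sub>E (a ` {..<n}) block_frames. \<Phi> (\<Psi> U) = U" using \<Phi>\<Psi> by blast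
    show "\<Phi> ` G0 \<subseteq> Pi\<^sub>E (a ` {..<n}) block_frames"
    proof (rule image_subsetI)
      fix f assume f: "f \<in> G0"
      have "\<Phi> f g \<in> block_frames g" if g: "g \<in> a ` {..<n}" for g
      proof -
        have "\<Phi> f g \<in> blkv g \<rightarrow>\<^sub>E vec (blkv g)"
          using f g by (auto simp: \<Phi>_def G0_def PiE_iff SB_def blkv_def)
        moreover have "frame_entry g (\<Phi> f g) b b' \<in> PP 1" if "b \<in> blkv g" "b' \<in> blkv g" for b b'
        proof -
          have b: "(b, b') \<in> SB" "a b = g" using that by (auto simp: blkv_def SB_def)
          have "cond_entry f b b' \<in> PP 1" using f b(1) by (auto simp: G0_def rescond_def)
          then show ?thesis using fe[OF b(1), of f] b(2) by simp
        qed
        ultimately show ?thesis by (simp add: block_frames_def)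
      qed
      then show "\<Phi> f \<in> Pi\<^sub>E (a ` {..<n}) block_frames" by (auto simp: \<Phi>_def PiE_iff)
    qed
    show "\<Psi> ` Pi\<^sub>E (a ` {..<n}) block_frames \<subseteq> G0"
    proof (rule image_subsetI)
      fix U assume U: "U \<in> Pi\<^sub>E (a ` {..<n}) block_frames"
      have "\<Psi> U x \<in> T" if x: "x \<in> SB" for x
      proof -
        obtain c j where cj: "x = (c, j)" "j < n" "c < n" "a c = a j" using x by (auto simp: SB_def)
        have "U (a j) \<in> block_frames (a j)" using U cj by auto
        then show ?thesis using cj x by (auto simp: block_frames_def \<Psi>_def PiE_iff blkv_def)
      qed
      then have 1: "\<Psi> U \<in> SB \<rightarrow>\<^sub>E T" by (auto simp: \<Psi>_def)
      have "cond_entry (\<Psi> U) i j \<in> PP 1" if ij: "(i, j) \<in> SB" for i j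
      proof -
        have "U (a i) \<in> block_frames (a i)" "i \<in> blkv (a i)" "j \<in> blkv (a i)"
          using U ij by (auto simp: SB_def blkv_def)
        then have "frame_entry (a i) (U (a i)) i j \<in> PP 1" by (simp add: block_frames_def)
        then show ?thesis using fe[OF ij, of "\<Psi> U"] \<Phi>\<Psi>[OF U] by simp
      qed
      then show "\<Psi> U \<in> G0" using 1 by (auto simp: G0_def rescond_def)
    qed
  qed
  then have "card G0 = card (Pi\<^sub>E (a ` {..<n}) block_frames)" by (rule bij_betw_same_card)
  then show ?thesis by (simp add: card_PiE)
qed

definition c_fac :: "nat \<Rightarrow> real" where
  "c_fac g = (if even g then w_poly (card (blkv g)) (- (1 / real q)) else w_poly (card (blkv g) div 2) (1 / real q ^ 4))"

lemma card_blkv_sum: "(\<Sum>g\<in>a ` {..<n}. card (blkv g) ^ 2) = card SB"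
  and odd_blkv_sum: "(\<Sum>g\<in>a ` {..<n}. if even g then 0 else card (blkv g)) = card {i. i < n \<and> odd (a i)}"
proof -
  have disj: "g \<noteq> g' \<Longrightarrow> blkv g \<inter> blkv g' = {}" for g g' by (auto simp: blkv_def)
  have "SB = (\<Union>g\<in>a ` {..<n}. blkv g \<times> blkv g)" by (auto simp: SB_def blkv_def)
  moreover have "card (\<Union>g\<in>a ` {..<n}. blkv g \<times> blkv g) = (\<Sum>g\<in>a ` {..<n}. card (blkv g \<times> blkv g))"
    by (rule card_UN_disjoint) (use disj finite_blkv in auto)
  ultimately show "(\<Sum>g\<in>a ` {..<n}. card (blkv g) ^ 2) = card SB"
    by (simp add: card_cartesian_product power2_eq_square)
  have "{i. i < n \<and> odd (a i)} = (\<Union>g\<in>a ` {..<n}. if even g then {} else blkv g)"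
    by (auto simp: blkv_def)
  moreover have "card (\<Union>g\<in>a ` {..<n}. if even g then {} else blkv g) =
      (\<Sum>g\<in>a ` {..<n}. card (if even g then {} else blkv g))"
    by (rule card_UN_disjoint) (use disj finite_blkv in auto)
  ultimately show "(\<Sum>g\<in>a ` {..<n}. if even g then 0 else card (blkv g)) = card {i. i < n \<and> odd (a i)}"
    by (simp add: if_distrib[of card] cong: if_cong)
qed

text \<open>A block of size \<open>m\<close> contributes the exponent \<open>m^2\<close>, in total
  \<open>card SB\<close>, and a further \<open>m\<close> if its exponent is odd, in total the number
  of odd exponents.\<close>

lemma real_card_G0:
  "real (card G0) = real q ^ (card SB + card {i. i < n \<and> odd (a i)}) * (\<Prod>g\<in>a ` {..<n}. c_fac g)"
proof -
  have "real (card G0) = (\<Prod>g\<in>a ` {..<n}. real q ^ (card (blkv g) ^ 2 + (if even g then 0 else card (blkv g))) * c_fac g)"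
    unfolding card_G0 of_nat_prod
    by (intro prod.cong refl) (auto simp: card_block_frames c_fac_def power_add power2_eq_square)
  also have "\<dots> = real q ^ (\<Sum>g\<in>a ` {..<n}. card (blkv g) ^ 2 + (if even g then 0 else card (blkv g)))
      * (\<Prod>g\<in>a ` {..<n}. c_fac g)"
    by (simp add: prod.distrib power_sum)
  also have "(\<Sum>g\<in>a ` {..<n}. card (blkv g) ^ 2 + (if even g then 0 else card (blkv g))) =
      card SB + card {i. i < n \<and> odd (a i)}"
    by (simp only: sum.distrib card_blkv_sum odd_blkv_sum)
  finally show ?thesis .
qed

lemma sum_triangle: "(\<Sum>(i, j)\<in>{(i, j). i < j \<and> j < n}. f i j) = (\<Sum>j<n. \<Sum>i<j. f i j)"
  for f :: "nat \<Rightarrow> nat \<Rightarrow> int"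
  unfolding sum.Sigma[of "{..<n}" "\<lambda>j. {..<j}", simplified]
  by (rule sum.reindex_bij_witness[of _ "\<lambda>(j, i). (i, j)" "\<lambda>(i, j). (j, i)"]) auto

lemma sum_square_split:
  fixes f :: "nat \<times> nat \<Rightarrow> int"
  shows "(\<Sum>x\<in>{..<n} \<times> {..<n}. f x) = (\<Sum>i<n. f (i, i)) + (\<Sum>j<n. \<Sum>i<j. f (i, j) + f (j, i))"
proof -
  let ?L = "{(i, j). i < j \<and> j < n}" and ?M = "{(i, j). j < i \<and> i < n}" and ?D = "(\<lambda>i. (i, i)) ` {..<n}"
  have fin: "finite ?L" "finite ?M" by (rule finite_subset[of _ "{..<n} \<times> {..<n}"]; auto)+
  have 1: "{..<n} \<times> {..<n} = ?D \<union> (?L \<union> ?M)" by auto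
  have 2: "sum f (?D \<union> (?L \<union> ?M)) = sum f ?D + sum f (?L \<union> ?M)"
    by (rule sum.union_disjoint) (use fin in auto)
  have "sum f (?L \<union> ?M) = sum f ?L + sum f ?M"
    by (rule sum.union_disjoint) (use fin in auto)
  then have "sum f ({..<n} \<times> {..<n}) = sum f ?D + (sum f ?L + sum f ?M)" unfolding 1 2 by simp
  moreover have "sum f ?D = (\<Sum>i<n. f (i, i))" by (subst sum.reindex) (auto simp: inj_on_def)
  moreover have "sum f ?M = (\<Sum>(i, j)\<in>?L. f (j, i))"
    by (rule sum.reindex_bij_witness[of _ "\<lambda>(i, j). (j, i)" "\<lambda>(i, j). (j, i)"]) auto
  moreover have "sum f ?L = (\<Sum>(i, j)\<in>?L. f (i, j))" by (simp add: split_beta)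
  ultimately show ?thesis by (simp only: sum_triangle sum.distrib)
qed

lemma card_SB: "int (card SB) = (\<Sum>x\<in>{..<n} \<times> {..<n}. if x \<in> SB then 1 else 0)"
proof -
  have "{..<n} \<times> {..<n} \<inter> SB = SB" by (auto simp: SB_def)
  then show ?thesis by (simp add: sum.If_cases)
qed

section \<open>The exponent of \<open>q\<close> and the limit\<close>

definition exp_Gam :: "int \<Rightarrow> int" where
  "exp_Gam m = (\<Sum>x\<in>{..<n} \<times> {..<n}. 2 * (m - off_val x))"

definition exp_Herm :: "int \<Rightarrow> int" where
  "exp_Herm k = (\<Sum>(i, j)\<in>{(i, j). i \<le> j \<and> j < n}.
     if i = j then (k + 1) div 2 - (int (a i) + 2) div 2 else 2 * (k - e_herm i j))"

text \<open>For \<open>i < j\<close> the lattice of \<open>Gam\<close> costs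
  \<open>2 * (a i - a j)\<close> at one of the two positions, and dividing by the forms gives back
  \<open>2 * a i\<close>. Each pair leaves \<open>4 * l + 2 + 2 * a j\<close>, also when the two
  exponents are equal. As \<open>j\<close> has \<open>j\<close> predecessors, summation produces the
  weighted sum of the exponents.\<close>

lemma exponent_identity:
  assumes sorted: "\<And>i j. i \<le> j \<Longrightarrow> j < n \<Longrightarrow> a j \<le> a i"
  shows "int (card SB) + exp_Gam (2 * l) - exp_Herm (2 * l - 1) =
    l * int n * (2 * int n + 1) + int n * (int n - 1)
    + 2 * (\<Sum>j<n. int j * int (a j)) + (\<Sum>j<n. int (a j) div 2)"
proof -
  let ?U = "{(i, j). i \<le> j \<and> j < n}" and ?L = "{(i, j). i < j \<and> j < n}" and ?D = "(\<lambda>i. (i, i)) ` {..<n}"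
  have fin: "finite ?L" by (rule finite_subset[of _ "{..<n} \<times> {..<n}"]) auto
  have U: "?U = ?D \<union> ?L" by auto
  have H: "exp_Herm (2 * l - 1) = (\<Sum>i<n. l - 1 - int (a i) div 2)
      + (\<Sum>j<n. \<Sum>i<j. 2 * (2 * l - 1 - e_herm i j))"
  proof -
    define h where "h = (\<lambda>(i, j). if i = j then (2 * l - 1 + 1) div 2 - (int (a i) + 2) div 2
      else 2 * (2 * l - 1 - e_herm i j))"
    have "exp_Herm (2 * l - 1) = sum h ?D + sum h ?L"
      unfolding exp_Herm_def h_def[symmetric] U by (rule sum.union_disjoint) (use fin in auto)
    moreover have "sum h ?D = (\<Sum>i<n. l - 1 - int (a i) div 2)"
      by (subst sum.reindex) (auto simp: inj_on_def h_def intro!: sum.cong)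
    moreover have "sum h ?L = (\<Sum>(i, j)\<in>?L. 2 * (2 * l - 1 - e_herm i j))"
      by (rule sum.cong) (auto simp: h_def)
    ultimately show ?thesis by (simp only: sum_triangle)
  qed
  have G: "int (card SB) + exp_Gam (2 * l) = (\<Sum>i<n. 4 * l - 1) + (\<Sum>j<n. \<Sum>i<j.
      2 * (if a i = a j then 1 else 0) + 8 * l - 2 * (off_val (i, j) + off_val (j, i)))"
  proof -
    have "int (card SB) + exp_Gam (2 * l) =
        (\<Sum>x\<in>{..<n} \<times> {..<n}. (if x \<in> SB then 1 else 0) + 2 * (2 * l - off_val x))"
      by (simp add: card_SB exp_Gam_def sum.distrib)
    also have "\<dots> = (\<Sum>i<n. 4 * l - 1) + (\<Sum>j<n. \<Sum>i<j.
      2 * (if a i = a j then 1 else 0) + 8 * l - 2 * (off_val (i, j) + off_val (j, i)))"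
      unfolding sum_square_split
      by (intro arg_cong2[where f = "(+)"] sum.cong refl) (auto simp: SB_def off_val_def)
    finally show ?thesis .
  qed
  have "int (card SB) + exp_Gam (2 * l) - exp_Herm (2 * l - 1) =
      (\<Sum>j<n. (4 * l - 1) - (l - 1 - int (a j) div 2) + (\<Sum>i<j.
        (2 * (if a i = a j then 1 else 0) + 8 * l - 2 * (off_val (i, j) + off_val (j, i)))
        - 2 * (2 * l - 1 - e_herm i j)))"
    unfolding G H by (rule sum_triangle_diff)
  also have "\<dots> = (\<Sum>j<n. 3 * l + int (a j) div 2 + int j * (4 * l + 2 + 2 * int (a j)))"
  proof (rule sum.cong[OF refl])
    fix j assume j: "j \<in> {..<n}"
    have "(\<Sum>i<j. (2 * (if a i = a j then 1 else 0) + 8 * l - 2 * (off_val (i, j) + off_val (j, i)))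
        - 2 * (2 * l - 1 - e_herm i j)) = (\<Sum>i<j. 4 * l + 2 + 2 * int (a j))"
    proof (rule sum.cong[OF refl])
      fix i assume "i \<in> {..<j}"
      then have "i < n" "j < n" "a j \<le> a i" using j sorted[of i j] by auto
      then show "(2 * (if a i = a j then 1 else 0) + 8 * l - 2 * (off_val (i, j) + off_val (j, i)))
        - 2 * (2 * l - 1 - e_herm i j) = 4 * l + 2 + 2 * int (a j)"
        by (cases "a i = a j") (auto simp: SB_def off_val_def e_herm_def)
    qed
    then show "(4 * l - 1) - (l - 1 - int (a j) div 2) + (\<Sum>i<j.
        (2 * (if a i = a j then 1 else 0) + 8 * l - 2 * (off_val (i, j) + off_val (j, i)))
        - 2 * (2 * l - 1 - e_herm i j)) = 3 * l + int (a j) div 2 + int j * (4 * l + 2 + 2 * int (a j))"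
      by simp
  qed
  also have "\<dots> = 3 * l * int n + (\<Sum>j<n. int (a j) div 2) + (\<Sum>j<n. int j * (4 * l + 2)) + 2 * (\<Sum>j<n. int j * int (a j))"
    by (simp add: sum.distrib distrib_left sum_distrib_left mult_ac)
  also have "(\<Sum>j<n. int j * (4 * l + 2)) = int n * (int n - 1) * (2 * l + 1)"
    by (induction n) (simp_all add: algebra_simps)
  finally show ?thesis by (simp add: algebra_simps)
qed

text \<open>The multiples of \<open>l\<close> in \<open>exponent_identity\<close> cancel against the
  normalising power of \<open>q\<close>, so the quotient is constant from \<open>l = am + 1\<close>
  on. This bound on \<open>l\<close> gives \<open>2 * l - 1 \<ge> 2 * am + 1\<close>, as
  \<open>card_Gam\<close> requires.\<close>

lemma N_sol_formula:
  assumes sorted: "\<And>i j. i \<le> j \<Longrightarrow> j < n \<Longrightarrow> a j \<le> a i" and l: "am + 1 \<le> int l" and n: "1 \<le> n"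
  shows "real (N_sol n n l A A) / real q ^ (l * n * (4*n - 2*n + 1) + n * (n - 1)) =
    real q powr (2 * (\<Sum>j<n. real j * real (a j)) + (\<Sum>j<n. real_of_int (int (a j) div 2))
      + real (card {i. i < n \<and> odd (a i)})) * (\<Prod>g\<in>a ` {..<n}. c_fac g)"
proof -
  let ?q = "real q"
  have q: "?q > 0" using residue_card_pos by (simp add: q_eq)
  have l1: "1 \<le> l" using l am_nonneg by simp
  have pw: "?q ^ nat z = ?q powr real_of_int z" if "0 \<le> z" for z
    using that q by (simp add: powr_realpow[symmetric])
  have Gam: "real (card (code (2 * int l) ` Gam)) = real (card G0) * ?q powr real_of_int (exp_Gam (2 * int l))"
  proof -
    have "real (\<Prod>x\<in>{..<n} \<times> {..<n}. residue_card v ^ (2 * nat (2 * int l - off_val x))) =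
        (\<Prod>x\<in>{..<n} \<times> {..<n}. ?q powr real_of_int (2 * (2 * int l - off_val x)))"
      unfolding of_nat_prod
    proof (rule prod.cong[OF refl])
      fix x assume x: "x \<in> {..<n} \<times> {..<n}"
      have "off_val x \<le> 2 * int l" using x l am_nonneg am_ge[of "snd x"] by (auto simp: off_val_def)
      moreover then have "2 * nat (2 * int l - off_val x) = nat (2 * (2 * int l - off_val x))" by simp
      ultimately show "real (residue_card v ^ (2 * nat (2 * int l - off_val x))) =
          ?q powr real_of_int (2 * (2 * int l - off_val x))"
        using pw[of "2 * (2 * int l - off_val x)"] by (simp add: q_eq)
    qed
    also have "\<dots> = ?q powr real_of_int (exp_Gam (2 * int l))"
      using q by (simp add: exp_Gam_def powr_sum)
    finally show ?thesis using card_code_Gam[of "2 * int l"] l am_nonneg by simp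
  qed
  have Herm: "real (card (code (2 * int l - 1) ` Herm)) = ?q powr real_of_int (exp_Herm (2 * int l - 1))"
  proof -
    let ?k = "2 * int l - 1" and ?U = "{(i, j). i \<le> j \<and> j < n}"
    let ?e = "\<lambda>(i, j). if i = j then (?k + 1) div 2 - (int (a i) + 2) div 2 else 2 * (?k - e_herm i j)"
    have "real (card (code ?k ` Herm)) = (\<Prod>x\<in>?U. ?q powr real_of_int (?e x))"
    proof -
      have "am + 1 \<le> ?k" using l am_nonneg by simp
      from card_code_Herm[OF this] show ?thesis
        unfolding of_nat_prod
      proof (simp only: of_nat_prod, intro prod.cong refl)
        fix x assume "x \<in> ?U"
        then obtain i j where x: "x = (i, j)" "i \<le> j" "j < n" by auto
        have b: "int (a i) + 2 \<le> 2 * int l" "e_herm i j \<le> ?k"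
          using am_ge[of i] am_ge[of j] x l am_nonneg by (auto simp: e_herm_def)
        have "(int (a i) + 2) div 2 \<le> (2 * int l) div 2" using b(1) by (rule zdiv_mono1) simp
        moreover have "2 * nat (?k - e_herm i j) = nat (2 * (?k - e_herm i j))" using b by simp
        ultimately show "real (case x of (i, j) \<Rightarrow>
            if i = j then residue_card v ^ nat ((?k + 1) div 2 - (int (a i) + 2) div 2)
            else residue_card v ^ (2 * nat (?k - e_herm i j))) = ?q powr real_of_int (?e x)"
          using b pw[of "(?k + 1) div 2 - (int (a i) + 2) div 2"] pw[of "2 * (?k - e_herm i j)"]
          by (cases "i = j") (simp_all add: x(1) q_eq)
      qed
    qed
    also have "\<dots> = ?q powr (\<Sum>x\<in>?U. real_of_int (?e x))" using q by (simp add: powr_sum)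
    also have "(\<Sum>x\<in>?U. real_of_int (?e x)) = real_of_int (exp_Herm ?k)"
      unfolding exp_Herm_def of_int_sum by (rule sum.cong) auto
    finally show ?thesis .
  qed
  have "card (code (2 * int l) ` Gam) = card (code (2 * int l - 1) ` Herm) * N_sol n n l A A"
    unfolding N_sol_eq[OF l1] using l am_nonneg by (intro card_Gam) auto
  then have "real (card G0) * ?q powr real_of_int (exp_Gam (2 * int l)) =
      ?q powr real_of_int (exp_Herm (2 * int l - 1)) * real (N_sol n n l A A)"
    unfolding Gam[symmetric] Herm[symmetric] by simp
  then have N: "real (N_sol n n l A A) =
      real (card G0) * ?q powr (real_of_int (exp_Gam (2 * int l)) - real_of_int (exp_Herm (2 * int l - 1)))"
    using q by (simp add: powr_diff field_simps)
  let ?D = "l * n * (4*n - 2*n + 1) + n * (n - 1)" and ?o = "card {i. i < n \<and> odd (a i)}"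
  have D: "int ?D = int l * int n * (2 * int n + 1) + int n * (int n - 1)"
  proof -
    have "4*n - 2*n + 1 = 2*n + 1" by simp
    then show ?thesis
      by (simp only: of_nat_add of_nat_mult of_nat_diff[OF n] of_nat_1 of_nat_numeral)
  qed
  have "real (N_sol n n l A A) / ?q ^ ?D =
      ?q powr (real (card SB + ?o) + (real_of_int (exp_Gam (2 * int l)) - real_of_int (exp_Herm (2 * int l - 1)))
        - real ?D) * (\<Prod>g\<in>a ` {..<n}. c_fac g)"
    unfolding N real_card_G0 using q
    by (simp add: powr_realpow[symmetric] powr_add powr_diff del: of_nat_add)
  also have "real (card SB + ?o) + (real_of_int (exp_Gam (2 * int l)) - real_of_int (exp_Herm (2 * int l - 1)))
        - real ?D = real_of_int (int (card SB) + exp_Gam (2 * int l) - exp_Herm (2 * int l - 1) - int ?D) + real ?o"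
    by simp
  also have "int (card SB) + exp_Gam (2 * int l) - exp_Herm (2 * int l - 1) - int ?D =
      2 * (\<Sum>j<n. int j * int (a j)) + (\<Sum>j<n. int (a j) div 2)"
  proof -
    have "int (card SB) + exp_Gam (2 * int l) - exp_Herm (2 * int l - 1) =
      int l * int n * (2 * int n + 1) + int n * (int n - 1)
      + 2 * (\<Sum>j<n. int j * int (a j)) + (\<Sum>j<n. int (a j) div 2)"
      by (rule exponent_identity) (rule sorted)
    then show ?thesis unfolding D by simp
  qed
  finally show ?thesis by simp
qed

lemma density_int_formula:
  assumes sorted: "\<And>i j. i \<le> j \<Longrightarrow> j < n \<Longrightarrow> a j \<le> a i" and n: "1 \<le> n"
  shows "density_int n n A A =
    real q powr (2 * (\<Sum>j<n. real j * real (a j)) + (\<Sum>j<n. real_of_int (int (a j) div 2))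
      + real (card {i. i < n \<and> odd (a i)})) * (\<Prod>g\<in>a ` {..<n}. c_fac g)"
  unfolding density_int_def
proof (intro limI tendsto_eventually)
  show "\<forall>\<^sub>F l in sequentially. real (N_sol n n l A A) / real q ^ (l * n * (4*n - 2*n + 1) + n * (n - 1)) =
    real q powr (2 * (\<Sum>j<n. real j * real (a j)) + (\<Sum>j<n. real_of_int (int (a j) div 2))
      + real (card {i. i < n \<and> odd (a i)})) * (\<Prod>g\<in>a ` {..<n}. c_fac g)"
  proof (rule eventually_mono[OF eventually_ge_at_top[of "nat (am + 1)"]])
    fix l assume "nat (am + 1) \<le> l"
    then have l: "am + 1 \<le> int l" by linarith
    show "real (N_sol n n l A A) / real q ^ (l * n * (4*n - 2*n + 1) + n * (n - 1)) =
      real q powr (2 * (\<Sum>j<n. real j * real (a j)) + (\<Sum>j<n. real_of_int (int (a j) div 2))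
        + real (card {i. i < n \<and> odd (a i)})) * (\<Prod>g\<in>a ` {..<n}. c_fac g)"
      by (rule N_sol_formula[OF sorted l n])
  qed
qed

end

section \<open>Block-diagonal forms\<close>

lemma count_list_replicate: "count_list (replicate l x) y = (if x = y then l else 0)"
  by (induction l) auto

lemma count_list_concat_replicate:
  "distinct (map g js) \<Longrightarrow> j \<in> set js \<Longrightarrow>
    count_list (concat (map (\<lambda>j. replicate (k j) (g j)) js)) (g j) = k j"
proof (induction js)
  case (Cons i js)
  note rep = count_list_replicate
  show ?case
  proof (cases "j = i")
    case True
    have "g i \<notin> set (concat (map (\<lambda>j. replicate (k j) (g j)) js))" using Cons.prems(1) by auto
    then show ?thesis using True by (simp add: rep count_list_append)
  next
    case False
    then have "j \<in> set js" "g i \<noteq> g j" using Cons.prems by auto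
    then show ?thesis using Cons by (simp add: rep count_list_append)
  qed
qed simp

context padic_quaternion
begin

text \<open>The power of \<Theta> with an arbitrary integer exponent, in the form in which it occurs
  as an entry of \<open>pi_block\<close>.\<close>

definition Theta_pow :: "int \<Rightarrow> 'd" where
  "Theta_pow g = scale (\<pi> powi (g div 2)) (if even g then 1 else \<Theta>)"

lemma Theta_pow_nonzero: "Theta_pow g \<noteq> 0"
  and w_Theta_pow: "w (Theta_pow g) = g"
proof -
  have e: "Theta_pow g = emb (\<pi> powi (g div 2)) * (if even g then 1 else \<Theta>)"
    by (simp add: Theta_pow_def emb_mult_left)
  have z: "\<pi> powi (g div 2) \<noteq> 0" using prime_element by simp
  show "Theta_pow g \<noteq> 0" unfolding e using z by simp
  have "w (Theta_pow g) = 2 * (g div 2) + (if even g then 0 else 1)"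
    unfolding e using z prime_element by (subst w_mult) (auto simp: w_emb v_power_int w_one w_Theta)
  then show "w (Theta_pow g) = g" by presburger
qed

lemma Theta_pow_shift: "scale (\<pi> ^ e) (Theta_pow g) = Theta_pow (g + 2 * int e)"
proof -
  have "(g + 2 * int e) div 2 = int e + g div 2" by simp
  then show ?thesis
    using prime_element by (simp add: Theta_pow_def power_int_add)
qed

text \<open>Here \<open>p\<close> and \<open>s\<close> are the permutation and the signs of the monomial matrix.\<close>

definition is_form :: "'d mat \<Rightarrow> int list \<Rightarrow> bool" where
  "is_form M xs \<longleftrightarrow> M \<in> carrier_mat (length xs) (length xs) \<and>
    (\<exists>p s. \<forall>i<length xs. p i < length xs \<and> p (p i) = i \<and> xs ! p i = xs ! i \<and> (s i = 1 \<or> s i = - 1) \<and>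
      (even (xs ! i) \<longrightarrow> p i = i \<and> s i = 1) \<and> (odd (xs ! i) \<longrightarrow> p i \<noteq> i \<and> s (p i) = - s i) \<and>
      (\<forall>j<length xs. M $$ (i, j) = (if j = p i then s i * Theta_pow (xs ! i) else 0)))"

text \<open>The permutation and the signs of the second form are shifted by the length of the first
  list.\<close>

lemma is_form_append:
  assumes "is_form M xs" "is_form M' ys"
  shows "is_form (four_block_mat M (0\<^sub>m (length xs) (length ys)) (0\<^sub>m (length ys) (length xs)) M') (xs @ ys)"
proof -
  let ?n = "length xs" and ?k = "length ys"
  obtain p s where M: "M \<in> carrier_mat ?n ?n" and ps: "\<forall>i<?n. p i < ?n \<and> p (p i) = i \<and> xs ! p i = xs ! i \<and>
      (s i = 1 \<or> s i = - 1) \<and>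
      (even (xs ! i) \<longrightarrow> p i = i \<and> s i = 1) \<and> (odd (xs ! i) \<longrightarrow> p i \<noteq> i \<and> s (p i) = - s i) \<and>
      (\<forall>j<?n. M $$ (i, j) = (if j = p i then s i * Theta_pow (xs ! i) else 0))"
    using assms(1) unfolding is_form_def by blast
  obtain p' s' where M': "M' \<in> carrier_mat ?k ?k" and ps': "\<forall>i<?k. p' i < ?k \<and> p' (p' i) = i \<and> ys ! p' i = ys ! i \<and>
      (s' i = 1 \<or> s' i = - 1) \<and>
      (even (ys ! i) \<longrightarrow> p' i = i \<and> s' i = 1) \<and> (odd (ys ! i) \<longrightarrow> p' i \<noteq> i \<and> s' (p' i) = - s' i) \<and>
      (\<forall>j<?k. M' $$ (i, j) = (if j = p' i then s' i * Theta_pow (ys ! i) else 0))"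
    using assms(2) unfolding is_form_def by blast
  define P where "P i = (if i < ?n then p i else ?n + p' (i - ?n))" for i
  define S where "S i = (if i < ?n then s i else s' (i - ?n))" for i
  let ?F = "four_block_mat M (0\<^sub>m ?n ?k) (0\<^sub>m ?k ?n) M'"
  have "P i < ?n + ?k \<and> P (P i) = i \<and> (xs @ ys) ! P i = (xs @ ys) ! i \<and> (S i = 1 \<or> S i = - 1) \<and>
      (even ((xs @ ys) ! i) \<longrightarrow> P i = i \<and> S i = 1) \<and> (odd ((xs @ ys) ! i) \<longrightarrow> P i \<noteq> i \<and> S (P i) = - S i) \<and>
      (\<forall>j<?n + ?k. ?F $$ (i, j) = (if j = P i then S i * Theta_pow ((xs @ ys) ! i) else 0))"
    if i: "i < ?n + ?k" for i
  proof (cases "i < ?n")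
    case True
    have F: "?F $$ (i, j) = (if j < ?n then M $$ (i, j) else 0)" if "j < ?n + ?k" for j
      using True M M' that by auto
    show ?thesis using ps[rule_format, OF True] True F by (auto simp: P_def S_def nth_append)
  next
    case False
    define i' where "i' = i - ?n"
    have i': "i = ?n + i'" "i' < ?k" using False i by (auto simp: i'_def)
    have F: "?F $$ (i, j) = (if j < ?n then 0 else M' $$ (i', j - ?n))" if "j < ?n + ?k" for j
      using i' M M' that by auto
    have P: "P i = ?n + p' i'" "S i = s' i'" using i' by (auto simp: P_def S_def)
    have "?F $$ (i, j) = (if j = P i then S i * Theta_pow ((xs @ ys) ! i) else 0)" if "j < ?n + ?k" for j
      unfolding F[OF that] P using ps'[rule_format, OF i'(2)] that i' by auto
    then show ?thesis using ps'[rule_format, OF i'(2)] P by (auto simp: P_def S_def nth_append i')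
  qed
  moreover have "?F \<in> carrier_mat (?n + ?k) (?n + ?k)" using M M' by simp
  ultimately show ?thesis unfolding is_form_def length_append by blast
qed

lemma is_form_diag: "list_all2 is_form Ms xss \<Longrightarrow> is_form (diag_block_mat Ms) (concat xss)"
proof (induction rule: list_all2_induct)
  case Nil
  show ?case by (simp add: is_form_def)
next
  case (Cons M Ms xs xss)
  have "M \<in> carrier_mat (length xs) (length xs)"
    "diag_block_mat Ms \<in> carrier_mat (length (concat xss)) (length (concat xss))"
    using Cons by (auto simp: is_form_def)
  then show ?case using is_form_append[OF Cons(1,3)] by (simp add: Let_def)
qed

lemma is_form_block:
  assumes "odd g \<Longrightarrow> even m" shows "is_form (pi_block g m) (replicate m g)"
proof (cases "even g")
  case True
  let ?c = "\<pi> powi (g div 2)"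
  have "pi_block g m = scale ?c 1 \<cdot>\<^sub>m 1\<^sub>m m" using True by (simp add: pi_block_def Let_def)
  then show ?thesis using True unfolding is_form_def
    by (intro conjI exI[of _ "\<lambda>i. i"] exI[of _ "\<lambda>_. 1"]) (auto simp: Theta_pow_def)
next
  case False
  let ?c = "\<pi> powi (g div 2)"
  let ?B = "mat_of_rows_list 2 [[0, scale ?c \<Theta>], [- scale ?c \<Theta>, 0]]"
  have B: "is_form ?B [g, g]" unfolding is_form_def
  \<comment> \<open>The map \<open>1 - i\<close> on naturals exchanges 0 and 1; the sign is 1 in the
    first row and -1 in the second.\<close>
  proof (intro conjI exI[of _ "\<lambda>i. 1 - i"] exI[of _ "\<lambda>i. if i = 0 then 1 else - 1"])
    show "?B \<in> carrier_mat (length [g, g]) (length [g, g])"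
      by (simp add: mat_of_rows_list_def numeral_2_eq_2)
    have two: "i < length [g, g] \<longleftrightarrow> i = 0 \<or> i = 1" for i :: nat by auto
    show "\<forall>i<length [g, g]. 1 - i < length [g, g] \<and> 1 - (1 - i) = i \<and> [g, g] ! (1 - i) = [g, g] ! i \<and>
        ((if i = 0 then 1 else - 1 :: 'd) = 1 \<or> (if i = 0 then 1 else - 1 :: 'd) = - 1) \<and>
        (even ([g, g] ! i) \<longrightarrow> 1 - i = i \<and> (if i = 0 then 1 else - 1 :: 'd) = 1) \<and>
        (odd ([g, g] ! i) \<longrightarrow> 1 - i \<noteq> i \<and> (if 1 - i = 0 then 1 else - 1 :: 'd) = - (if i = 0 then 1 else - 1)) \<and>
        (\<forall>j<length [g, g]. ?B $$ (i, j) =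
          (if j = 1 - i then (if i = 0 then 1 else - 1) * Theta_pow ([g, g] ! i) else 0))"
      unfolding two using False by (auto simp: mat_of_rows_list_def Theta_pow_def)
  qed
  have "list_all2 is_form (replicate k ?B) (replicate k [g, g])" for k
    using B by (simp add: list_all2_conv_all_nth)
  from is_form_diag[OF this, of "m div 2"]
  have "is_form (pi_block g m) (concat (replicate (m div 2) [g, g]))"
    using False by (simp add: pi_block_def Let_def)
  moreover have "concat (replicate k [g, g]) = replicate (2 * k) g" for k by (induction k) auto
  ultimately show ?thesis using assms[OF False] by simp
qed

text \<open>As \<pi> is central and the square of \<Theta>, scaling shifts all exponents by
  \<open>2 * e\<close>, which preserves parities and hence the pairing.\<close>

lemma is_form_scale:
  assumes "is_form M xs" shows "is_form (map_mat (scale (\<pi> ^ e)) M) (map (\<lambda>x. x + 2 * int e) xs)"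
proof -
  obtain p s where M: "M \<in> carrier_mat (length xs) (length xs)"
    and ps: "\<forall>i<length xs. p i < length xs \<and> p (p i) = i \<and> xs ! p i = xs ! i \<and>
      (s i = 1 \<or> s i = - 1) \<and>
      (even (xs ! i) \<longrightarrow> p i = i \<and> s i = 1) \<and> (odd (xs ! i) \<longrightarrow> p i \<noteq> i \<and> s (p i) = - s i) \<and>
      (\<forall>j<length xs. M $$ (i, j) = (if j = p i then s i * Theta_pow (xs ! i) else 0))"
    using assms unfolding is_form_def by blast
  have sc: "scale (\<pi> ^ e) (x * Theta_pow g) = x * Theta_pow (g + 2 * int e)" for x g
    by (simp add: scale_mult_right flip: Theta_pow_shift)
  show ?thesis unfolding is_form_def
  proof (intro conjI exI[of _ p] exI[of _ s])
    show "\<forall>i<length (map (\<lambda>x. x + 2 * int e) xs).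
        p i < length (map (\<lambda>x. x + 2 * int e) xs) \<and> p (p i) = i \<and>
        map (\<lambda>x. x + 2 * int e) xs ! p i = map (\<lambda>x. x + 2 * int e) xs ! i \<and>
        (s i = 1 \<or> s i = - 1) \<and>
        (even (map (\<lambda>x. x + 2 * int e) xs ! i) \<longrightarrow> p i = i \<and> s i = 1) \<and>
        (odd (map (\<lambda>x. x + 2 * int e) xs ! i) \<longrightarrow> p i \<noteq> i \<and> s (p i) = - s i) \<and>
        (\<forall>j<length (map (\<lambda>x. x + 2 * int e) xs). map_mat (scale (\<pi> ^ e)) M $$ (i, j) =
          (if j = p i then s i * Theta_pow (map (\<lambda>x. x + 2 * int e) xs ! i) else 0))"
      using ps M by (auto simp: sc)
  qed (use M in simp)
qed

end

lemma (in monomial_form) Theta_pow_nat: "0 \<le> g \<Longrightarrow> Theta_pow g = \<Theta> ^ nat g"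
proof -
  assume g: "0 \<le> g"
  define k where "k = nat (g div 2)"
  have k: "\<pi> powi (g div 2) = \<pi> ^ k" using g by (simp add: k_def power_int_def)
  have e: "nat g = 2 * k + (if even g then 0 else 1)"
    using g unfolding k_def by (cases "even g") (auto elim!: evenE oddE simp: nat_add_distrib nat_mult_distrib)
  show ?thesis
    unfolding Theta_pow_def k e using Theta_power_even[of k]
    by (simp add: emb_mult_left[symmetric] emb_commute[of \<Theta>])
qed

lemma (in monomial_form) A_in_X_int: "A \<in> X_int n"
proof -
  have "invertible_mat A"
    unfolding invertible_mat_def inverts_mat_def square_mat.simps
    by (intro conjI exI[of _ Ainv]) (simp_all add: A_Ainv Ainv_A)
  then show ?thesis using Mo_A(1) by (simp add: X_int_def X_def adjoint_A O_eq[symmetric])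
qed

context padic_quaternion
begin

lemma is_form_monomial:
  assumes f: "is_form M xs" and nn: "\<And>i. i < length xs \<Longrightarrow> 0 \<le> xs ! i"
  obtains p s where
    "monomial_form v scale star \<O> \<P> \<pi> \<Theta> \<epsilon> (length xs) (\<lambda>i. nat (xs ! i)) p s"
    "monomial_form.A \<Theta> (length xs) (\<lambda>i. nat (xs ! i)) p s = M"
proof -
  obtain p s where M: "M \<in> carrier_mat (length xs) (length xs)"
    and ps: "\<forall>i<length xs. p i < length xs \<and> p (p i) = i \<and> xs ! p i = xs ! i \<and>
      (s i = 1 \<or> s i = - 1) \<and>
      (even (xs ! i) \<longrightarrow> p i = i \<and> s i = 1) \<and> (odd (xs ! i) \<longrightarrow> p i \<noteq> i \<and> s (p i) = - s i) \<and>
      (\<forall>j<length xs. M $$ (i, j) = (if j = p i then s i * Theta_pow (xs ! i) else 0))"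
    using f unfolding is_form_def by blast
  have par: "even (nat (xs ! i)) \<longleftrightarrow> even (xs ! i)" if "i < length xs" for i
    using nn[OF that] by (simp add: even_nat_iff)
  interpret F: monomial_form v scale star \<O> \<P> \<pi> \<Theta> \<epsilon> "length xs" "\<lambda>i. nat (xs ! i)" p s
    by unfold_locales (use ps par in \<open>auto\<close>)
  have "F.A = M"
  proof (rule eq_matI)
    fix i j assume "i < dim_row M" "j < dim_col M"
    then have ij: "i < length xs" "j < length xs" using M by auto
    then show "F.A $$ (i, j) = M $$ (i, j)"
      using ps nn[OF ij(1)] by (simp add: F.A_def F.Theta_pow_nat)
  qed (use M in auto)
  then show ?thesis using that F.monomial_form_axioms by blast
qed

text \<open>Row \<open>i\<close> has an entry of valuation \<open>xs ! i\<close>. The criterion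
  decides which clearing exponents the choice in \<open>density\<close> can return.\<close>

lemma is_form_X_int_iff:
  assumes f: "is_form M xs" shows "M \<in> X_int (length xs) \<longleftrightarrow> (\<forall>i<length xs. 0 \<le> xs ! i)"
proof
  assume "\<forall>i<length xs. 0 \<le> xs ! i"
  then obtain p s where
    m: "monomial_form v scale star \<O> \<P> \<pi> \<Theta> \<epsilon> (length xs) (\<lambda>i. nat (xs ! i)) p s"
    "monomial_form.A \<Theta> (length xs) (\<lambda>i. nat (xs ! i)) p s = M"
    using is_form_monomial[OF f] by blast
  interpret F: monomial_form v scale star \<O> \<P> \<pi> \<Theta> \<epsilon> "length xs" "\<lambda>i. nat (xs ! i)" p s by (rule m(1))
  show "M \<in> X_int (length xs)" using F.A_in_X_int m(2) by simp
next
  assume M: "M \<in> X_int (length xs)"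
  show "\<forall>i<length xs. 0 \<le> xs ! i"
  proof (intro allI impI)
    fix i assume i: "i < length xs"
    obtain j x where jx: "j < length xs" "x = 1 \<or> x = - 1" "M $$ (i, j) = x * Theta_pow (xs ! i)"
      using f i unfolding is_form_def by metis
    have "M $$ (i, j) \<in> \<O>" using M i jx(1) by (simp add: X_int_def matrices_over_def)
    then have "M $$ (i, j) \<in> PP 0" by (simp only: O_eq)
    then have "Theta_pow (xs ! i) \<in> PP 0" using jx(2,3) PP_minus[of "- Theta_pow (xs ! i)" 0] by auto
    then show "0 \<le> xs ! i" using Theta_pow_nonzero by (simp add: PP_iff w_Theta_pow)
  qed
qed

text \<open>Whichever \<open>e\<close> is chosen, the shift by \<open>2 * e\<close> raises twice the
  weighted sum by \<open>2 * e * n * (n - 1)\<close> and the sum of the rounded halves by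
  \<open>e * n\<close>, together the normalising exponent \<open>e * n * (2 * n - 1)\<close>.
  Rounding down loses one half for each odd part and the symplectic groups add one, which leaves one
  half.\<close>

lemma density_is_form:
  assumes f: "is_form M xs" and sorted: "\<And>i j. i \<le> j \<Longrightarrow> j < length xs \<Longrightarrow> xs ! j \<le> xs ! i"
    and n: "1 \<le> length xs"
  shows "density (length xs) (length xs) M M =
    real q powr (2 * real_of_int (n_stat xs) + real_of_int (\<Sum>i<length xs. xs ! i) / 2
      + real (card {i. i < length xs \<and> odd (xs ! i)}) / 2) *
    (\<Prod>g\<in>set xs. if even g then w_poly (count_list xs g) (- (1 / real q))
      else w_poly (count_list xs g div 2) (1 / real q ^ 4))"
proof -
  let ?n = "length xs"
  define e where "e = (SOME e. map_mat (scale (\<pi> ^ e)) M \<in> X_int ?n \<and> map_mat (scale (\<pi> ^ e)) M \<in> X_int ?n)"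
  define ys where "ys = map (\<lambda>x. x + 2 * int e) xs"
  define M' where "M' = map_mat (scale (\<pi> ^ e)) M"
  have iff: "map_mat (scale (\<pi> ^ e)) M \<in> X_int ?n \<longleftrightarrow> (\<forall>i<?n. 0 \<le> xs ! i + 2 * int e)" for e
    using is_form_X_int_iff[OF is_form_scale[OF f, of e]] by simp
  have "\<exists>e. map_mat (scale (\<pi> ^ e)) M \<in> X_int ?n \<and> map_mat (scale (\<pi> ^ e)) M \<in> X_int ?n"
  proof -
    have "0 \<le> xs ! i + 2 * int (nat (\<Sum>i<?n. \<bar>xs ! i\<bar>))" if "i < ?n" for i
    proof -
      have "\<bar>xs ! i\<bar> \<le> (\<Sum>i<?n. \<bar>xs ! i\<bar>)" by (rule member_le_sum) (use that in auto)
      then show ?thesis by linarith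
    qed
    then show ?thesis using iff by blast
  qed
  from someI_ex[OF this] have "M' \<in> X_int ?n" unfolding M'_def e_def by blast
  then have nn: "0 \<le> xs ! i + 2 * int e" if "i < ?n" for i using iff that unfolding M'_def by blast
  have len: "length ys = ?n" by (simp add: ys_def)
  have ynn: "0 \<le> ys ! i" if "i < length ys" for i using nn that by (simp add: ys_def)
  have "is_form M' ys" unfolding M'_def ys_def by (rule is_form_scale[OF f])
  then obtain p s where
    m: "monomial_form v scale star \<O> \<P> \<pi> \<Theta> \<epsilon> (length ys) (\<lambda>i. nat (ys ! i)) p s"
    "monomial_form.A \<Theta> (length ys) (\<lambda>i. nat (ys ! i)) p s = M'"
    using is_form_monomial ynn by blast
  interpret F: monomial_form v scale star \<O> \<P> \<pi> \<Theta> \<epsilon> ?n "\<lambda>i. nat (ys ! i)" p s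
    using m(1) by (simp add: len)
  have A: "F.A = M'" using m(2) by (simp add: len)
  have y: "int (nat (ys ! i)) = xs ! i + 2 * int e" if "i < ?n" for i
    using nn[OF that] that by (simp add: ys_def)
  have sorted': "nat (ys ! j) \<le> nat (ys ! i)" if "i \<le> j" "j < ?n" for i j
    using sorted[OF that] that by (simp add: ys_def)
  have q: "real q > 0" using residue_card_pos by (simp add: q_eq)
  have nat: "nat (ys ! i) = nat (xs ! i + 2 * int e)" if "i < ?n" for i using that by (simp add: ys_def)
  have odd: "{i. i < ?n \<and> odd (nat (ys ! i))} = {i. i < ?n \<and> odd (xs ! i)}"
    using nn by (auto simp: nat even_nat_iff)
  have prod: "(\<Prod>g\<in>(\<lambda>i. nat (ys ! i)) ` {..<?n}. F.c_fac g) =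
    (\<Prod>g\<in>set xs. if even g then w_poly (count_list xs g) (- (1 / real q))
      else w_poly (count_list xs g div 2) (1 / real q ^ 4))"
  proof -
    have xnn: "0 \<le> g + 2 * int e" if "g \<in> set xs" for g using that nn by (auto simp: in_set_conv_nth)
    have img: "(\<lambda>i. nat (ys ! i)) ` {..<?n} = (\<lambda>g. nat (g + 2 * int e)) ` set xs"
    proof -
      have "set xs = (!) xs ` {..<?n}" by (auto simp: set_conv_nth)
      then have "(\<lambda>g. nat (g + 2 * int e)) ` set xs = (\<lambda>i. nat (xs ! i + 2 * int e)) ` {..<?n}"
        by (simp add: image_image)
      moreover have "(\<lambda>i. nat (ys ! i)) ` {..<?n} = (\<lambda>i. nat (xs ! i + 2 * int e)) ` {..<?n}"
        by (rule image_cong[OF refl]) (simp add: nat)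
      ultimately show ?thesis by simp
    qed
    have inj: "inj_on (\<lambda>g. nat (g + 2 * int e)) (set xs)"
    proof (rule inj_onI)
      fix x y assume "x \<in> set xs" "y \<in> set xs" "nat (x + 2 * int e) = nat (y + 2 * int e)"
      then show "x = y" using xnn[of x] xnn[of y] by simp
    qed
    have "F.c_fac (nat (g + 2 * int e)) = (if even g then w_poly (count_list xs g) (- (1 / real q))
      else w_poly (count_list xs g div 2) (1 / real q ^ 4))" if g: "g \<in> set xs" for g
    proof -
      have "F.blkv (nat (g + 2 * int e)) = {i. i < ?n \<and> g = xs ! i}"
      proof -
        have "nat (xs ! i + 2 * int e) = nat (g + 2 * int e) \<longleftrightarrow> g = xs ! i" if "i < ?n" for i
          using xnn[OF g] nn[OF that] by auto
        then show ?thesis by (auto simp: F.blkv_def nat)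
      qed
      then have "card (F.blkv (nat (g + 2 * int e))) = count_list xs g"
        by (simp add: count_list_eq_length_filter length_filter_conv_card)
      moreover have "even (nat (g + 2 * int e)) \<longleftrightarrow> even g" using xnn[OF g] by (simp add: even_nat_iff)
      ultimately show ?thesis by (simp add: F.c_fac_def)
    qed
    then show ?thesis unfolding img by (simp add: prod.reindex[OF inj])
  qed
  have exponents: "2 * (\<Sum>j<?n. real j * real (nat (ys ! j))) + (\<Sum>j<?n. real_of_int (int (nat (ys ! j)) div 2))
      + real (card {i. i < ?n \<and> odd (nat (ys ! i))}) - real (e * ?n * (2 * ?n - 1)) =
    2 * real_of_int (n_stat xs) + real_of_int (\<Sum>i<?n. xs ! i) / 2
      + real (card {i. i < ?n \<and> odd (xs ! i)}) / 2"
  proof -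
    let ?o = "\<lambda>j. if odd (xs ! j) then 1 else 0 :: real"
    have 1: "(\<Sum>j<?n. real j * real (nat (ys ! j))) =
        real_of_int (n_stat xs) + real e * (real ?n * (real ?n - 1))"
    proof -
      have r: "real (nat (ys ! j)) = real_of_int (xs ! j) + 2 * real e" if "j < ?n" for j
      proof -
        have "real (nat (ys ! j)) = real_of_int (int (nat (ys ! j)))"
          by (rule of_int_of_nat_eq[symmetric])
        then show ?thesis unfolding y[OF that] by simp
      qed
      have "(\<Sum>j<?n. real j * real (nat (ys ! j))) =
          (\<Sum>j<?n. real j * real_of_int (xs ! j) + real e * (2 * real j))"
        by (intro sum.cong refl) (simp add: r algebra_simps)
      also have "\<dots> = real_of_int (n_stat xs) + real e * (\<Sum>j<?n. 2 * real j)"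
        by (simp add: n_stat_def sum.distrib sum_distrib_left)
      also have "(\<Sum>j<k. 2 * real j) = real k * (real k - 1)" for k
        by (induction k) (simp_all add: algebra_simps)
      finally show ?thesis .
    qed
    have 2: "(\<Sum>j<?n. real_of_int (int (nat (ys ! j)) div 2)) =
        real_of_int (\<Sum>i<?n. xs ! i) / 2 - real (card {i. i < ?n \<and> odd (xs ! i)}) / 2 + real ?n * real e"
    proof -
      have h: "real_of_int (int (nat (ys ! j)) div 2) = real_of_int (xs ! j) / 2 - ?o j / 2 + real e"
        if "j < ?n" for j
      proof -
        have "(xs ! j + 2 * int e) div 2 = xs ! j div 2 + int e" by simp
        moreover have "real_of_int (xs ! j div 2) = real_of_int (xs ! j) / 2 - ?o j / 2"
          by (cases "even (xs ! j)") (auto elim!: evenE oddE simp: field_simps)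
        ultimately show ?thesis unfolding y[OF that] by simp
      qed
      have "(\<Sum>j<?n. real_of_int (int (nat (ys ! j)) div 2)) =
          (\<Sum>j<?n. real_of_int (xs ! j) / 2 - ?o j / 2 + real e)"
        by (rule sum.cong[OF refl]) (rule h, simp)
      also have "\<dots> = (\<Sum>j<?n. real_of_int (xs ! j)) / 2 - (\<Sum>j<?n. ?o j) / 2 + real ?n * real e"
        by (simp add: sum.distrib sum_subtractf sum_divide_distrib)
      also have "(\<Sum>j<?n. ?o j) = real (card {i. i < ?n \<and> odd (xs ! i)})"
        by (simp add: sum.If_cases Int_def)
      finally show ?thesis by simp
    qed
    have 3: "real (e * ?n * (2 * ?n - 1)) = real e * real ?n * (2 * real ?n - 1)"
      using n by (simp add: of_nat_diff)
    show ?thesis unfolding 1 2 3 odd by (simp add: field_simps)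
  qed
  have pd: "x powr b * P / x ^ k = x powr (b - real k) * P" if "x > 0" for x b P :: real and k
    using that by (simp add: powr_diff powr_realpow)
  have "density ?n ?n M M = density_int ?n ?n F.A F.A / real q ^ (e * ?n * (2 * ?n - 1))"
    unfolding density_def Let_def e_def[symmetric] A M'_def ..
  also have "density_int ?n ?n F.A F.A = real q powr (2 * (\<Sum>j<?n. real j * real (nat (ys ! j)))
      + (\<Sum>j<?n. real_of_int (int (nat (ys ! j)) div 2)) + real (card {i. i < ?n \<and> odd (nat (ys ! i))})) *
      (\<Prod>g\<in>(\<lambda>i. nat (ys ! i)) ` {..<?n}. F.c_fac g)"
    by (rule F.density_int_formula[OF sorted' n])
  finally show ?thesis unfolding pd[OF q] exponents prod .
qed

end

theorem theorem2p3:
  fixes v :: "'k::field_char_0 \<Rightarrow> int"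
    and scale :: "'k \<Rightarrow> 'd::division_ring \<Rightarrow> 'd"
    and star :: "'d \<Rightarrow> 'd"
    and \<O> \<P> :: "'d set" and \<pi> :: 'k and \<Theta> \<epsilon> :: 'd
    and n r :: nat and \<alpha> :: "int list"
    and \<gamma> :: "nat \<Rightarrow> int" and m :: "nat \<Rightarrow> nat" and q :: real
  assumes "padic_quaternion v scale star \<O> \<P> \<pi> \<Theta> \<epsilon>"
    and "n \<ge> 1"
    and "\<alpha> \<in> Lambda n"
    and "\<alpha> = concat (map (\<lambda>j. replicate (m j) (\<gamma> j)) [1..<Suc r])"
    and "\<And>i j. 1 \<le> i \<Longrightarrow> i < j \<Longrightarrow> j \<le> r \<Longrightarrow> \<gamma> i > \<gamma> j"
    and "\<And>j. 1 \<le> j \<Longrightarrow> j \<le> r \<Longrightarrow> m j > 0"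
    and "(\<Sum>j=1..r. m j) = n"
    and "q = real (residue_card v)"
  shows "padic_quaternion.density v scale star \<O> \<P> \<pi> n n
           (padic_quaternion.pi_pow scale \<pi> \<Theta> \<alpha>) (padic_quaternion.pi_pow scale \<pi> \<Theta> \<alpha>) =
         q powr (2 * real_of_int (n_stat \<alpha>) + real_of_int (\<Sum>i<n. \<alpha> ! i) / 2
                 + real (card {i. i < n \<and> odd (\<alpha> ! i)}) / 2)
         * (\<Prod>j=1..r. if even (\<gamma> j) then w_poly (m j) (- (1 / q)) else w_poly (m j div 2) (1 / q ^ 4))"
proof -
  interpret padic_quaternion v scale star \<O> \<P> \<pi> \<Theta> \<epsilon> by (rule assms(1))
  have len: "length \<alpha> = n" using assms(3) by (simp add: Lambda_def)
  have inj: "inj_on \<gamma> {1..r}"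
  proof (rule linorder_inj_onI')
    fix i j assume "i \<in> {1..r}" "j \<in> {1..r}" "i < j"
    then show "\<gamma> i \<noteq> \<gamma> j" using assms(5)[of i j] by simp
  qed
  have set: "set \<alpha> = \<gamma> ` {1..r}"
    using assms(6) by (auto simp: assms(4) image_iff Suc_le_eq less_Suc_eq_le)
  have dist: "distinct (map \<gamma> [1..<Suc r])"
    using inj by (simp add: distinct_map atLeastLessThanSuc_atLeastAtMost del: upt_Suc)
  have count: "count_list \<alpha> (\<gamma> j) = m j" if "j \<in> {1..r}" for j
    unfolding assms(4) using that by (intro count_list_concat_replicate[OF dist]) (auto simp del: upt_Suc)
  \<comment> \<open>The values \<gamma> decrease, so \<open>pi_pow\<close>, which sorts its blocks
    in descending order, lists them in the order of the given decomposition.\<close>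
  have desc: "rev (sorted_list_of_set (set \<alpha>)) = map \<gamma> [1..<Suc r]"
  proof -
    have "sorted_wrt (<) (rev (map \<gamma> [1..<Suc r]))"
      unfolding sorted_wrt_rev sorted_wrt_map
      by (rule sorted_wrt_mono_rel[OF _ sorted_wrt_upt]) (use assms(5) in auto)
    then have "sorted (rev (map \<gamma> [1..<Suc r]))" "distinct (rev (map \<gamma> [1..<Suc r]))"
      by (simp_all add: strict_sorted_iff del: upt_Suc)
    moreover have "set (rev (map \<gamma> [1..<Suc r])) = set \<alpha>"
      unfolding set by (simp add: atLeastLessThanSuc_atLeastAtMost del: upt_Suc)
    ultimately have "sorted_list_of_set (set \<alpha>) = rev (map \<gamma> [1..<Suc r])"
      by (metis sorted_list_of_set.idem_if_sorted_distinct)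
    then show ?thesis by simp
  qed
  \<comment> \<open>The parity condition of \<open>Lambda\<close> counts positions with a given
    value; for the value \<open>\<gamma> j\<close> there are \<open>m j\<close> of them, and so an
    odd block splits into planes.\<close>
  have even_m: "even (m j)" if j: "j \<in> {1..r}" "odd (\<gamma> j)" for j
  proof -
    have "\<gamma> j \<in> set \<alpha>" using set j by simp
    then obtain i where i: "i < n" "\<alpha> ! i = \<gamma> j" using len by (auto simp: in_set_conv_nth)
    have "\<forall>i<n. odd (\<alpha> ! i) \<longrightarrow> even (card {j. j < n \<and> \<alpha> ! j = \<alpha> ! i})"
      using assms(3) by (simp add: Lambda_def)
    then have "odd (\<alpha> ! i) \<longrightarrow> even (card {j. j < n \<and> \<alpha> ! j = \<alpha> ! i})" using i(1) by blast
    then have "even (card {j'. j' < n \<and> \<alpha> ! j' = \<alpha> ! i})" using i(2) j(2) by simp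
    moreover have "{j'. j' < n \<and> \<alpha> ! j' = \<alpha> ! i} = {j'. j' < length \<alpha> \<and> \<gamma> j = \<alpha> ! j'}"
      using i len by auto
    ultimately show ?thesis
      using count[OF j(1)] by (simp add: count_list_eq_length_filter length_filter_conv_card)
  qed
  have form: "is_form (pi_pow \<alpha>) \<alpha>"
  proof -
    have "list_all2 is_form (map (\<lambda>g. pi_block g (count_list \<alpha> g)) (map \<gamma> [1..<Suc r]))
      (map (\<lambda>j. replicate (m j) (\<gamma> j)) [1..<Suc r])"
      unfolding list_all2_map1 list_all2_map2 list.map_comp
    proof (rule list.rel_refl_strong)
      fix j assume "j \<in> set [1..<Suc r]"
      then have j: "j \<in> {1..r}" by auto
      then have "is_form (pi_block (\<gamma> j) (count_list \<alpha> (\<gamma> j))) (replicate (m j) (\<gamma> j))"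
        unfolding count[OF j] by (rule is_form_block[OF even_m])
      then show "is_form (((\<lambda>g. pi_block g (count_list \<alpha> g)) \<circ> \<gamma>) j) (replicate (m j) (\<gamma> j))" by simp
    qed
    from is_form_diag[OF this] show ?thesis unfolding pi_pow_def desc assms(4)[symmetric] .
  qed
  have sorted: "\<alpha> ! j \<le> \<alpha> ! i" if "i \<le> j" "j < length \<alpha>" for i j
  proof (cases "i = j")
    case False
    then show ?thesis using assms(3) that sorted_wrt_nth_less[of "(\<ge>)" \<alpha> i j] by (simp add: Lambda_def)
  qed simp
  have n1: "1 \<le> length \<alpha>" using len assms(2) by simp
  have rq: "real (padic_quaternion.q v) = q" by (simp add: q_eq assms(8))
  from density_is_form[OF form sorted n1]
  have "density n n (pi_pow \<alpha>) (pi_pow \<alpha>) =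
    q powr (2 * real_of_int (n_stat \<alpha>) + real_of_int (\<Sum>i<n. \<alpha> ! i) / 2
      + real (card {i. i < n \<and> odd (\<alpha> ! i)}) / 2) *
    (\<Prod>g\<in>set \<alpha>. if even g then w_poly (count_list \<alpha> g) (- (1 / q))
      else w_poly (count_list \<alpha> g div 2) (1 / q ^ 4))"
    unfolding len rq by simp
  also have "(\<Prod>g\<in>set \<alpha>. if even g then w_poly (count_list \<alpha> g) (- (1 / q))
      else w_poly (count_list \<alpha> g div 2) (1 / q ^ 4)) =
    (\<Prod>j=1..r. if even (\<gamma> j) then w_poly (m j) (- (1 / q)) else w_poly (m j div 2) (1 / q ^ 4))"
    unfolding set by (subst prod.reindex[OF inj]) (auto simp: count intro!: prod.cong)
  finally show ?thesis by simp
qed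

end
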